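(* Let $H$ be a fixed bi-arc graph which contains no irreflexive edge and no set of $3$ vertices with private neighbors. Then $\textsc{LHomED}(H)$ can be solved in polynomial time.
   Context: Graphs may have loops; irreflexive = no loop; an irreflexive edge joins two distinct irreflexive vertices. A set $U$ has private neighbors if each $u\in U$ has a neighbor adjacent to no other vertex of $U$. Bi-arc graphs: let $C$ be a circle with top-most point $p$ and bottom-most point $q$; a bi-arc is a pair $(N,S)$ of arcs with $p\in N$, $q\notin N$, $q\in S$, $p\notin S$. $H$ is bi-arc if each vertex $x$ can be assigned a bi-arc $(N_x,S_x)$ so that for all $x,y$: if $xy\in E(H)$ then $N_x\cap S_y=N_y\cap S_x=\emptyset$, and if $xy\notin E(H)$ then both $N_x\cap S_y$ and $N_y\cap S_x$ are nonempty. $\textsc{LHomED}(H)$: given a graph $G$ and lists $L:V(G)\to2^{V(H)}$, find a minimum-size $X\subseteq E(G)$ such that there is $f:V(G)\to V(H)$ with $f(v)\in L(v)$ for all $v$ and $f(u)f(v)\in E(H)$ for all $uv\in E(G)\setminus X$. *)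

theory Defs
  imports Complex_Main "HOL-Computational_Algebra.Polynomial"
begin

section \<open>Graphs\<close>

text \<open>Finite undirected graphs without parallel edges. An edge is the set of its endpoints, so
  that a loop at \<open>v\<close> is the singleton \<open>{v, v} = {v}\<close>, and \<open>card\<close> counts undirected edges.\<close>

record 'a ugraph =
  verts :: "'a set"
  edges :: "'a set set"

definition is_graph :: "'a ugraph \<Rightarrow> bool" where
  "is_graph G \<longleftrightarrow> finite (verts G) \<and>
     (\<forall>e\<in>edges G. \<exists>u\<in>verts G. \<exists>v\<in>verts G. e = {u, v})"

definition adj :: "'a ugraph \<Rightarrow> 'a \<Rightarrow> 'a \<Rightarrow> bool" where
  "adj G u v \<longleftrightarrow> {u, v} \<in> edges G"

definition irreflexive_vertex :: "'a ugraph \<Rightarrow> 'a \<Rightarrow> bool" where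
  "irreflexive_vertex G v \<longleftrightarrow> v \<in> verts G \<and> \<not> adj G v v"

definition irreflexive_edge :: "'a ugraph \<Rightarrow> 'a \<Rightarrow> 'a \<Rightarrow> bool" where
  "irreflexive_edge G u v \<longleftrightarrow>
     adj G u v \<and> u \<noteq> v \<and> irreflexive_vertex G u \<and> irreflexive_vertex G v"

text \<open>A private neighbour of \<open>u\<close> may itself belong to \<open>U\<close>; in particular it may be \<open>u\<close>, if \<open>u\<close>
  has a loop.\<close>

definition has_private_neighbors :: "'a ugraph \<Rightarrow> 'a set \<Rightarrow> bool" where
  "has_private_neighbors G U \<longleftrightarrow>
     (\<forall>u\<in>U. \<exists>w\<in>verts G. adj G u w \<and> (\<forall>u'\<in>U - {u}. \<not> adj G u' w))"


section \<open>Bi-arc graphs\<close>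

text \<open>The circle is the unit circle of the complex plane, with top-most point \<open>\<i>\<close> and bottom-most
  point \<open>- \<i>\<close>. Arcs are closed and have more than one point.\<close>

definition circle_arc :: "complex set \<Rightarrow> bool" where
  "circle_arc A \<longleftrightarrow> (\<exists>a b::real. a < b \<and> A = cis ` {a..b})"

definition is_bi_arc :: "complex set \<Rightarrow> complex set \<Rightarrow> bool" where
  "is_bi_arc N S \<longleftrightarrow> circle_arc N \<and> circle_arc S \<and>
     \<i> \<in> N \<and> - \<i> \<notin> N \<and> - \<i> \<in> S \<and> \<i> \<notin> S"

definition bi_arc_graph :: "'a ugraph \<Rightarrow> bool" where
  "bi_arc_graph H \<longleftrightarrow> (\<exists>N S.
     (\<forall>x\<in>verts H. is_bi_arc (N x) (S x)) \<and>
     (\<forall>x\<in>verts H. \<forall>y\<in>verts H.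
        (adj H x y \<longrightarrow> N x \<inter> S y = {} \<and> N y \<inter> S x = {}) \<and>
        (\<not> adj H x y \<longrightarrow> N x \<inter> S y \<noteq> {} \<and> N y \<inter> S x \<noteq> {})))"


section \<open>Polynomial time\<close>

text \<open>The machine model is a random access machine with uniform cost: finitely many registers (those
  mentioned in the program) and an unbounded memory, all holding natural numbers. Its
  instructions are those of Cook and Reckhow, with structured control flow in place of jumps;
  \<open>Sub\<close> is truncated. As addition and subtraction are the only arithmetic operations, numbers
  have length at most linear in the input size plus the number of steps, and therefore uniform-cost
  running time is polynomially related to Turing machine time.\<close>

type_synonym reg = nat

datatype ram_prog =
    Const reg nat
  | Add reg reg reg
  | Sub reg reg reg
  | Load reg reg          \<comment> \<open>\<open>Load r a\<close>: register \<open>r\<close> gets the memory cell addressed by register \<open>a\<close>\<close>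
  | Store reg reg         \<comment> \<open>\<open>Store a r\<close>: the memory cell addressed by register \<open>a\<close> gets register \<open>r\<close>\<close>
  | Seq ram_prog ram_prog
  | IfNZ reg ram_prog ram_prog
  | WhileNZ reg ram_prog

type_synonym ram_state = "(reg \<Rightarrow> nat) \<times> (nat \<Rightarrow> nat)"  \<comment> \<open>registers and memory\<close>

text \<open>\<open>ram_exec c s t s'\<close>: started in \<open>s\<close>, the program \<open>c\<close> halts after exactly \<open>t\<close> steps in \<open>s'\<close>.\<close>

inductive ram_exec :: "ram_prog \<Rightarrow> ram_state \<Rightarrow> nat \<Rightarrow> ram_state \<Rightarrow> bool" where
  Const: "ram_exec (Const r k) (\<rho>, m) 1 (\<rho>(r := k), m)"
| Add: "ram_exec (Add r a b) (\<rho>, m) 1 (\<rho>(r := \<rho> a + \<rho> b), m)"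
| Sub: "ram_exec (Sub r a b) (\<rho>, m) 1 (\<rho>(r := \<rho> a - \<rho> b), m)"
| Load: "ram_exec (Load r a) (\<rho>, m) 1 (\<rho>(r := m (\<rho> a)), m)"
| Store: "ram_exec (Store a r) (\<rho>, m) 1 (\<rho>, m(\<rho> a := \<rho> r))"
| Seq: "ram_exec c s t s' \<Longrightarrow> ram_exec d s' t' s'' \<Longrightarrow> ram_exec (Seq c d) s (t + t') s''"
| IfTrue: "fst s r \<noteq> 0 \<Longrightarrow> ram_exec c s t s' \<Longrightarrow> ram_exec (IfNZ r c d) s (Suc t) s'"
| IfFalse: "fst s r = 0 \<Longrightarrow> ram_exec d s t s' \<Longrightarrow> ram_exec (IfNZ r c d) s (Suc t) s'"
| WhileFalse: "fst s r = 0 \<Longrightarrow> ram_exec (WhileNZ r c) s 1 s"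
| WhileTrue: "fst s r \<noteq> 0 \<Longrightarrow> ram_exec c s t s' \<Longrightarrow> ram_exec (WhileNZ r c) s' t' s'' \<Longrightarrow>
    ram_exec (WhileNZ r c) s (Suc (t + t')) s''"

text \<open>Input and output are bit strings: cell \<open>0\<close> holds the length, cell \<open>i + 1\<close> holds bit \<open>i\<close>. All
  registers and all other memory cells are initially \<open>0\<close>.\<close>

definition input_memory :: "bool list \<Rightarrow> nat \<Rightarrow> nat" where
  "input_memory x a =
     (case a of 0 \<Rightarrow> length x | Suc i \<Rightarrow> if i < length x then of_bool (x ! i) else 0)"

definition output_in_memory :: "(nat \<Rightarrow> nat) \<Rightarrow> bool list \<Rightarrow> bool" where
  "output_in_memory m y \<longleftrightarrow> m 0 = length y \<and> (\<forall>i<length y. m (Suc i) = of_bool (y ! i))"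

definition ram_computes :: "ram_prog \<Rightarrow> bool list \<Rightarrow> nat \<Rightarrow> bool list \<Rightarrow> bool" where
  "ram_computes c x t y \<longleftrightarrow>
     (\<exists>\<rho> m. ram_exec c (\<lambda>_. 0, input_memory x) t (\<rho>, m) \<and> output_in_memory m y)"

text \<open>A search problem is given by its set \<open>I\<close> of instances, the encoding \<open>enc\<close> of instances as bit
  strings, and the relation \<open>sol\<close> between instances and the bit strings that are correct answers.\<close>

definition poly_time_solvable ::
  "'i set \<Rightarrow> ('i \<Rightarrow> bool list) \<Rightarrow> ('i \<Rightarrow> bool list \<Rightarrow> bool) \<Rightarrow> bool" where
  "poly_time_solvable I enc sol \<longleftrightarrow>
     (\<exists>c. \<exists>p :: nat poly. \<forall>i\<in>I. \<exists>t y.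
        ram_computes c (enc i) t y \<and> t \<le> poly p (length (enc i)) \<and> sol i y)"


section \<open>List homomorphism by edge deletion\<close>

definition list_hom_del ::
  "'a ugraph \<Rightarrow> 'v ugraph \<Rightarrow> ('v \<Rightarrow> 'a set) \<Rightarrow> 'v set set \<Rightarrow> bool" where
  "list_hom_del H G L X \<longleftrightarrow> X \<subseteq> edges G \<and>
     (\<exists>f. (\<forall>v\<in>verts G. f v \<in> L v) \<and>
          (\<forall>u v. {u, v} \<in> edges G - X \<longrightarrow> adj H (f u) (f v)))"

definition min_list_hom_del ::
  "'a ugraph \<Rightarrow> 'v ugraph \<Rightarrow> ('v \<Rightarrow> 'a set) \<Rightarrow> 'v set set \<Rightarrow> bool" where
  "min_list_hom_del H G L X \<longleftrightarrow> list_hom_del H G L X \<and>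
     (\<forall>Y. list_hom_del H G L Y \<longrightarrow> card X \<le> card Y)"

text \<open>As usual, the vertices of an instance with \<open>n\<close> vertices are \<open>0, \<dots>, n - 1\<close>.\<close>

definition LHomED_instances :: "'a ugraph \<Rightarrow> (nat ugraph \<times> (nat \<Rightarrow> 'a set)) set" where
  "LHomED_instances H = {(G, L). is_graph G \<and> (\<exists>n. verts G = {..<n}) \<and>
     (\<forall>v\<in>verts G. L v \<subseteq> verts H)}"

definition edge_matrix :: "nat \<Rightarrow> nat set set \<Rightarrow> bool list" where
  "edge_matrix n E = concat (map (\<lambda>u. map (\<lambda>v. {u, v} \<in> E) [0..<n]) [0..<n])"

text \<open>The encoding of \<open>(G, L)\<close> consists of the number \<open>n\<close> of vertices of \<open>G\<close> in unary, the adjacency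
  matrix of \<open>G\<close>, and for each vertex the characteristic vector of its list with respect to the
  enumeration \<open>hs\<close> of the vertices of \<open>H\<close>.\<close>

definition LHomED_encode :: "'a list \<Rightarrow> nat ugraph \<times> (nat \<Rightarrow> 'a set) \<Rightarrow> bool list" where
  "LHomED_encode hs = (\<lambda>(G, L). let n = card (verts G) in
     replicate n True @ [False] @ edge_matrix n (edges G) @
     concat (map (\<lambda>v. map (\<lambda>a. a \<in> L v) hs) [0..<n]))"

text \<open>If some list is empty, not even deleting all edges helps, and no solution exists. This has to
  be reported by the answer \<open>[False]\<close>.\<close>

definition LHomED_answer ::
  "'a ugraph \<Rightarrow> nat ugraph \<times> (nat \<Rightarrow> 'a set) \<Rightarrow> bool list \<Rightarrow> bool" where
  "LHomED_answer H = (\<lambda>(G, L) y.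
     if \<exists>X. list_hom_del H G L X
     then \<exists>X. min_list_hom_del H G L X \<and> y = True # edge_matrix (card (verts G)) X
     else y = [False])"

text \<open>The choice of the enumeration \<open>hs\<close> is immaterial, as \<open>H\<close> is not part of the input; we ask for
  an algorithm for each of them. The program and the polynomial may depend on \<open>H\<close> and \<open>hs\<close>.\<close>

definition LHomED_poly_time :: "'a ugraph \<Rightarrow> bool" where
  "LHomED_poly_time H \<longleftrightarrow> (\<forall>hs. distinct hs \<and> set hs = verts H \<longrightarrow>
     poly_time_solvable (LHomED_instances H) (LHomED_encode hs) (LHomED_answer H))"

end

theory Submission imports Defs begin

text \<open>The supermodular inequality arises naturally when one chain is ordered by north arcs and
  the other by south arcs, because an edge compares a north arc with a south arc. The obstacle is
  that a list needs one order that serves against every other list. Lists without loops have no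
  edges between them, so the delicate case is that of two lists with loops, both ordered by north
  arcs. If the south order agrees with the north order on one of the two pairs compared, the natural
  case applies; if it disagrees on both, all four vertices have loops and the four entries are
  equal. Excluding \<open>0 1 0\<close> then makes one unit arc per edge sufficient, which
  supermodularity alone would not. Chains and thresholds depend only on subsets of the fixed set
  \<open>verts H\<close>. They enter the program as finitely many constants, so the program never
  computes with arcs. The number \<open>n * n + 1\<close> exceeds the total capacity of the unit
  arcs; it serves both as the capacity of arcs that must not be cut and as the number of rounds of
  the flow loop, so that no loop of unknown length is needed.\<close>

text \<open>A bi-arc representation places every vertex by the end points of its two arcs, on the right and
  on the left side of the circle; adjacency becomes a conjunction of two comparisons. In a list, a
  label whose neighbourhood is contained in that of another one can be dropped. The remaining labels
  are linearly ordered, by their north arcs if one of them has a loop and by their south arcs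
  otherwise. Absence of irreflexive edges and of three vertices with private neighbours makes the
  adjacency matrix between two such chains supermodular, without a pattern \<open>0 1 0\<close> in a row or column.
  Hence its ones form a lower left and an upper right rectangle. The cost of an edge is therefore
  the minimum cut of a small network with one unit arc, and a minimum set of deleted edges is a
  minimum cut of the union of these networks. It is found by at most \<open>n\<^sup>2\<close> augmentations along
  shortest paths, on a random access machine programmed through a language of bounded loops.\<close>

section \<open>Bi-arc coordinates\<close>

text \<open>Up to a common constant, \<open>nr x\<close> and \<open>nl x\<close> are the distances
  from the top to the two ends of the north arc, along the right and the left side;
  \<open>sr x\<close> and \<open>sl x\<close> belong to the south arc. An edge means that the arcs
  stay apart on both sides. The private neighbours \<open>p\<close>, \<open>q\<close>,
  \<open>r\<close> may be among \<open>x\<close>, \<open>y\<close>, \<open>z\<close>.\<close>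

locale biarc_order =
  fixes V :: "'a set" and E :: "'a \<Rightarrow> 'a \<Rightarrow> bool" and nr nl sr sl :: "'a \<Rightarrow> real"
  assumes E_iff: "x \<in> V \<Longrightarrow> y \<in> V \<Longrightarrow> E x y \<longleftrightarrow> nr x < sr y \<and> nl x < sl y"
    and E_sym: "E x y = E y x"
    and E_loop: "x \<in> V \<Longrightarrow> y \<in> V \<Longrightarrow> E x y \<Longrightarrow> E x x \<or> E y y"
    and no_private_triple: "{x, y, z, p, q, r} \<subseteq> V \<Longrightarrow>
      E x p \<Longrightarrow> \<not> E y p \<Longrightarrow> \<not> E z p \<Longrightarrow> \<not> E x q \<Longrightarrow> E y q \<Longrightarrow> \<not> E z q \<Longrightarrow>
      \<not> E x r \<Longrightarrow> \<not> E y r \<Longrightarrow> \<not> E z r"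
begin

lemma E_iff': "x \<in> V \<Longrightarrow> y \<in> V \<Longrightarrow> E x y \<longleftrightarrow> nr y < sr x \<and> nl y < sl x"
  using E_iff E_sym by blast

text \<open>Reflection in the vertical axis exchanges the two sides.\<close>

lemma mirror: "biarc_order V E nl nr sl sr"
proof unfold_locales
  fix x y assume "x \<in> V" "y \<in> V"
  then show "E x y \<longleftrightarrow> nl x < sl y \<and> nr x < sr y"
    using E_iff by auto
qed (fact E_sym E_loop no_private_triple)+

text \<open>Turning the circle upside down exchanges north and south arcs and reverses the direction
  of measurement, hence the signs.\<close>

lemma dual: "biarc_order V E (\<lambda>x. - sr x) (\<lambda>x. - sl x) (\<lambda>x. - nr x) (\<lambda>x. - nl x)"
proof unfold_locales
  fix x y assume "x \<in> V" "y \<in> V"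
  then show "E x y \<longleftrightarrow> - sr x < - nr y \<and> - sl x < - nl y"
    using E_iff' by auto
qed (fact E_sym E_loop no_private_triple)+

section \<open>Inclusion of neighbourhoods and the two orders of incomparable vertices\<close>

definition dominated :: "'a \<Rightarrow> 'a \<Rightarrow> bool" where
  "dominated x y \<longleftrightarrow> (\<forall>z\<in>V. E x z \<longrightarrow> E y z)"

definition incomparable :: "'a \<Rightarrow> 'a \<Rightarrow> bool" where
  "incomparable x y \<longleftrightarrow> x \<in> V \<and> y \<in> V \<and> \<not> dominated x y \<and> \<not> dominated y x"

lemma incomparable_sym: "incomparable x y \<Longrightarrow> incomparable y x"
  by (auto simp: incomparable_def)

lemma incomparable_private:
  assumes "incomparable x y"
  obtains p where "p \<in> V" "E x p" "\<not> E y p"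
  using assms unfolding incomparable_def dominated_def by blast

text \<open>A north arc that reaches at least as far on both sides has the smaller neighbourhood. So
  incomparable vertices are ordered oppositely on the two sides.\<close>

lemma incomparable_n:
  assumes "incomparable x y"
  shows "nr x < nr y \<and> nl y < nl x \<or> nr y < nr x \<and> nl x < nl y"
proof -
  have *: "dominated y x" if "nr x \<le> nr y" "nl x \<le> nl y" "x \<in> V" "y \<in> V" for x y
    unfolding dominated_def using E_iff that by force
  show ?thesis
    using assms *[of x y] *[of y x] unfolding incomparable_def by linarith
qed

lemma incomparable_s:
  assumes "incomparable x y"
  shows "sr x < sr y \<and> sl y < sl x \<or> sr y < sr x \<and> sl x < sl y"
proof -
  interpret d: biarc_order V E "\<lambda>x. - sr x" "\<lambda>x. - sl x" "\<lambda>x. - nr x" "\<lambda>x. - nl x"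
    by (rule dual)
  have "d.incomparable x y"
    using assms unfolding incomparable_def d.incomparable_def dominated_def d.dominated_def .
  from d.incomparable_n[OF this] show ?thesis by auto
qed

text \<open>The left order is the reverse of the right one: the north arc of \<open>y\<close> ends
  before that of \<open>z\<close> on the right and before that of \<open>x\<close> on the
  left.\<close>

lemma convex_n:
  assumes "incomparable x y" "incomparable y z" "nr x < nr y" "nr y < nr z"
    "E x w" "E z w" "w \<in> V"
  shows "E y w"
  using incomparable_n[OF assms(1)] incomparable_n[OF assms(2)] assms(3-)
    E_iff[of x w] E_iff[of y w] E_iff[of z w] assms(1,2) unfolding incomparable_def by auto

text \<open>Otherwise \<open>w\<close> is private to \<open>y\<close>. By \<open>convex_n\<close>, a
  neighbour that distinguishes \<open>x\<close> from \<open>y\<close> is not adjacent to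
  \<open>z\<close> either, and likewise for \<open>z\<close>. This is a forbidden triple.\<close>

lemma covered_n:
  assumes "incomparable x y" "incomparable y z" "nr x < nr y" "nr y < nr z" "E y w" "w \<in> V"
  shows "E x w \<or> E z w"
proof (rule ccontr)
  assume *: "\<not> ?thesis"
  obtain p where p: "p \<in> V" "E x p" "\<not> E y p"
    using incomparable_private[OF assms(1)] .
  obtain q where q: "q \<in> V" "E z q" "\<not> E y q"
    using incomparable_private[OF incomparable_sym[OF assms(2)]] .
  have "\<not> E z p" "\<not> E x q" using convex_n[OF assms(1-4)] p q by blast+
  moreover have "{x, y, z, p, w, q} \<subseteq> V"
    using assms p q unfolding incomparable_def by auto
  ultimately show False using no_private_triple[of x y z p w q] * p q assms(5) by blast
qed

lemma convex_s:
  assumes "incomparable x y" "incomparable y z" "sr x < sr y" "sr y < sr z"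
    "E x w" "E z w" "w \<in> V"
  shows "E y w"
proof -
  interpret d: biarc_order V E "\<lambda>x. - sr x" "\<lambda>x. - sl x" "\<lambda>x. - nr x" "\<lambda>x. - nl x"
    by (rule dual)
  show ?thesis
    using d.convex_n[of z y x w] assms
    unfolding incomparable_def d.incomparable_def dominated_def d.dominated_def by simp
qed

lemma covered_s:
  assumes "incomparable x y" "incomparable y z" "sr x < sr y" "sr y < sr z" "E y w" "w \<in> V"
  shows "E x w \<or> E z w"
proof -
  interpret d: biarc_order V E "\<lambda>x. - sr x" "\<lambda>x. - sl x" "\<lambda>x. - nr x" "\<lambda>x. - nl x"
    by (rule dual)
  show ?thesis
    using d.covered_n[of z y x w] assms
    unfolding incomparable_def d.incomparable_def dominated_def d.dominated_def by auto
qed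

text \<open>With truth values read as 0 and 1, this is
  \<open>E a b + E a' b' \<ge> E a b' + E a' b\<close>, split according to whether the right side is
  2 or at least 1.\<close>

definition supermod :: "'a \<Rightarrow> 'a \<Rightarrow> 'a \<Rightarrow> 'a \<Rightarrow> bool" where
  "supermod a a' b b' \<longleftrightarrow> (E a b' \<and> E a' b \<longrightarrow> E a b \<and> E a' b') \<and>
     (E a b' \<or> E a' b \<longrightarrow> E a b \<or> E a' b')"

lemma supermod_commute: "supermod a a' b b' \<longleftrightarrow> supermod b b' a a'"
  unfolding supermod_def using E_sym by blast

text \<open>The forbidden triple is \<open>z\<close>, \<open>a\<close>, \<open>a'\<close> with
  private neighbours \<open>b\<close>, \<open>b'\<close>, \<open>w\<close>, where \<open>z\<close>
  distinguishes \<open>b\<close> from \<open>b'\<close> and \<open>w\<close> distinguishes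
  \<open>a'\<close> from \<open>a\<close>. That \<open>z\<close> and \<open>w\<close> are not
  adjacent is seen on the left side.\<close>

lemma supermod_ns_half:
  assumes a: "incomparable a a'" "nr a < nr a'" and b: "incomparable b b'" "sr b < sr b'"
    and E: "E a b'" "\<not> E a b" "\<not> E a' b'"
  shows False
proof -
  have V: "a \<in> V" "a' \<in> V" "b \<in> V" "b' \<in> V" using a b unfolding incomparable_def by auto
  have na: "nl a' < nl a" and sb: "sl b' < sl b"
    using incomparable_n[OF a(1)] incomparable_s[OF b(1)] a b by auto
  obtain z where z: "z \<in> V" "E b z" "\<not> E b' z" using incomparable_private[OF b(1)] .
  obtain w where w: "w \<in> V" "E a' w" "\<not> E a w"
    using incomparable_private[OF incomparable_sym[OF a(1)]] .
  have 1: "nr a < sr b'" "nl a < sl b'" "sr b \<le> nr a" "sr b' \<le> nr a'"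
    using E E_iff V na sb by force+
  have 2: "nr z < sr b" "sl b' \<le> nl z" "nl z < sl b"
    using z E_iff' V b sb by force+
  have 3: "sl w \<le> nl a" using w E_iff V a by force
  have "\<not> E a b" "\<not> E a' b" "\<not> E z b'" "\<not> E z w"
    using E E_iff[OF V(2,3)] 1 a z E_sym E_iff[OF z(1) w(1)] 1 2 3 by auto
  then show False
    using no_private_triple[of z a a' b b' w] E_sym z w E V by blast
qed

text \<open>A single off-diagonal edge is treated by \<open>supermod_ns_half\<close> or its mirror
  image; two of them give both diagonal edges by comparing ends alone.\<close>

lemma supermod_ns:
  assumes a: "incomparable a a'" "nr a < nr a'" and b: "incomparable b b'" "sr b < sr b'"
  shows "supermod a a' b b'"
proof -
  have V: "a \<in> V" "a' \<in> V" "b \<in> V" "b' \<in> V" using a b unfolding incomparable_def by auto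
  have na: "nl a' < nl a" and sb: "sl b' < sl b"
    using incomparable_n[OF a(1)] incomparable_s[OF b(1)] a b by auto
  interpret m: biarc_order V E nl nr sl sr by (rule mirror)
  have "False" if "E a' b" "\<not> E a' b'" "\<not> E a b"
    using m.supermod_ns_half[of a' a b' b] that a b na sb
    unfolding incomparable_def m.incomparable_def dominated_def m.dominated_def by blast
  moreover have "False" if "E a b'" "\<not> E a' b'" "\<not> E a b"
    using supermod_ns_half that a b by blast
  moreover have "E a b \<and> E a' b'" if "E a b'" "E a' b"
    using that na sb a(2) b(2) V by (auto simp: E_iff)
  ultimately show ?thesis unfolding supermod_def by blast
qed

text \<open>Let \<open>p\<close> be adjacent to \<open>y\<close> but not to \<open>x\<close>. On the
  left, the south arc of \<open>p\<close> begins no later than the gap between the two arcs of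
  \<open>x\<close>, and its north arc ends no earlier than that gap. So \<open>p\<close> has no
  loop, and the edge \<open>yp\<close> requires one at \<open>y\<close>.\<close>

lemma mixed_half:
  assumes "incomparable x y" "nr x < nr y" "sr y < sr x" "E x x"
  shows "E y y"
proof -
  obtain p where p: "p \<in> V" "E y p" "\<not> E x p"
    using incomparable_private[OF incomparable_sym[OF assms(1)]] .
  have V: "x \<in> V" "y \<in> V" using assms(1) unfolding incomparable_def by auto
  have l: "nl y < nl x" "sl x < sl y"
    using incomparable_n[OF assms(1)] incomparable_s[OF assms(1)] assms by auto
  have "sl p \<le> nl x" using p V E_iff assms by force
  moreover have "sl x \<le> nl p" using p V E_iff' assms by force
  moreover have "nl x < sl x" using assms E_iff V by blast
  ultimately have "\<not> E p p" using E_iff[of p p] p by auto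
  then show ?thesis using E_loop[of y p] p V by blast
qed

lemma mixed:
  assumes "incomparable x y" "nr x < nr y" "sr y < sr x"
  shows "E x x \<longleftrightarrow> E y y"
proof -
  interpret m: biarc_order V E nl nr sl sr by (rule mirror)
  have l: "nl y < nl x" "sl x < sl y"
    using incomparable_n[OF assms(1)] incomparable_s[OF assms(1)] assms by auto
  show ?thesis
    using mixed_half[OF assms] m.mixed_half[of y x] assms(1) l
    unfolding incomparable_def m.incomparable_def dominated_def m.dominated_def by blast
qed

text \<open>Non-adjacent vertices with loops have disjoint gaps (between north and south arc) on
  both sides, in opposite directions. The gaps of the primed vertices lie inside those of the others
  on the right and contain them on the left. So a separation of one pair passes, on a suitable side,
  to every other pair, and the four entries are equal.\<close>

lemma nested_loops_constant:
  assumes "incomparable a a'" "nr a < nr a'" "sr a' < sr a" "E a a" "E a' a'"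
    and "incomparable b b'" "nr b < nr b'" "sr b' < sr b" "E b b" "E b' b'"
  shows "supermod a a' b b'"
proof -
  have V: "a \<in> V" "a' \<in> V" "b \<in> V" "b' \<in> V" using assms unfolding incomparable_def by auto
  have l: "nl a' < nl a" "sl a < sl a'" "nl b' < nl b" "sl b < sl b'"
    using incomparable_n[OF assms(1)] incomparable_s[OF assms(1)]
      incomparable_n[OF assms(6)] incomparable_s[OF assms(6)] assms by auto
  show ?thesis
    using l assms(2,3,4,5,7,8,9,10) V E_iff[of a b] E_iff'[of a b] E_iff[of a b'] E_iff'[of a b']
      E_iff[of a' b] E_iff'[of a' b] E_iff[of a' b'] E_iff'[of a' b']
      E_iff[of a a] E_iff[of b b] E_iff[of a' a'] E_iff[of b' b']
    unfolding supermod_def by (smt (verit))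
qed

section \<open>Antichains and their linear orders\<close>

definition antichain :: "'a set \<Rightarrow> bool" where
  "antichain A \<longleftrightarrow> A \<subseteq> V \<and> (\<forall>x\<in>A. \<forall>y\<in>A. x \<noteq> y \<longrightarrow> incomparable x y)"

text \<open>An antichain with a loop and one without are thus compared as in
  \<open>supermod_ns\<close>, and two without loops have no edges between them. Two with loops need
  \<open>supermod_nn\<close>.\<close>

definition key :: "'a set \<Rightarrow> 'a \<Rightarrow> real" where
  "key A = (if \<exists>x\<in>A. E x x then nr else sr)"

lemma key_less_linear:
  assumes "antichain A" "x \<in> A" "y \<in> A" "x \<noteq> y"
  shows "key A x < key A y \<or> key A y < key A x"
  using incomparable_n[of x y] incomparable_s[of x y] assms unfolding antichain_def key_def by auto

lemma inj_key: "antichain A \<Longrightarrow> inj_on (key A) A"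
  using key_less_linear by (fastforce intro!: inj_onI)

lemma antichain_covered:
  assumes "antichain A" "x \<in> A" "y \<in> A" "z \<in> A" "key A x < key A y" "key A y < key A z"
    "w \<in> V" "E y w"
  shows "E x w \<or> E z w"
proof -
  have "incomparable x y" "incomparable y z"
    using assms unfolding antichain_def by (metis order_less_irrefl)+
  then show ?thesis
    using assms covered_n[of x y z w] covered_s[of x y z w]
    unfolding key_def by (auto split: if_splits)
qed

text \<open>Otherwise the two orders would put different elements of \<open>{x, y, c}\<close> in the middle, and the
  neighbourhoods of \<open>x\<close> and \<open>y\<close> would coincide.\<close>
lemma reversed_no_mixed:
  assumes A: "antichain A" "x \<in> A" "y \<in> A" "c \<in> A" and xy: "nr x < nr y" "sr y < sr x"
    and c: "E c c" "\<not> E x x" "\<not> E y y"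
  shows False
proof -
  have i: "incomparable c x" "incomparable c y" "incomparable x y"
    using A c xy unfolding antichain_def by (metis order_less_irrefl)+
  then have i': "incomparable x c" "incomparable y c" "incomparable y x"
    using incomparable_sym by blast+
  \<comment> \<open>By \<open>mixed\<close>, a vertex with a loop and one without are ordered alike
    by \<open>nr\<close> and \<open>sr\<close>.\<close>
  have sgn: "nr c < nr x \<longleftrightarrow> sr c < sr x" "nr c < nr y \<longleftrightarrow> sr c < sr y"
    using mixed[OF i(1)] mixed[OF i(2)] mixed[OF i'(1)] mixed[OF i'(2)] c
      incomparable_n[OF i(1)] incomparable_n[OF i(2)] incomparable_s[OF i(1)] incomparable_s[OF i(2)]
    by (smt (verit))+
  \<comment> \<open>Hence \<open>c\<close> is not between \<open>x\<close> and \<open>y\<close>,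
    which the two orders arrange differently.\<close>
  consider "nr c < nr x" | "nr y < nr c"
    using sgn xy incomparable_n[OF i(1)] incomparable_n[OF i(2)] by (smt (verit))
  then have "dominated x y"
  proof cases
    case 1
    then have "sr c < sr y" "sr c < sr x" using sgn xy by auto
    show ?thesis unfolding dominated_def
    proof safe
      fix w assume w: "w \<in> V" "E x w"
      show "E y w"
        using covered_n[OF i(1,3) 1 xy(1) w(2,1)] convex_s[OF i(2) i'(3) \<open>sr c < sr y\<close> xy(2) _ w(2,1)]
        by blast
    qed
  next
    case 2
    then have "sr x < sr c"
      using sgn xy incomparable_s[OF i(1)] by (smt (verit))
    show ?thesis unfolding dominated_def
    proof safe
      fix w assume w: "w \<in> V" "E x w"
      show "E y w"
        using convex_n[OF i(3) i'(2) xy(1) 2 w(2) _ w(1)] covered_s[OF i'(3) i'(1) xy(2) \<open>sr x < sr c\<close> w(2,1)]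
        by blast
    qed
  qed
  then show False using i unfolding incomparable_def by blast
qed

text \<open>If \<open>sr\<close> orders one of the pairs as \<open>nr\<close> does, that pair may be
  regarded as ordered by south arcs. If it disagrees on both, then \<open>mixed\<close> and
  \<open>reversed_no_mixed\<close> put loops on all four vertices.\<close>

lemma supermod_nn:
  assumes A: "antichain A" "x \<in> A" "x' \<in> A" "c \<in> A" "E c c" "nr x < nr x'"
    and B: "antichain B" "y \<in> B" "y' \<in> B" "d \<in> B" "E d d" "nr y < nr y'"
  shows "supermod x x' y y'"
proof -
  have i: "incomparable x x'" "incomparable y y'"
    using A B unfolding antichain_def by (metis order_less_irrefl)+
  consider "sr x < sr x'" | "sr y < sr y'" | "sr x' < sr x" "sr y' < sr y"
    using incomparable_s[OF i(1)] incomparable_s[OF i(2)] by blast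
  then show ?thesis
  proof cases
    case 1
    then show ?thesis using supermod_ns[OF i(2) B(6) i(1)] supermod_commute by blast
  next
    case 2
    then show ?thesis using supermod_ns[OF i(1) A(6) i(2)] by blast
  next
    case 3
    have "E x x" "E x' x'"
      using mixed[OF i(1) A(6) 3(1)] reversed_no_mixed[OF A(1,2,3,4,6) 3(1) A(5)] by blast+
    moreover have "E y y" "E y' y'"
      using mixed[OF i(2) B(6) 3(2)] reversed_no_mixed[OF B(1,2,3,4,6) 3(2) B(5)] by blast+
    ultimately show ?thesis using nested_loops_constant i A B 3 by blast
  qed
qed

lemma antichain_supermod:
  assumes A: "antichain A" "x \<in> A" "x' \<in> A" "key A x < key A x'"
    and B: "antichain B" "y \<in> B" "y' \<in> B" "key B y < key B y'"
  shows "supermod x x' y y'"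
proof -
  have i: "incomparable x x'" "incomparable y y'"
    using A B unfolding antichain_def by (metis order_less_irrefl)+
  have V: "x \<in> V" "x' \<in> V" "y \<in> V" "y' \<in> V" using i unfolding incomparable_def by auto
  consider "\<exists>c\<in>A. E c c" "\<exists>d\<in>B. E d d" | "\<exists>c\<in>A. E c c" "\<not> (\<exists>d\<in>B. E d d)"
    | "\<not> (\<exists>c\<in>A. E c c)" "\<exists>d\<in>B. E d d" | "\<not> (\<exists>c\<in>A. E c c)" "\<not> (\<exists>d\<in>B. E d d)" by blast
  then show ?thesis
  proof cases
    case 1
    then show ?thesis using supermod_nn A B unfolding key_def by auto
  next
    case 2
    then show ?thesis using supermod_ns[OF i(1) _ i(2)] A B unfolding key_def by auto
  next
    case 3
    then show ?thesis
      using supermod_ns[OF i(2) _ i(1)] A B supermod_commute unfolding key_def by auto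
  next
    case 4
    \<comment> \<open>No edge joins two vertices without loops, so all four entries are
      false.\<close>
    then show ?thesis using E_loop V A B unfolding supermod_def by blast
  qed
qed

end

section \<open>Two-monotone chains of labels\<close>

lemma downset_is_initial_segment:
  fixes D :: "nat \<Rightarrow> bool"
  assumes "\<And>i j. D i \<Longrightarrow> j \<le> i \<Longrightarrow> D j" "\<And>i. D i \<Longrightarrow> i < k"
  shows "\<exists>a\<le>k. \<forall>i. D i \<longleftrightarrow> i < a"
proof -
  have "\<not> D k" using assms(2) by blast
  define a where "a = (LEAST i. \<not> D i)"
  have "\<not> D a" unfolding a_def using \<open>\<not> D k\<close> by (rule LeastI)
  moreover have "D i" if "i < a" for i using not_less_Least that unfolding a_def by blast
  moreover have "a \<le> k" unfolding a_def using \<open>\<not> D k\<close> by (rule Least_le)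
  ultimately show ?thesis using assms(1) not_less by metis
qed

definition supermod_matrix :: "nat \<Rightarrow> nat \<Rightarrow> (nat \<Rightarrow> nat \<Rightarrow> bool) \<Rightarrow> bool" where
  "supermod_matrix k l g \<longleftrightarrow> (\<forall>i i' j j'. i < i' \<longrightarrow> i' < k \<longrightarrow> j < j' \<longrightarrow> j' < l \<longrightarrow>
     (g i j' \<and> g i' j \<longrightarrow> g i j \<and> g i' j') \<and> (g i j' \<or> g i' j \<longrightarrow> g i j \<or> g i' j'))"

lemma supermod_matrixD:
  assumes "supermod_matrix k l g" "i < i'" "i' < k" "j < j'" "j' < l"
  shows "g i j' \<Longrightarrow> g i' j \<Longrightarrow> g i j \<and> g i' j'" "g i j' \<or> g i' j \<Longrightarrow> g i j \<or> g i' j'"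
  using assms unfolding supermod_matrix_def by blast+

text \<open>If the block below \<open>(x, y0)\<close> and the block below \<open>(x1, y)\<close> are
  full, so is the block below \<open>(x, y)\<close>: an entry beyond both is the fourth corner of a
  rectangle whose two off-diagonal corners are ones. So the corners of full blocks form a product of
  two initial segments.\<close>

lemma supermod_matrix_lower_rectangle:
  assumes "supermod_matrix k l g"
  shows "\<exists>a\<le>k. \<exists>b\<le>l. \<forall>i<k. \<forall>j<l. (\<forall>i'\<le>i. \<forall>j'\<le>j. g i' j') \<longleftrightarrow> i < a \<and> j < b"
proof -
  define P where "P = (\<lambda>i j. i < k \<and> j < l \<and> (\<forall>i'\<le>i. \<forall>j'\<le>j. g i' j'))"
  obtain a where a: "a \<le> k" "\<And>i. (\<exists>j. P i j) \<longleftrightarrow> i < a"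
    using downset_is_initial_segment[of "\<lambda>i. \<exists>j. P i j" k] unfolding P_def
    by (smt (verit) le_trans order.strict_trans1)
  obtain b where b: "b \<le> l" "\<And>j. (\<exists>i. P i j) \<longleftrightarrow> j < b"
    using downset_is_initial_segment[of "\<lambda>j. \<exists>i. P i j" l] unfolding P_def
    by (smt (verit) le_trans order.strict_trans1)
  have "P x y" if 1: "P x y0" and 2: "P x1 y" for x y x1 y0
  proof -
    have "g i j" if ij: "i \<le> x" "j \<le> y" for i j
    proof (cases "j \<le> y0 \<or> i \<le> x1")
      case True
      then show ?thesis using 1 2 ij unfolding P_def by auto
    next
      case False
      then have "g i y0" "g x1 j" using 1 2 ij unfolding P_def by auto
      then show ?thesis
        using supermod_matrixD(1)[OF assms, of x1 i y0 j] False ij 1 2 unfolding P_def by auto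
    qed
    then show ?thesis using 1 2 unfolding P_def by auto
  qed
  then have "P i j \<longleftrightarrow> i < a \<and> j < b" for i j using a b by blast
  then show ?thesis using a b unfolding P_def by blast
qed

text \<open>A one outside both rectangles has a zero \<open>(p, q)\<close> weakly below it and a
  zero \<open>(p', q')\<close> weakly above it. The absence of \<open>0 1 0\<close> turns
  \<open>(p, j)\<close> and \<open>(i, q)\<close> into ones, and these contradict the zero at
  \<open>(p, q)\<close>.\<close>

lemma supermod_matrix_two_monotone:
  assumes g: "supermod_matrix k l g"
    and row: "\<And>i j j' j''. i < k \<Longrightarrow> j < j' \<Longrightarrow> j' < j'' \<Longrightarrow> j'' < l \<Longrightarrow> g i j' \<Longrightarrow> g i j \<or> g i j''"
    and col: "\<And>i i' i'' j. j < l \<Longrightarrow> i < i' \<Longrightarrow> i' < i'' \<Longrightarrow> i'' < k \<Longrightarrow> g i' j \<Longrightarrow> g i j \<or> g i'' j"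
  shows "\<exists>a\<le>k. \<exists>b\<le>l. \<exists>c\<le>k. \<exists>d\<le>l. \<forall>i<k. \<forall>j<l. g i j \<longleftrightarrow> i < a \<and> j < b \<or> c \<le> i \<and> d \<le> j"
proof -
  obtain a b where ab: "a \<le> k" "b \<le> l"
    "\<forall>i<k. \<forall>j<l. (\<forall>i'\<le>i. \<forall>j'\<le>j. g i' j') \<longleftrightarrow> i < a \<and> j < b"
    using supermod_matrix_lower_rectangle[OF g] by (elim exE conjE)
  then have ab3: "(\<forall>i'\<le>i. \<forall>j'\<le>j. g i' j') \<longleftrightarrow> i < a \<and> j < b" if "i < k" "j < l" for i j
    using that by simp
  \<comment> \<open>A half turn of the matrix preserves supermodularity and moves the upper right
    corner to the lower left.\<close>
  define h where h_def: "h = (\<lambda>i j. g (k - Suc i) (l - Suc j))"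
  have "supermod_matrix k l h"
    unfolding supermod_matrix_def h_def
  proof (intro allI impI)
    fix i i' j j' assume "i < i'" "i' < k" "j < j'" "j' < l"
    then have "k - Suc i' < k - Suc i" "k - Suc i < k" "l - Suc j' < l - Suc j" "l - Suc j < l"
      by auto
    then show "(g (k - Suc i) (l - Suc j') \<and> g (k - Suc i') (l - Suc j) \<longrightarrow>
        g (k - Suc i) (l - Suc j) \<and> g (k - Suc i') (l - Suc j')) \<and>
       (g (k - Suc i) (l - Suc j') \<or> g (k - Suc i') (l - Suc j) \<longrightarrow>
        g (k - Suc i) (l - Suc j) \<or> g (k - Suc i') (l - Suc j'))"
      using supermod_matrixD[OF g] by blast
  qed
  from supermod_matrix_lower_rectangle[OF this] obtain c d where cd: "c \<le> k" "d \<le> l"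
    "\<forall>i<k. \<forall>j<l. (\<forall>i'\<le>i. \<forall>j'\<le>j. h i' j') \<longleftrightarrow> i < c \<and> j < d"
    by (elim exE conjE)
  have up: "k - c \<le> i \<and> l - d \<le> j \<longleftrightarrow> (\<forall>p q. i \<le> p \<and> p < k \<and> j \<le> q \<and> q < l \<longrightarrow> g p q)"
    if ij: "i < k" "j < l" for i j
  proof -
    have "k - c \<le> i \<and> l - d \<le> j \<longleftrightarrow> k - Suc i < c \<and> l - Suc j < d"
      using ij cd by auto
    also have "\<dots> \<longleftrightarrow> (\<forall>i'\<le>k - Suc i. \<forall>j'\<le>l - Suc j. h i' j')" using cd(3) ij by simp
    also have "\<dots> \<longleftrightarrow> (\<forall>p q. i \<le> p \<and> p < k \<and> j \<le> q \<and> q < l \<longrightarrow> g p q)"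
    proof safe
      fix p q assume *: "\<forall>i'\<le>k - Suc i. \<forall>j'\<le>l - Suc j. h i' j'" "i \<le> p" "p < k" "j \<le> q" "q < l"
      then have "h (k - Suc p) (l - Suc q)" using diff_le_mono2 by simp
      then show "g p q" using * unfolding h_def by (simp add: Suc_diff_Suc)
    next
      fix p q assume *: "\<forall>p q. i \<le> p \<and> p < k \<and> j \<le> q \<and> q < l \<longrightarrow> g p q"
        "p \<le> k - Suc i" "q \<le> l - Suc j"
      then have "i \<le> k - Suc p" "k - Suc p < k" "j \<le> l - Suc q" "l - Suc q < l"
        using ij by auto
      then show "h p q" using * unfolding h_def by blast
    qed
    finally show ?thesis .
  qed
  have "g i j \<longleftrightarrow> i < a \<and> j < b \<or> k - c \<le> i \<and> l - d \<le> j" if ij: "i < k" "j < l" for i j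
  proof
    assume "i < a \<and> j < b \<or> k - c \<le> i \<and> l - d \<le> j"
    then show "g i j" using ab3[OF ij] up[OF ij] ij by blast
  next
    assume gij: "g i j"
    show "i < a \<and> j < b \<or> k - c \<le> i \<and> l - d \<le> j"
    proof (rule ccontr)
      assume "\<not> ?thesis"
      then obtain p q p' q' where pq: "p \<le> i" "q \<le> j" "\<not> g p q"
        "i \<le> p'" "p' < k" "j \<le> q'" "q' < l" "\<not> g p' q'"
        using ab3[OF ij] up[OF ij] by blast
      \<comment> \<open>If \<open>(p, j)\<close> were a zero, then \<open>(p', j)\<close> would be a
        one, since column \<open>j\<close> has no \<open>0 1 0\<close>. But then the off-diagonal
        one at \<open>(p', j)\<close> faces zeros at both \<open>(p, j)\<close> and
        \<open>(p', q')\<close>.\<close>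
      have "g p j"
      proof (rule ccontr)
        assume *: "\<not> g p j"
        then have "p < i" using gij pq by (cases "p = i") auto
        have "g p' j" using col[of j p i p'] * gij pq \<open>p < i\<close> ij by (cases "p' = i") auto
        then have "j < q'" using pq by (cases "j = q'") auto
        then show False
          using supermod_matrixD(2)[OF g, of p p' j q'] \<open>g p' j\<close> \<open>p < i\<close> pq * by auto
      qed
      moreover have "g i q"
      proof (rule ccontr)
        assume *: "\<not> g i q"
        then have "q < j" using gij pq by (cases "q = j") auto
        have "g i q'" using row[of i q j q'] * gij pq \<open>q < j\<close> ij by (cases "q' = j") auto
        then have "i < p'" using pq by (cases "i = p'") auto
        then show False
          using supermod_matrixD(2)[OF g, of i p' q q'] \<open>g i q'\<close> \<open>q < j\<close> pq * by auto
      qed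
      moreover have "p < i" "q < j"
        using \<open>g p j\<close> \<open>g i q\<close> pq(1,2,3) by (metis le_neq_implies_less)+
      ultimately show False using supermod_matrixD(1)[OF g, of p i q j] pq ij \<open>g p j\<close> \<open>g i q\<close> by blast
    qed
  qed
  moreover have "k - c \<le> k" "l - d \<le> l" by auto
  ultimately show ?thesis using ab(1,2) by blast
qed

context biarc_order
begin

definition chain :: "'a set \<Rightarrow> 'a list \<Rightarrow> bool" where
  "chain A xs \<longleftrightarrow> set xs \<subseteq> A \<and> distinct xs \<and> antichain (set xs) \<and>
     sorted_wrt (\<lambda>x y. key (set xs) x < key (set xs) y) xs \<and> (\<forall>x\<in>A. \<exists>y\<in>set xs. dominated x y)"

text \<open>A dominating subset of least cardinality is an antichain, since an element dominated by
  another one could be removed.\<close>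

lemma chain_exists:
  assumes "finite V" "A \<subseteq> V"
  shows "\<exists>xs. chain A xs"
proof -
  have "finite A" using assms finite_subset by blast
  let ?D = "\<lambda>B. B \<subseteq> A \<and> (\<forall>x\<in>A. \<exists>y\<in>B. dominated x y)"
  have refl: "dominated x x" for x unfolding dominated_def by blast
  have trans: "dominated x z" if "dominated x y" "dominated y z" for x y z
    using that unfolding dominated_def by blast
  have "?D A" using refl by blast
  then obtain B where B: "?D B" and min: "\<And>C. ?D C \<Longrightarrow> card B \<le> card C"
    using ex_has_least_nat[of ?D A card] by blast
  have "finite B" using B \<open>finite A\<close> finite_subset by blast
  have "\<not> dominated x y" if xy: "x \<in> B" "y \<in> B" "x \<noteq> y" for x y
  proof
    assume d: "dominated x y"
    have "?D (B - {x})"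
    proof (intro conjI ballI)
      fix z assume "z \<in> A"
      then obtain w where "w \<in> B" "dominated z w" using B by blast
      then show "\<exists>y\<in>B - {x}. dominated z y" using d trans xy by (cases "w = x") auto
    qed (use B in blast)
    from min[OF this] show False
      using card_Diff1_less[OF \<open>finite B\<close> xy(1)] by linarith
  qed
  then have ac: "antichain B"
    using B assms unfolding antichain_def incomparable_def by blast
  obtain ys where ys: "set ys = B" "distinct ys"
    using finite_distinct_list[OF \<open>finite B\<close>] by blast
  define xs where "xs = sort_key (key B) ys"
  have xs: "set xs = B" "distinct xs" using ys unfolding xs_def by auto
  have "sorted_wrt (\<lambda>x y. key B x \<le> key B y) xs"
    using sorted_sort_key[of "key B" ys] unfolding xs_def sorted_map by simp
  then have "sorted_wrt (\<lambda>x y. key B x < key B y) xs"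
    using inj_key[OF ac] xs unfolding sorted_wrt_iff_nth_less inj_on_def distinct_conv_nth
    by (metis nth_mem order.strict_trans nless_le)
  then show ?thesis unfolding chain_def using xs ac B by blast
qed

lemma chain_sm:
  assumes "chain A xs" "chain B ys"
  shows "supermod_matrix (length xs) (length ys) (\<lambda>i j. E (xs ! i) (ys ! j))"
  unfolding supermod_matrix_def
proof (intro allI impI)
  fix i i' j j' assume "i < i'" "i' < length xs" "j < j'" "j' < length ys"
  then have "supermod (xs ! i) (xs ! i') (ys ! j) (ys ! j')"
    using assms unfolding chain_def sorted_wrt_iff_nth_less
    by (intro antichain_supermod[of "set xs" _ _ "set ys"]) auto
  then show "(E (xs ! i) (ys ! j') \<and> E (xs ! i') (ys ! j) \<longrightarrow>
        E (xs ! i) (ys ! j) \<and> E (xs ! i') (ys ! j')) \<and>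
       (E (xs ! i) (ys ! j') \<or> E (xs ! i') (ys ! j) \<longrightarrow>
        E (xs ! i) (ys ! j) \<or> E (xs ! i') (ys ! j'))"
    unfolding supermod_def .
qed

lemma chain_covered:
  assumes "chain A xs" "i < i'" "i' < i''" "i'' < length xs" "w \<in> V" "E (xs ! i') w"
  shows "E (xs ! i) w \<or> E (xs ! i'') w"
  using assms unfolding chain_def sorted_wrt_iff_nth_less
  by (intro antichain_covered[of "set xs" _ "xs ! i'"]) auto

lemma chain_two_monotone:
  assumes A: "chain A xs" and B: "chain B ys"
  shows "\<exists>a\<le>length xs. \<exists>b\<le>length ys. \<exists>c\<le>length xs. \<exists>d\<le>length ys.
    \<forall>i<length xs. \<forall>j<length ys. E (xs ! i) (ys ! j) \<longleftrightarrow> i < a \<and> j < b \<or> c \<le> i \<and> d \<le> j"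
proof (rule supermod_matrix_two_monotone[OF chain_sm[OF A B]])
  have V: "set xs \<subseteq> V" "set ys \<subseteq> V" using A B unfolding chain_def antichain_def by auto
  show "E (xs ! i) (ys ! j) \<or> E (xs ! i) (ys ! j'')"
    if "i < length xs" "j < j'" "j' < j''" "j'' < length ys" "E (xs ! i) (ys ! j')" for i j j' j''
    using chain_covered[OF B that(2-4), of "xs ! i"] V that E_sym nth_mem by blast
  show "E (xs ! i) (ys ! j) \<or> E (xs ! i'') (ys ! j)"
    if "j < length ys" "i < i'" "i' < i''" "i'' < length xs" "E (xs ! i') (ys ! j)" for i i' i'' j
    using chain_covered[OF A that(2-4), of "ys ! j"] V that nth_mem by blast
qed

end

section \<open>Arcs of the circle and their angles\<close>

lemma cis_eq_iff_shift: "cis x = cis y \<longleftrightarrow> (\<exists>k::int. x = y + 2 * pi * k)"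
proof -
  have "cis x = cis y \<longleftrightarrow> sin x = sin y \<and> cos x = cos y" by (auto simp: complex_eq_iff)
  then show ?thesis unfolding sin_cos_eq_iff .
qed

text \<open>A shift by full turns brings the interval of angles around \<open>t\<close>; as the
  antipode of \<open>cis t\<close> is missing, it extends by less than a half turn in each
  direction.\<close>

lemma circle_arc_angles:
  assumes "circle_arc A" "cis t \<in> A" "- cis t \<notin> A"
  obtains a b where "t - pi < a" "a \<le> t" "t \<le> b" "b < t + pi" "A = cis ` {a..b}"
proof -
  obtain a b where ab: "a < b" "A = cis ` {a..b}" using assms(1) unfolding circle_arc_def by blast
  then obtain s where s: "s \<in> {a..b}" "cis t = cis s" using assms(2) by auto
  then obtain k :: int where k: "t = s + 2 * pi * k" using cis_eq_iff_shift by blast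
  define a' b' where "a' = a + 2 * pi * k" and "b' = b + 2 * pi * k"
  have "{a'..b'} = (+) (2 * pi * k) ` {a..b}" unfolding a'_def b'_def by (simp add: algebra_simps)
  moreover have "cis (2 * pi * k + x) = cis x" for x
    using cis_eq_iff_shift by (metis add.commute)
  ultimately have "cis ` {a'..b'} = A" using ab(2) by (simp only: image_image)
  moreover have "a' \<le> t" "t \<le> b'" using s k unfolding a'_def b'_def by auto
  moreover have "cis (t + pi) = - cis t" "cis (t - pi) = - cis t"
    by (simp_all add: complex_eq_iff)
  then have "t + pi \<notin> {a'..b'}" "t - pi \<notin> {a'..b'}"
    using assms(3) \<open>cis ` {a'..b'} = A\<close> by (metis image_eqI)+
  then have "t - pi < a'" "b' < t + pi"
    using \<open>a' \<le> t\<close> \<open>t \<le> b'\<close> pi_gt_zero unfolding atLeastAtMost_iff by linarith+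
  ultimately show thesis using that by blast
qed


lemma mem_arc_iff:
  assumes "t - pi < a" "b < t + pi" "t - pi \<le> x" "x < t + pi"
  shows "cis x \<in> cis ` {a..b} \<longleftrightarrow> a \<le> x \<and> x \<le> b"
proof
  assume "cis x \<in> cis ` {a..b}"
  then obtain y and k :: int where y: "a \<le> y" "y \<le> b" "x = y + 2 * pi * k"
    using cis_eq_iff_shift by auto
  have "2 * pi * k < 2 * pi * 1" "2 * pi * (- 1) < 2 * pi * k" using y assms by linarith+
  then have "k < 1" "- 1 < k"
    unfolding mult_less_cancel_left_pos[OF mult_pos_pos[OF zero_less_numeral pi_gt_zero]] by auto
  then have "k = 0" by simp
  then show "a \<le> x \<and> x \<le> b" using y by simp
qed simp

text \<open>The left side has the angles from \<open>pi / 2\<close> to \<open>3 * pi / 2\<close>,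
  where the arcs are apart iff \<open>b < c\<close>. The second arc continues to the right side
  beyond \<open>3 * pi / 2\<close>, and only after a shift by \<open>2 * pi\<close> can its end
  \<open>d\<close> be compared with \<open>a\<close>.\<close>

lemma opposite_arcs_disjoint_iff:
  assumes "- pi / 2 < a" "a \<le> pi / 2" "pi / 2 \<le> b" "b < 3 * pi / 2"
    and "pi / 2 < c" "c \<le> 3 * pi / 2" "3 * pi / 2 \<le> d" "d < 5 * pi / 2"
  shows "cis ` {a..b} \<inter> cis ` {c..d} = {} \<longleftrightarrow> d - 2 * pi < a \<and> b < c"
proof -
  have shift: "cis (x - 2 * pi) = cis x" for x
    using cis_eq_iff_shift[of "x - 2 * pi" x] by (auto intro!: exI[of _ "-1"])
  have mem: "cis x \<in> cis ` {a..b} \<longleftrightarrow> a \<le> x \<and> x \<le> b" if "- pi / 2 \<le> x" "x < 3 * pi / 2" for x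
    using mem_arc_iff[of "pi / 2" a b x] assms that by (simp add: field_simps)
  have mem': "cis x \<in> cis ` {a..b} \<longleftrightarrow> a \<le> x - 2 * pi"
    if "3 * pi / 2 \<le> x" "x \<le> d" for x
    using mem[of "x - 2 * pi"] assms that unfolding shift by simp
  show ?thesis
  proof safe
    assume e: "cis ` {a..b} \<inter> cis ` {c..d} = {}"
    have "cis d \<in> cis ` {c..d}" "cis b \<in> cis ` {a..b}" using assms by auto
    then have 1: "cis d \<notin> cis ` {a..b}" "cis b \<notin> cis ` {c..d}" using e by blast+
    show "d - 2 * pi < a" using 1 mem'[of d] assms by auto
    show "b < c" using 1 assms by (meson atLeastAtMost_iff image_eqI not_less order_less_imp_le order_trans)
  next
    fix y assume *: "d - 2 * pi < a" "b < c" "y \<in> {c..d}"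
  {
    fix x assume **: "x \<in> {a..b}" "cis x = cis y"
    then have "cis y \<in> cis ` {a..b}" by (metis image_eqI)
    then have False using mem[of y] mem'[of y] * assms by (cases "y < 3 * pi / 2") auto
  }
  then show "cis x \<in> {}" if "x \<in> {a..b}" "cis x = cis y" for x using that by blast
  qed
qed

lemma bi_arc_angles:
  assumes "is_bi_arc N S"
  shows "\<exists>a b c d. N = cis ` {a..b} \<and> S = cis ` {c..d} \<and>
    - pi / 2 < a \<and> a \<le> pi / 2 \<and> pi / 2 \<le> b \<and> b < 3 * pi / 2 \<and>
    pi / 2 < c \<and> c \<le> 3 * pi / 2 \<and> 3 * pi / 2 \<le> d \<and> d < 5 * pi / 2"
proof -
  have top: "cis (pi / 2) = \<i>" by (simp add: complex_eq_iff)
  have "cis (3 * pi / 2) = cis (- (pi / 2))"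
    unfolding cis_eq_iff_shift by (auto intro!: exI[of _ 1])
  also have "\<dots> = - \<i>" by (simp add: complex_eq_iff)
  finally have bot: "cis (3 * pi / 2) = - \<i>" .
  have *: "circle_arc N" "circle_arc S" "cis (pi / 2) \<in> N" "- cis (pi / 2) \<notin> N"
    "cis (3 * pi / 2) \<in> S" "- cis (3 * pi / 2) \<notin> S"
    using assms unfolding is_bi_arc_def top bot by auto
  obtain a b where "pi / 2 - pi < a" "a \<le> pi / 2" "pi / 2 \<le> b" "b < pi / 2 + pi" "N = cis ` {a..b}"
    using circle_arc_angles[OF *(1,3,4)] .
  moreover obtain c d where "3 * pi / 2 - pi < c" "c \<le> 3 * pi / 2" "3 * pi / 2 \<le> d"
    "d < 3 * pi / 2 + pi" "S = cis ` {c..d}"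
    using circle_arc_angles[OF *(2,5,6)] .
  ultimately show ?thesis
    by (intro exI[of _ a] exI[of _ b] exI[of _ c] exI[of _ d] conjI) (assumption | linarith)+
qed

text \<open>A point of the circle is located by its distance from the top along the right or the left
  side. The arcs \<open>N x\<close> and \<open>S y\<close> are disjoint if they are so on both sides.\<close>
lemma bi_arc_graph_order:
  assumes "is_graph H" "bi_arc_graph H" "\<not> (\<exists>u v. irreflexive_edge H u v)"
    and triple: "\<not> (\<exists>U \<subseteq> verts H. card U = 3 \<and> has_private_neighbors H U)"
  shows "\<exists>nr nl sr sl. biarc_order (verts H) (adj H) nr nl sr sl"
proof -
  obtain N S where NS: "\<And>x. x \<in> verts H \<Longrightarrow> is_bi_arc (N x) (S x)"
    and "\<forall>x\<in>verts H. \<forall>y\<in>verts H. (adj H x y \<longrightarrow> N x \<inter> S y = {} \<and> N y \<inter> S x = {}) \<and>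
        (\<not> adj H x y \<longrightarrow> N x \<inter> S y \<noteq> {} \<and> N y \<inter> S x \<noteq> {})"
    using assms(2) unfolding bi_arc_graph_def by blast
  then have adj: "adj H x y \<longleftrightarrow> N x \<inter> S y = {}" if "x \<in> verts H" "y \<in> verts H" for x y
    using that by blast
  have "\<forall>x. \<exists>a b c d. x \<in> verts H \<longrightarrow> N x = cis ` {a..b} \<and> S x = cis ` {c..d} \<and>
    - pi / 2 < a \<and> a \<le> pi / 2 \<and> pi / 2 \<le> b \<and> b < 3 * pi / 2 \<and>
    pi / 2 < c \<and> c \<le> 3 * pi / 2 \<and> 3 * pi / 2 \<le> d \<and> d < 5 * pi / 2"
    using bi_arc_angles[OF NS] by blast
  then obtain a b c d where abcd: "\<forall>x. x \<in> verts H \<longrightarrow>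
    N x = cis ` {a x..b x} \<and> S x = cis ` {c x..d x} \<and>
    - pi / 2 < a x \<and> a x \<le> pi / 2 \<and> pi / 2 \<le> b x \<and> b x < 3 * pi / 2 \<and>
    pi / 2 < c x \<and> c x \<le> 3 * pi / 2 \<and> 3 * pi / 2 \<le> d x \<and> d x < 5 * pi / 2"
    by metis
  \<comment> \<open>Going down from the top, angles decrease on the right and increase on the left,
    hence the signs. The term \<open>2 * pi\<close> is the shift of
    \<open>opposite_arcs_disjoint_iff\<close>.\<close>
  have "biarc_order (verts H) (adj H) (\<lambda>x. - a x) b (\<lambda>x. 2 * pi - d x) c"
  proof
    fix x y assume xy: "x \<in> verts H" "y \<in> verts H"
    have "N x \<inter> S y = {} \<longleftrightarrow> d y - 2 * pi < a x \<and> b x < c y"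
      using opposite_arcs_disjoint_iff[of "a x" "b x" "c y" "d y"] abcd[rule_format, OF xy(1)]
        abcd[rule_format, OF xy(2)] by simp
    then show "adj H x y \<longleftrightarrow> - a x < 2 * pi - d y \<and> b x < c y"
      using adj[OF xy] by auto
  next
    fix x y show "adj H x y = adj H y x" unfolding adj_def by (simp add: insert_commute)
  next
    fix x y assume "x \<in> verts H" "y \<in> verts H" "adj H x y"
    then show "adj H x x \<or> adj H y y"
      using assms(3) unfolding irreflexive_edge_def irreflexive_vertex_def by blast
  next
    fix x y z p q r
    assume V: "{x, y, z, p, q, r} \<subseteq> verts H"
      and E: "adj H x p" "\<not> adj H y p" "\<not> adj H z p" "\<not> adj H x q" "adj H y q" "\<not> adj H z q"
        "\<not> adj H x r" "\<not> adj H y r"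
    show "\<not> adj H z r"
    proof
      assume r: "adj H z r"
      have "x \<noteq> y" "y \<noteq> z" "x \<noteq> z" using E r by auto
      then have "card {x, y, z} = 3" by simp
      moreover have "has_private_neighbors H {x, y, z}"
        unfolding has_private_neighbors_def using E V r by auto
      moreover have "{x, y, z} \<subseteq> verts H" using V by simp
      ultimately have "\<exists>U \<subseteq> verts H. card U = 3 \<and> has_private_neighbors H U"
        by (intro exI[of _ "{x, y, z}"] conjI)
      with triple show False by (rule notE)
    qed
  qed
  then show ?thesis by blast
qed

text \<open>\<open>ch A\<close> lists the labels that remain of the list \<open>A\<close> after the removal of dominated labels.\<close>
definition two_monotone_chains ::
  "'a ugraph \<Rightarrow> ('a set \<Rightarrow> 'a list) \<Rightarrow> ('a set \<Rightarrow> 'a set \<Rightarrow> nat) \<Rightarrow> ('a set \<Rightarrow> 'a set \<Rightarrow> nat) \<Rightarrow>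
    ('a set \<Rightarrow> 'a set \<Rightarrow> nat) \<Rightarrow> ('a set \<Rightarrow> 'a set \<Rightarrow> nat) \<Rightarrow> bool" where
  "two_monotone_chains H ch pa pb qa qb \<longleftrightarrow>
     (\<forall>A\<subseteq>verts H. set (ch A) \<subseteq> A \<and> length (ch A) \<le> card (verts H) \<and>
        (\<forall>x\<in>A. \<exists>y\<in>set (ch A). \<forall>z\<in>verts H. adj H x z \<longrightarrow> adj H y z)) \<and>
     (\<forall>A\<subseteq>verts H. \<forall>B\<subseteq>verts H.
        pa A B \<le> length (ch A) \<and> pb A B \<le> length (ch B) \<and>
        qa A B \<le> length (ch A) \<and> qb A B \<le> length (ch B) \<and>
        (\<forall>i<length (ch A). \<forall>j<length (ch B). adj H (ch A ! i) (ch B ! j) \<longleftrightarrow>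
           i < pa A B \<and> j < pb A B \<or> qa A B \<le> i \<and> qb A B \<le> j))"

lemma two_monotone_chains_exist:
  assumes "is_graph H" "bi_arc_graph H" "\<not> (\<exists>u v. irreflexive_edge H u v)"
    and "\<not> (\<exists>U \<subseteq> verts H. card U = 3 \<and> has_private_neighbors H U)"
  shows "\<exists>ch pa pb qa qb. two_monotone_chains H ch pa pb qa qb"
proof -
  obtain nr nl sr sl where "biarc_order (verts H) (adj H) nr nl sr sl"
    using bi_arc_graph_order[OF assms] by blast
  then interpret biarc_order "verts H" "adj H" nr nl sr sl .
  have fin: "finite (verts H)" using assms(1) unfolding is_graph_def by blast
  obtain ch where ch: "\<And>A. A \<subseteq> verts H \<Longrightarrow> chain A (ch A)"
    using chain_exists[OF fin] by metis
  have "\<forall>A B. \<exists>a b c d. A \<subseteq> verts H \<longrightarrow> B \<subseteq> verts H \<longrightarrow>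
      a \<le> length (ch A) \<and> b \<le> length (ch B) \<and> c \<le> length (ch A) \<and> d \<le> length (ch B) \<and>
      (\<forall>i<length (ch A). \<forall>j<length (ch B). adj H (ch A ! i) (ch B ! j) \<longleftrightarrow>
        i < a \<and> j < b \<or> c \<le> i \<and> d \<le> j)"
  proof (intro allI)
    fix A B
    show "\<exists>a b c d. A \<subseteq> verts H \<longrightarrow> B \<subseteq> verts H \<longrightarrow>
      a \<le> length (ch A) \<and> b \<le> length (ch B) \<and> c \<le> length (ch A) \<and> d \<le> length (ch B) \<and>
      (\<forall>i<length (ch A). \<forall>j<length (ch B). adj H (ch A ! i) (ch B ! j) \<longleftrightarrow>
        i < a \<and> j < b \<or> c \<le> i \<and> d \<le> j)"
    proof (cases "A \<subseteq> verts H \<and> B \<subseteq> verts H")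
      case True
      then have AB: "A \<subseteq> verts H" "B \<subseteq> verts H" by auto
      from chain_two_monotone[OF ch[OF AB(1)] ch[OF AB(2)]]
      obtain a b c d where "a \<le> length (ch A)" "b \<le> length (ch B)" "c \<le> length (ch A)"
        "d \<le> length (ch B)" "\<forall>i<length (ch A). \<forall>j<length (ch B).
          adj H (ch A ! i) (ch B ! j) \<longleftrightarrow> i < a \<and> j < b \<or> c \<le> i \<and> d \<le> j"
        by (elim exE conjE)
      then show ?thesis by (intro exI impI conjI)
    qed blast
  qed
  then obtain pa pb qa qb where two: "\<forall>A B. A \<subseteq> verts H \<longrightarrow> B \<subseteq> verts H \<longrightarrow>
      pa A B \<le> length (ch A) \<and> pb A B \<le> length (ch B) \<and>
      qa A B \<le> length (ch A) \<and> qb A B \<le> length (ch B) \<and>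
      (\<forall>i<length (ch A). \<forall>j<length (ch B). adj H (ch A ! i) (ch B ! j) \<longleftrightarrow>
        i < pa A B \<and> j < pb A B \<or> qa A B \<le> i \<and> qb A B \<le> j)"
    by metis
  have one: "set (ch A) \<subseteq> A \<and> length (ch A) \<le> card (verts H) \<and>
        (\<forall>x\<in>A. \<exists>y\<in>set (ch A). \<forall>z\<in>verts H. adj H x z \<longrightarrow> adj H y z)"
    if A: "A \<subseteq> verts H" for A
  proof (intro conjI)
    have "distinct (ch A)" and sub: "set (ch A) \<subseteq> A"
      and dom: "\<forall>x\<in>A. \<exists>y\<in>set (ch A). dominated x y"
      using ch[OF A] unfolding chain_def by blast+
    then show "length (ch A) \<le> card (verts H)"
      using card_mono[OF fin order_trans[OF sub A]] distinct_card by metis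
    show "set (ch A) \<subseteq> A" by (fact sub)
    show "\<forall>x\<in>A. \<exists>y\<in>set (ch A). \<forall>z\<in>verts H. adj H x z \<longrightarrow> adj H y z"
      using dom unfolding dominated_def .
  qed
  have "two_monotone_chains H ch pa pb qa qb"
    unfolding two_monotone_chains_def
  proof (rule conjI; intro allI impI)
    fix A assume "A \<subseteq> verts H"
    then show "set (ch A) \<subseteq> A \<and> length (ch A) \<le> card (verts H) \<and>
        (\<forall>x\<in>A. \<exists>y\<in>set (ch A). \<forall>z\<in>verts H. adj H x z \<longrightarrow> adj H y z)"
      by (rule one)
  qed (rule two[THEN spec, THEN spec, THEN mp, THEN mp])
  then show ?thesis by blast
qed

section \<open>A language of bounded loops\<close>

text \<open>The machine has no multiplication, so a product costs as many additions as its second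
  factor. Making that factor a variable, like the bound of a loop, lets the running time be read off
  the syntax and the values of a few variables.\<close>

datatype exp = Num nat | Var nat | Plus exp exp | Minus exp exp | Times exp nat | Arr nat exp

datatype com = Assign nat exp | Update nat exp exp | Get nat exp | Put exp exp
  | Comp com com | Cond exp com com | For nat nat com

record state =
  var :: "nat \<Rightarrow> nat"
  raw :: "nat \<Rightarrow> nat"
  arr :: "nat \<Rightarrow> nat \<Rightarrow> nat"

abbreviation set_var :: "nat \<Rightarrow> nat \<Rightarrow> state \<Rightarrow> state" where
  "set_var x k s \<equiv> s\<lparr>var := (var s)(x := k)\<rparr>"

fun aval :: "exp \<Rightarrow> state \<Rightarrow> nat" where
  "aval (Num k) s = k"
| "aval (Var x) s = var s x"
| "aval (Plus e e') s = aval e s + aval e' s"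
| "aval (Minus e e') s = aval e s - aval e' s"
| "aval (Times e x) s = aval e s * var s x"
| "aval (Arr j e) s = arr s j (aval e s)"

text \<open>\<open>b\<close> is the number of raw memory cells. The loop \<open>For i x c\<close> runs \<open>c\<close> with
  \<open>i = 0, \<dots>, x - 1\<close>.\<close>
fun sem :: "nat \<Rightarrow> com \<Rightarrow> state \<Rightarrow> state" where
  "sem b (Assign x e) s = set_var x (aval e s) s"
| "sem b (Update j e e') s = s\<lparr>arr := (arr s)(j := (arr s j)(aval e s := aval e' s))\<rparr>"
| "sem b (Get x e) s = set_var x (if aval e s < b then raw s (aval e s) else 0) s"
| "sem b (Put e e') s = (if aval e s < b then s\<lparr>raw := (raw s)(aval e s := aval e' s)\<rparr> else s)"
| "sem b (Comp c d) s = sem b d (sem b c s)"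
| "sem b (Cond e c d) s = (if aval e s \<noteq> 0 then sem b c s else sem b d s)"
| "sem b (For i x c) s = fold (\<lambda>k s. sem b c (set_var i k s)) [0..<var s x] s"

text \<open>The values of the variables in \<open>sizes c\<close>, which are the second factors and the loop bounds in
  \<open>c\<close>, bound the running time of \<open>c\<close> if \<open>c\<close> does not change them.\<close>
fun exp_sizes :: "exp \<Rightarrow> nat set" where
  "exp_sizes (Num k) = {}"
| "exp_sizes (Var x) = {}"
| "exp_sizes (Plus e e') = exp_sizes e \<union> exp_sizes e'"
| "exp_sizes (Minus e e') = exp_sizes e \<union> exp_sizes e'"
| "exp_sizes (Times e x) = insert x (exp_sizes e)"
| "exp_sizes (Arr j e) = exp_sizes e"

fun sizes :: "com \<Rightarrow> nat set" where
  "sizes (Assign x e) = exp_sizes e"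
| "sizes (Update j e e') = exp_sizes e \<union> exp_sizes e'"
| "sizes (Get x e) = exp_sizes e"
| "sizes (Put e e') = exp_sizes e \<union> exp_sizes e'"
| "sizes (Comp c d) = sizes c \<union> sizes d"
| "sizes (Cond e c d) = exp_sizes e \<union> sizes c \<union> sizes d"
| "sizes (For i x c) = insert x (sizes c)"

fun assigned :: "com \<Rightarrow> nat set" where
  "assigned (Assign x e) = {x}"
| "assigned (Update j e e') = {}"
| "assigned (Get x e) = {x}"
| "assigned (Put e e') = {}"
| "assigned (Comp c d) = assigned c \<union> assigned d"
| "assigned (Cond e c d) = assigned c \<union> assigned d"
| "assigned (For i x c) = insert i (assigned c)"

fun updated :: "com \<Rightarrow> nat set" where
  "updated (Assign x e) = {}"
| "updated (Update j e e') = {j}"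
| "updated (Get x e) = {}"
| "updated (Put e e') = {}"
| "updated (Comp c d) = updated c \<union> updated d"
| "updated (Cond e c d) = updated c \<union> updated d"
| "updated (For i x c) = updated c"

fun puts :: "com \<Rightarrow> bool" where
  "puts (Put e e') = True"
| "puts (Comp c d) = (puts c \<or> puts d)"
| "puts (Cond e c d) = (puts c \<or> puts d)"
| "puts (For i x c) = puts c"
| "puts c = False"

fun exp_arrays :: "exp \<Rightarrow> bool" where
  "exp_arrays (Plus e e') = (exp_arrays e \<and> exp_arrays e')"
| "exp_arrays (Minus e e') = (exp_arrays e \<and> exp_arrays e')"
| "exp_arrays (Times e x) = exp_arrays e"
| "exp_arrays (Arr j e) = (j < 8 \<and> exp_arrays e)"
| "exp_arrays e = True"

fun arrays :: "com \<Rightarrow> bool" where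
  "arrays (Assign x e) = exp_arrays e"
| "arrays (Update j e e') = (j < 8 \<and> exp_arrays e \<and> exp_arrays e')"
| "arrays (Get x e) = exp_arrays e"
| "arrays (Put e e') = (exp_arrays e \<and> exp_arrays e')"
| "arrays (Comp c d) = (arrays c \<and> arrays d)"
| "arrays (Cond e c d) = (exp_arrays e \<and> arrays c \<and> arrays d)"
| "arrays (For i x c) = arrays c"

section \<open>Loop invariants and frame properties\<close>

lemma fold_invariant:
  assumes "I 0 s" "\<And>k s. k < n \<Longrightarrow> I k s \<Longrightarrow> I (Suc k) (f k s)"
  shows "I n (fold f [0..<n] s)"
proof -
  have "k \<le> n \<Longrightarrow> I k (fold f [0..<k] s)" for k
    by (induction k) (use assms in auto)
  then show ?thesis by simp
qed

lemma sem_For_invariant: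
  assumes "I 0 s" "\<And>k t. k < var s x \<Longrightarrow> I k t \<Longrightarrow> I (Suc k) (sem b c (set_var i k t))"
  shows "I (var s x) (sem b (For i x c) s)"
  using fold_invariant[of I s "var s x"] assms by simp

lemma sem_frame:
  "x \<notin> assigned c \<Longrightarrow> var (sem b c s) x = var s x"
  "j \<notin> updated c \<Longrightarrow> arr (sem b c s) j = arr s j"
  "\<not> puts c \<Longrightarrow> raw (sem b c s) = raw s"
proof -
  show "x \<notin> assigned c \<Longrightarrow> var (sem b c s) x = var s x"
  proof (induction c arbitrary: s)
    case (For i y c)
    then show ?case
      using sem_For_invariant[of "\<lambda>_ t. var t x = var s x" s y b c i] by auto
  qed auto
  show "j \<notin> updated c \<Longrightarrow> arr (sem b c s) j = arr s j"
  proof (induction c arbitrary: s)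
    case (For i y c)
    then show ?case
      using sem_For_invariant[of "\<lambda>_ t. arr t j = arr s j" s y b c i] by auto
  qed auto
  show "\<not> puts c \<Longrightarrow> raw (sem b c s) = raw s"
  proof (induction c arbitrary: s)
    case (For i y c)
    then show ?case
      using sem_For_invariant[of "\<lambda>_ t. raw t = raw s" s y b c i] by auto
  qed auto
qed

text \<open>Register \<open>0\<close> holds \<open>b\<close>. Even registers hold the variables, odd ones intermediate results.
  Cell \<open>i\<close> of array \<open>j < 8\<close> is stored in memory cell \<open>b + 8 * i + j\<close>.\<close>
abbreviation var_reg :: "nat \<Rightarrow> reg" where "var_reg x \<equiv> 2 * x + 2"
abbreviation tmp :: "nat \<Rightarrow> reg" where "tmp d \<equiv> 2 * d + 1"

definition address :: "nat \<Rightarrow> nat \<Rightarrow> ram_prog" where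
  "address j d = Seq (Add (tmp d) (tmp d) (tmp d)) (Seq (Add (tmp d) (tmp d) (tmp d))
     (Seq (Add (tmp d) (tmp d) (tmp d)) (Seq (Add (tmp d) (tmp d) 0)
     (Seq (Const (tmp (d + 1)) j) (Add (tmp d) (tmp d) (tmp (d + 1)))))))"

text \<open>No instruction moves a register; the zero to be added is put into
  \<open>tmp d\<close>.\<close>

definition copy :: "reg \<Rightarrow> reg \<Rightarrow> nat \<Rightarrow> ram_prog" where
  "copy r r' d = Seq (Const (tmp d) 0) (Add r r' (tmp d))"

text \<open>The value ends up in \<open>tmp d\<close>, and only temporaries from \<open>d\<close> on
  are overwritten, so that results of enclosing expressions survive.\<close>

fun compile_exp :: "exp \<Rightarrow> nat \<Rightarrow> ram_prog" where
  "compile_exp (Num k) d = Const (tmp d) k"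
| "compile_exp (Var x) d = copy (tmp d) (var_reg x) d"
| "compile_exp (Plus e e') d =
     Seq (compile_exp e d) (Seq (compile_exp e' (d + 1)) (Add (tmp d) (tmp d) (tmp (d + 1))))"
| "compile_exp (Minus e e') d =
     Seq (compile_exp e d) (Seq (compile_exp e' (d + 1)) (Sub (tmp d) (tmp d) (tmp (d + 1))))"
| "compile_exp (Times e x) d =
     Seq (compile_exp e (d + 1)) (Seq (copy (tmp (d + 2)) (var_reg x) (d + 2))
     (Seq (Const (tmp (d + 3)) 1) (Seq (Const (tmp d) 0)
     (WhileNZ (tmp (d + 2)) (Seq (Add (tmp d) (tmp d) (tmp (d + 1)))
        (Sub (tmp (d + 2)) (tmp (d + 2)) (tmp (d + 3))))))))"
| "compile_exp (Arr j e) d = Seq (compile_exp e d) (Seq (address j d) (Load (tmp d) (tmp d)))"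

text \<open>In \<open>Get\<close> and \<open>Put\<close> the difference of register 0 and the
  address is nonzero iff the address is below \<open>b\<close>. \<open>For\<close> counts down in
  \<open>tmp d\<close>, with the index in \<open>tmp (d + 1)\<close> and the constant 1 in
  \<open>tmp (d + 2)\<close>. The body starts at \<open>d + 3\<close> and cannot disturb them, even
  if it assigns to the loop variable.\<close>

fun compile :: "com \<Rightarrow> nat \<Rightarrow> ram_prog" where
  "compile (Assign x e) d = Seq (compile_exp e d) (copy (var_reg x) (tmp d) (d + 1))"
| "compile (Update j e e') d =
     Seq (compile_exp e d) (Seq (address j d) (Seq (compile_exp e' (d + 1))
       (Store (tmp d) (tmp (d + 1)))))"
| "compile (Get x e) d =
     Seq (compile_exp e d) (Seq (Sub (tmp (d + 1)) 0 (tmp d))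
       (IfNZ (tmp (d + 1)) (Load (var_reg x) (tmp d)) (Const (var_reg x) 0)))"
| "compile (Put e e') d =
     Seq (compile_exp e d) (Seq (compile_exp e' (d + 1)) (Seq (Sub (tmp (d + 2)) 0 (tmp d))
       (IfNZ (tmp (d + 2)) (Store (tmp d) (tmp (d + 1))) (Const (tmp d) 0))))"
| "compile (Comp c c') d = Seq (compile c d) (compile c' d)"
| "compile (Cond e c c') d = Seq (compile_exp e d) (IfNZ (tmp d) (compile c d) (compile c' d))"
| "compile (For i x c) d =
     Seq (copy (tmp d) (var_reg x) d) (Seq (Const (tmp (d + 1)) 0) (Seq (Const (tmp (d + 2)) 1)
     (WhileNZ (tmp d) (Seq (copy (var_reg i) (tmp (d + 1)) (d + 3)) (Seq (compile c (d + 3))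
        (Seq (Add (tmp (d + 1)) (tmp (d + 1)) (tmp (d + 2)))
          (Sub (tmp d) (tmp d) (tmp (d + 2)))))))))"

fun exp_time :: "exp \<Rightarrow> nat \<Rightarrow> nat" where
  "exp_time (Num k) M = 1"
| "exp_time (Var x) M = 2"
| "exp_time (Plus e e') M = exp_time e M + exp_time e' M + 1"
| "exp_time (Minus e e') M = exp_time e M + exp_time e' M + 1"
| "exp_time (Times e x) M = exp_time e M + 3 * M + 5"
| "exp_time (Arr j e) M = exp_time e M + 7"

fun com_time :: "com \<Rightarrow> nat \<Rightarrow> nat" where
  "com_time (Assign x e) M = exp_time e M + 2"
| "com_time (Update j e e') M = exp_time e M + exp_time e' M + 7"
| "com_time (Get x e) M = exp_time e M + 3"
| "com_time (Put e e') M = exp_time e M + exp_time e' M + 3"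
| "com_time (Comp c d) M = com_time c M + com_time d M"
| "com_time (Cond e c d) M = exp_time e M + com_time c M + com_time d M + 1"
| "com_time (For i x c) M = M * (com_time c M + 5) + 5"

section \<open>Correctness and running time of the compiled programs\<close>

definition ram_within :: "ram_prog \<Rightarrow> ram_state \<Rightarrow> nat \<Rightarrow> ram_state \<Rightarrow> bool" where
  "ram_within c s T s' \<longleftrightarrow> (\<exists>t\<le>T. ram_exec c s t s')"

lemma ram_within_simple:
  "ram_within (Const r k) (\<rho>, m) 1 (\<rho>(r := k), m)"
  "ram_within (Add r a a') (\<rho>, m) 1 (\<rho>(r := \<rho> a + \<rho> a'), m)"
  "ram_within (Sub r a a') (\<rho>, m) 1 (\<rho>(r := \<rho> a - \<rho> a'), m)"
  "ram_within (Load r a) (\<rho>, m) 1 (\<rho>(r := m (\<rho> a)), m)"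
  "ram_within (Store a r) (\<rho>, m) 1 (\<rho>, m(\<rho> a := \<rho> r))"
  unfolding ram_within_def by (intro exI[of _ 1] conjI order_refl ram_exec.intros)+

lemma ram_within_Seq:
  "ram_within c s T s' \<Longrightarrow> ram_within d s' T' s'' \<Longrightarrow> T + T' \<le> U \<Longrightarrow> ram_within (Seq c d) s U s''"
  unfolding ram_within_def using ram_exec.Seq by (meson add_mono order_trans)

lemma ram_within_If:
  "(fst s r \<noteq> 0 \<Longrightarrow> ram_within c s T s') \<Longrightarrow> (fst s r = 0 \<Longrightarrow> ram_within d s T s') \<Longrightarrow>
    ram_within (IfNZ r c d) s (Suc T) s'"
  unfolding ram_within_def
proof (cases "fst s r = 0")
  case True
  assume "fst s r = 0 \<Longrightarrow> \<exists>t\<le>T. ram_exec d s t s'"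
  then obtain t where "t \<le> T" "ram_exec d s t s'" using True by blast
  then show "\<exists>t\<le>Suc T. ram_exec (IfNZ r c d) s t s'"
    using IfFalse[of s r d t s' c] True by (intro exI[of _ "Suc t"]) simp
next
  case False
  assume "fst s r \<noteq> 0 \<Longrightarrow> \<exists>t\<le>T. ram_exec c s t s'"
  then obtain t where "t \<le> T" "ram_exec c s t s'" using False by blast
  then show "\<exists>t\<le>Suc T. ram_exec (IfNZ r c d) s t s'"
    using IfTrue[of s r c t s' d] False by (intro exI[of _ "Suc t"]) simp
qed

lemma ram_within_count_down:
  assumes "I n s" "\<And>k s. I k s \<Longrightarrow> fst s r = k"
    and "\<And>k s. I (Suc k) s \<Longrightarrow> k < n \<Longrightarrow> \<exists>s'. ram_within c s T s' \<and> I k s'"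
  shows "\<exists>s'. ram_within (WhileNZ r c) s (n * (T + 1) + 1) s' \<and> I 0 s'"
  using assms
proof (induction n arbitrary: s)
  case 0
  then have "ram_within (WhileNZ r c) s (0 * (T + 1) + 1) s"
    unfolding ram_within_def using WhileFalse[of s r c] by (intro exI[of _ 1]) simp
  then show ?case using 0 by blast
next
  case (Suc n)
  obtain s' where s': "ram_within c s T s'" "I n s'" using Suc.prems(1,3) by blast
  obtain s'' where s'': "ram_within (WhileNZ r c) s' (n * (T + 1) + 1) s''" "I 0 s''"
    using Suc.IH[OF s'(2) Suc.prems(2)] Suc.prems(3) by (metis less_Suc_eq)
  obtain t t' where t: "t \<le> T" "ram_exec c s t s'" "t' \<le> n * (T + 1) + 1"
    "ram_exec (WhileNZ r c) s' t' s''"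
    using s'(1) s''(1) unfolding ram_within_def by blast
  have nz: "fst s r \<noteq> 0" using Suc.prems(2)[OF Suc.prems(1)] by simp
  have "ram_exec (WhileNZ r c) s (Suc (t + t')) s''"
    by (rule WhileTrue[OF nz t(2,4)])
  moreover have "Suc (t + t') \<le> Suc n * (T + 1) + 1" using t by simp
  ultimately show ?case using s''(2) unfolding ram_within_def by blast
qed

definition represents :: "nat \<Rightarrow> state \<Rightarrow> ram_state \<Rightarrow> bool" where
  "represents b s z \<longleftrightarrow> fst z 0 = b \<and> (\<forall>x. fst z (var_reg x) = var s x) \<and>
     (\<forall>i<b. snd z i = raw s i) \<and> (\<forall>j<8. \<forall>i. snd z (b + 8 * i + j) = arr s j i)"

text \<open>This is the guarantee for commands, whose effect on even registers is described by
  \<open>represents\<close>. Expressions satisfy the stronger \<open>preserves_vars\<close>.\<close>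

definition preserves :: "nat \<Rightarrow> (reg \<Rightarrow> nat) \<Rightarrow> (reg \<Rightarrow> nat) \<Rightarrow> bool" where
  "preserves d \<rho> \<rho>' \<longleftrightarrow> (\<forall>r<tmp d. odd r \<longrightarrow> \<rho>' r = \<rho> r)"

definition preserves_vars :: "nat \<Rightarrow> (reg \<Rightarrow> nat) \<Rightarrow> (reg \<Rightarrow> nat) \<Rightarrow> bool" where
  "preserves_vars d \<rho> \<rho>' \<longleftrightarrow> (\<forall>r. r < tmp d \<or> even r \<longrightarrow> \<rho>' r = \<rho> r)"

lemma preserves_vars_refl: "preserves_vars d \<rho> \<rho>"
  by (simp add: preserves_vars_def)

lemma preserves_vars_tmp:
  "preserves_vars d \<rho> \<rho>' \<Longrightarrow> d \<le> d' \<Longrightarrow> preserves_vars d \<rho> (\<rho>'(tmp d' := k))"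
  by (auto simp: preserves_vars_def)

lemma preserves_vars_trans:
  "preserves_vars d \<rho> \<rho>' \<Longrightarrow> preserves_vars d' \<rho>' \<rho>'' \<Longrightarrow> d \<le> d' \<Longrightarrow> preserves_vars d \<rho> \<rho>''"
  by (auto simp: preserves_vars_def)

lemma represents_preserves_vars:
  "represents b s (\<rho>, m) \<Longrightarrow> preserves_vars d \<rho> \<rho>' \<Longrightarrow> represents b s (\<rho>', m)"
  by (auto simp: represents_def preserves_vars_def)

lemma ram_within_copy:
  assumes "r' \<noteq> tmp d \<or> \<rho> r' = 0"
  shows "ram_within (copy r r' d) (\<rho>, m) 2 ((\<rho>(tmp d := 0))(r := \<rho> r'), m)"
proof -
  have "ram_within (copy r r' d) (\<rho>, m) 2
      ((\<rho>(tmp d := 0))(r := (\<rho>(tmp d := 0)) r' + (\<rho>(tmp d := 0)) (tmp d)), m)"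
    unfolding copy_def by (rule ram_within_Seq[OF ram_within_simple(1,2)]) simp
  also have "(\<rho>(tmp d := 0)) r' + (\<rho>(tmp d := 0)) (tmp d) = \<rho> r'" using assms by auto
  finally show ?thesis .
qed

lemma ram_within_address:
  shows "\<exists>\<rho>'. ram_within (address j d) (\<rho>, m) 6 (\<rho>', m) \<and> preserves_vars d \<rho> \<rho>' \<and>
    \<rho>' (tmp d) = \<rho> 0 + 8 * \<rho> (tmp d) + j"
  unfolding address_def
  by (rule exI, rule conjI, (rule ram_within_Seq ram_within_simple)+)
    (auto simp: preserves_vars_def)

lemma compile_exp_correct:
  assumes "represents b s (\<rho>, m)" "exp_arrays e" "\<forall>x\<in>exp_sizes e. var s x \<le> M"
  shows "\<exists>\<rho>'. ram_within (compile_exp e d) (\<rho>, m) (exp_time e M) (\<rho>', m) \<and>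
    preserves_vars d \<rho> \<rho>' \<and> \<rho>' (tmp d) = aval e s"
  using assms
proof (induction e arbitrary: d \<rho>)
  case (Num k)
  show ?case
    using ram_within_simple(1) by (force simp: preserves_vars_def)
next
  case (Var x)
  have "\<rho> (var_reg x) = var s x" using Var by (auto simp: represents_def)
  moreover have "var_reg x \<noteq> tmp d" by presburger
  ultimately have "ram_within (compile_exp (Var x) d) (\<rho>, m) (exp_time (Var x) M)
      (\<rho>(tmp d := var s x), m)"
    using ram_within_copy[of "var_reg x" d \<rho> "tmp d" m] by simp
  then show ?case by - (rule exI, rule conjI, assumption, auto simp: preserves_vars_def)
next
  case (Plus e e')
  obtain \<rho>1 where 1: "ram_within (compile_exp e d) (\<rho>, m) (exp_time e M) (\<rho>1, m)"
    "preserves_vars d \<rho> \<rho>1" "\<rho>1 (tmp d) = aval e s"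
    using Plus.IH(1)[of \<rho> d] Plus.prems by auto
  obtain \<rho>2 where 2: "ram_within (compile_exp e' (d + 1)) (\<rho>1, m) (exp_time e' M) (\<rho>2, m)"
    "preserves_vars (d + 1) \<rho>1 \<rho>2" "\<rho>2 (tmp (d + 1)) = aval e' s"
    using Plus.IH(2)[of \<rho>1 "d + 1"] Plus.prems represents_preserves_vars[OF Plus.prems(1) 1(2)]
    by auto
  have "ram_within (compile_exp (Plus e e') d) (\<rho>, m) (exp_time (Plus e e') M)
    (\<rho>2(tmp d := \<rho>2 (tmp d) + \<rho>2 (tmp (d + 1))), m)"
    unfolding compile_exp.simps
    by (rule ram_within_Seq[OF 1(1)] ram_within_Seq[OF 2(1)] ram_within_simple order_refl)+ simp
  then show ?case using 1 2
    by - (rule exI, rule conjI, assumption, auto simp: preserves_vars_def)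
next
  case (Minus e e')
  obtain \<rho>1 where 1: "ram_within (compile_exp e d) (\<rho>, m) (exp_time e M) (\<rho>1, m)"
    "preserves_vars d \<rho> \<rho>1" "\<rho>1 (tmp d) = aval e s"
    using Minus.IH(1)[of \<rho> d] Minus.prems by auto
  obtain \<rho>2 where 2: "ram_within (compile_exp e' (d + 1)) (\<rho>1, m) (exp_time e' M) (\<rho>2, m)"
    "preserves_vars (d + 1) \<rho>1 \<rho>2" "\<rho>2 (tmp (d + 1)) = aval e' s"
    using Minus.IH(2)[of \<rho>1 "d + 1"] Minus.prems represents_preserves_vars[OF Minus.prems(1) 1(2)]
    by auto
  have "ram_within (compile_exp (Minus e e') d) (\<rho>, m) (exp_time (Minus e e') M)
    (\<rho>2(tmp d := \<rho>2 (tmp d) - \<rho>2 (tmp (d + 1))), m)"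
    unfolding compile_exp.simps
    by (rule ram_within_Seq[OF 1(1)] ram_within_Seq[OF 2(1)] ram_within_simple order_refl)+ simp
  then show ?case using 1 2
    by - (rule exI, rule conjI, assumption, auto simp: preserves_vars_def)
next
  case (Times e x)
  obtain \<rho>1 where 1: "ram_within (compile_exp e (d + 1)) (\<rho>, m) (exp_time e M) (\<rho>1, m)"
    "preserves_vars (d + 1) \<rho> \<rho>1" "\<rho>1 (tmp (d + 1)) = aval e s"
    using Times.IH[of \<rho> "d + 1"] Times.prems by auto
  have x: "\<rho>1 (var_reg x) = var s x"
    using represents_preserves_vars[OF Times.prems(1) 1(2)] by (auto simp: represents_def)
  define n where "n = var s x"
  define \<rho>2 where "\<rho>2 = \<rho>1(tmp (d + 2) := n, tmp (d + 3) := 1, tmp d := 0)"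
  define I where "I = (\<lambda>k z. snd z = m \<and> preserves_vars d \<rho> (fst z) \<and> fst z (tmp (d + 3)) = 1 \<and>
    fst z (tmp (d + 1)) = aval e s \<and> fst z (tmp (d + 2)) = k \<and> k \<le> n \<and>
    fst z (tmp d) = (n - k) * aval e s)"
  have cnt: "fst z (tmp (d + 2)) = k" if "I k z" for k z using that unfolding I_def by blast
  have init: "I n (\<rho>2, m)" unfolding I_def \<rho>2_def using 1 by (auto simp: preserves_vars_def)
  have step: "\<exists>s'. ram_within (Seq (Add (tmp d) (tmp d) (tmp (d + 1)))
      (Sub (tmp (d + 2)) (tmp (d + 2)) (tmp (d + 3)))) z 2 s' \<and> I k s'" if I: "I (Suc k) z" for k z
  proof -
    obtain \<rho>z where z: "z = (\<rho>z, m)" using I unfolding I_def by (metis prod.collapse)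
    have "Suc k \<le> n" using I unfolding I_def by blast
    then have "Suc (n - Suc k) = n - k" by simp
    then have *: "(n - k) * aval e s = (n - Suc k) * aval e s + aval e s"
      by (metis add.commute mult_Suc)
    define \<rho>y where "\<rho>y = \<rho>z(tmp d := \<rho>z (tmp d) + \<rho>z (tmp (d + 1)))"
    define \<rho>x where "\<rho>x = \<rho>y(tmp (d + 2) := \<rho>y (tmp (d + 2)) - \<rho>y (tmp (d + 3)))"
    have "ram_within (Seq (Add (tmp d) (tmp d) (tmp (d + 1)))
      (Sub (tmp (d + 2)) (tmp (d + 2)) (tmp (d + 3)))) z 2 (\<rho>x, m)"
      unfolding z \<rho>x_def \<rho>y_def by (rule ram_within_Seq[OF ram_within_simple(2,3)]) simp
    moreover have "I k (\<rho>x, m)"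
      using I *
      unfolding z I_def \<rho>x_def \<rho>y_def by (auto simp: preserves_vars_def)
    ultimately show ?thesis by blast
  qed
  obtain z where z: "ram_within (WhileNZ (tmp (d + 2)) (Seq (Add (tmp d) (tmp d)
      (tmp (d + 1))) (Sub (tmp (d + 2)) (tmp (d + 2)) (tmp (d + 3))))) (\<rho>2, m) (n * (2 + 1) + 1) z"
      "I 0 z"
    using ram_within_count_down[of I, OF init cnt step] by blast
  have "ram_within (Seq (copy (tmp (d + 2)) (var_reg x) (d + 2)) (Seq (Const (tmp (d + 3)) 1)
     (Seq (Const (tmp d) 0) (WhileNZ (tmp (d + 2)) (Seq (Add (tmp d) (tmp d) (tmp (d + 1)))
        (Sub (tmp (d + 2)) (tmp (d + 2)) (tmp (d + 3)))))))) (\<rho>1, m) (2 + (1 + (1 + (n * (2 + 1) + 1)))) z"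
  proof (rule ram_within_Seq[OF ram_within_copy])
    have eq: "\<rho>2 = ((\<rho>1(tmp (d + 2) := 0, tmp (d + 2) := \<rho>1 (var_reg x)))(tmp (d + 3) := 1))(tmp d := 0)"
      unfolding \<rho>2_def n_def x by simp
    show "ram_within (Seq (Const (tmp (d + 3)) 1)
     (Seq (Const (tmp d) 0) (WhileNZ (tmp (d + 2)) (Seq (Add (tmp d) (tmp d) (tmp (d + 1)))
        (Sub (tmp (d + 2)) (tmp (d + 2)) (tmp (d + 3)))))))
        (\<rho>1(tmp (d + 2) := 0, tmp (d + 2) := \<rho>1 (var_reg x)), m) (1 + (1 + (n * (2 + 1) + 1))) z"
      by (rule ram_within_Seq[OF ram_within_simple(1)
          ram_within_Seq[OF ram_within_simple(1) z(1)[unfolded eq]]]) (rule order_refl)+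
  qed (presburger | simp)+
  then have "ram_within (compile_exp (Times e x) d) (\<rho>, m) (exp_time (Times e x) M) z"
    unfolding compile_exp.simps
    by (rule ram_within_Seq[OF 1(1)]) (use Times.prems in \<open>auto simp: n_def\<close>)
  then show ?case
    using z(2) unfolding I_def n_def
    by (intro exI[of _ "fst z"] conjI) (auto simp: mult.commute)
next
  case (Arr j e)
  obtain \<rho>1 where 1: "ram_within (compile_exp e d) (\<rho>, m) (exp_time e M) (\<rho>1, m)"
    "preserves_vars d \<rho> \<rho>1" "\<rho>1 (tmp d) = aval e s"
    using Arr.IH[of \<rho> d] Arr.prems by auto
  obtain \<rho>2 where 2: "ram_within (address j d) (\<rho>1, m) 6 (\<rho>2, m)" "preserves_vars d \<rho>1 \<rho>2"
    "\<rho>2 (tmp d) = \<rho>1 0 + 8 * \<rho>1 (tmp d) + j"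
    using ram_within_address by blast
  have "ram_within (compile_exp (Arr j e) d) (\<rho>, m) (exp_time (Arr j e) M)
    (\<rho>2(tmp d := m (\<rho>2 (tmp d))), m)"
    unfolding compile_exp.simps
    by (rule ram_within_Seq[OF 1(1)] ram_within_Seq[OF 2(1)] ram_within_simple order_refl)+ simp
  moreover have "m (\<rho>2 (tmp d)) = arr s j (aval e s)"
    using represents_preserves_vars[OF Arr.prems(1) 1(2)] Arr.prems(2) 1(3) 2(3)
    by (auto simp: represents_def)
  ultimately show ?case using 1 2
    by - (rule exI, rule conjI, assumption, auto simp: preserves_vars_def)
qed

lemma preserves_vars_preserves: "preserves_vars d \<rho> \<rho>' \<Longrightarrow> preserves d \<rho> \<rho>'"
  by (auto simp: preserves_vars_def preserves_def)

lemma preserves_trans: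
  "preserves d \<rho> \<rho>' \<Longrightarrow> preserves d' \<rho>' \<rho>'' \<Longrightarrow> d \<le> d' \<Longrightarrow> preserves d \<rho> \<rho>''"
  by (auto simp: preserves_def)

lemma represents_set_var:
  "represents b s (\<rho>, m) \<Longrightarrow> preserves_vars d \<rho> \<rho>' \<Longrightarrow> represents b (set_var x k s) (\<rho>'(var_reg x := k), m)"
  by (auto simp: represents_def preserves_vars_def)

lemma represents_update:
  assumes "represents b s (\<rho>, m)" "preserves_vars d \<rho> \<rho>'" "j < 8"
  shows "represents b (s\<lparr>arr := (arr s)(j := (arr s j)(i := k))\<rparr>) (\<rho>', m(b + 8 * i + j := k))"
proof -
  have "i' = i \<and> j' = j" if "b + 8 * i' + j' = b + 8 * i + j" "j' < 8" for i' j'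
    using that assms(3) by presburger
  then show ?thesis using assms unfolding represents_def preserves_vars_def by fastforce
qed

lemma represents_put:
  assumes "represents b s (\<rho>, m)" "preserves_vars d \<rho> \<rho>'" "i < b"
  shows "represents b (s\<lparr>raw := (raw s)(i := k)\<rparr>) (\<rho>', m(i := k))"
  using assms by (auto simp: represents_def preserves_vars_def)

text \<open>Since \<open>c\<close> assigns no variable in \<open>sizes c\<close>, the bound
  \<open>M\<close> on their initial values holds throughout the run and limits every loop and
  product.\<close>

lemma compile_correct:
  assumes "represents b s (\<rho>, m)" "arrays c" "\<forall>x\<in>sizes c. var s x \<le> M" "sizes c \<inter> assigned c = {}"
  shows "\<exists>\<rho>' m'. ram_within (compile c d) (\<rho>, m) (com_time c M) (\<rho>', m') \<and>
    represents b (sem b c s) (\<rho>', m') \<and> preserves d \<rho> \<rho>'"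
  using assms
proof (induction c arbitrary: s d \<rho> m)
  case (Assign x e)
  obtain \<rho>1 where 1: "ram_within (compile_exp e d) (\<rho>, m) (exp_time e M) (\<rho>1, m)"
    "preserves_vars d \<rho> \<rho>1" "\<rho>1 (tmp d) = aval e s"
    using compile_exp_correct[OF Assign.prems(1), of e M d] Assign.prems by auto
  let ?\<rho> = "\<rho>1(tmp (d + 1) := 0, var_reg x := \<rho>1 (tmp d))"
  have "ram_within (compile (Assign x e) d) (\<rho>, m) (com_time (Assign x e) M) (?\<rho>, m)"
    unfolding compile.simps by (rule ram_within_Seq[OF 1(1) ram_within_copy]) auto
  moreover have "represents b (sem b (Assign x e) s) (?\<rho>, m)"
    using represents_set_var[OF Assign.prems(1) preserves_vars_tmp[OF 1(2), of "d + 1" 0]] 1(3) by simp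
  moreover have "preserves d \<rho> ?\<rho>"
    using 1(2) by (auto simp: preserves_def preserves_vars_def)
  ultimately show ?case by blast
next
  case (Update j e e')
  obtain \<rho>1 where 1: "ram_within (compile_exp e d) (\<rho>, m) (exp_time e M) (\<rho>1, m)"
    "preserves_vars d \<rho> \<rho>1" "\<rho>1 (tmp d) = aval e s"
    using compile_exp_correct[OF Update.prems(1), of e M d] Update.prems by auto
  obtain \<rho>2 where 2: "ram_within (address j d) (\<rho>1, m) 6 (\<rho>2, m)" "preserves_vars d \<rho>1 \<rho>2"
    "\<rho>2 (tmp d) = \<rho>1 0 + 8 * \<rho>1 (tmp d) + j"
    using ram_within_address by blast
  have p2: "preserves_vars d \<rho> \<rho>2" using preserves_vars_trans[OF 1(2) 2(2)] by simp
  obtain \<rho>3 where 3: "ram_within (compile_exp e' (d + 1)) (\<rho>2, m) (exp_time e' M) (\<rho>3, m)"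
    "preserves_vars (d + 1) \<rho>2 \<rho>3" "\<rho>3 (tmp (d + 1)) = aval e' s"
    using compile_exp_correct[OF represents_preserves_vars[OF Update.prems(1) p2], of e' M "d + 1"]
      Update.prems by auto
  have p3: "preserves_vars d \<rho> \<rho>3" using preserves_vars_trans[OF p2 3(2)] by simp
  have "\<rho>3 (tmp d) = \<rho>2 (tmp d)" using 3(2) by (auto simp: preserves_vars_def)
  moreover have "\<rho>1 0 = b"
    using represents_preserves_vars[OF Update.prems(1) 1(2)] by (simp add: represents_def)
  ultimately have "\<rho>3 (tmp d) = b + 8 * aval e s + j" using 1(3) 2(3) by simp
  moreover have "ram_within (compile (Update j e e') d) (\<rho>, m) (com_time (Update j e e') M)
      (\<rho>3, m(\<rho>3 (tmp d) := \<rho>3 (tmp (d + 1))))"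
    unfolding compile.simps
    by (rule ram_within_Seq[OF 1(1)] ram_within_Seq[OF 2(1)] ram_within_Seq[OF 3(1)]
      ram_within_simple order_refl)+ simp
  moreover have "represents b (sem b (Update j e e') s) (\<rho>3, m(b + 8 * aval e s + j := aval e' s))"
    using represents_update[OF Update.prems(1) p3] Update.prems(2) by simp
  ultimately show ?case using preserves_vars_preserves[OF p3] 3(3) by metis
next
  case (Get x e)
  obtain \<rho>1 where 1: "ram_within (compile_exp e d) (\<rho>, m) (exp_time e M) (\<rho>1, m)"
    "preserves_vars d \<rho> \<rho>1" "\<rho>1 (tmp d) = aval e s"
    using compile_exp_correct[OF Get.prems(1), of e M d] Get.prems by auto
  define \<rho>2 where "\<rho>2 = \<rho>1(tmp (d + 1) := \<rho>1 0 - \<rho>1 (tmp d))"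
  have b: "\<rho>1 0 = b" "\<rho>1 (tmp d) = aval e s"
    using represents_preserves_vars[OF Get.prems(1) 1(2)] 1(3) by (simp_all add: represents_def)
  have p2: "preserves_vars d \<rho> \<rho>2" unfolding \<rho>2_def by (rule preserves_vars_tmp[OF 1(2)]) simp
  let ?v = "if aval e s < b then raw s (aval e s) else 0"
  have "ram_within (IfNZ (tmp (d + 1)) (Load (var_reg x) (tmp d)) (Const (var_reg x) 0))
      (\<rho>2, m) (Suc 1) (\<rho>2(var_reg x := ?v), m)"
  proof (rule ram_within_If)
    assume "fst (\<rho>2, m) (tmp (d + 1)) \<noteq> 0"
    then have "aval e s < b" using b unfolding \<rho>2_def by simp
    moreover have "m (\<rho>2 (tmp d)) = raw s (aval e s)" if "aval e s < b"
      using Get.prems(1) b that unfolding represents_def \<rho>2_def by simp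
    ultimately show "ram_within (Load (var_reg x) (tmp d)) (\<rho>2, m) 1 (\<rho>2(var_reg x := ?v), m)"
      using ram_within_simple(4)[of "var_reg x" "tmp d" \<rho>2 m] by simp
  next
    assume "fst (\<rho>2, m) (tmp (d + 1)) = 0"
    then have "\<not> aval e s < b" using b unfolding \<rho>2_def by simp
    then show "ram_within (Const (var_reg x) 0) (\<rho>2, m) 1 (\<rho>2(var_reg x := ?v), m)"
      using ram_within_simple(1)[of "var_reg x" 0 \<rho>2 m] by simp
  qed
  then have "ram_within (compile (Get x e) d) (\<rho>, m) (com_time (Get x e) M) (\<rho>2(var_reg x := ?v), m)"
    unfolding compile.simps
    by (intro ram_within_Seq[OF 1(1) ram_within_Seq[OF ram_within_simple(3)] ])
      (auto simp: \<rho>2_def)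
  moreover have "represents b (sem b (Get x e) s) (\<rho>2(var_reg x := ?v), m)"
    using represents_set_var[OF Get.prems(1) p2] by simp
  moreover have "preserves d \<rho> (\<rho>2(var_reg x := ?v))"
    using p2 by (auto simp: preserves_def preserves_vars_def)
  ultimately show ?case by blast
next
  case (Put e e')
  obtain \<rho>1 where 1: "ram_within (compile_exp e d) (\<rho>, m) (exp_time e M) (\<rho>1, m)"
    "preserves_vars d \<rho> \<rho>1" "\<rho>1 (tmp d) = aval e s"
    using compile_exp_correct[OF Put.prems(1), of e M d] Put.prems by auto
  obtain \<rho>2 where 2: "ram_within (compile_exp e' (d + 1)) (\<rho>1, m) (exp_time e' M) (\<rho>2, m)"
    "preserves_vars (d + 1) \<rho>1 \<rho>2" "\<rho>2 (tmp (d + 1)) = aval e' s"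
    using compile_exp_correct[OF represents_preserves_vars[OF Put.prems(1) 1(2)], of e' M "d + 1"]
      Put.prems by auto
  have p2: "preserves_vars d \<rho> \<rho>2" using preserves_vars_trans[OF 1(2) 2(2)] by simp
  define \<rho>3 where "\<rho>3 = \<rho>2(tmp (d + 2) := \<rho>2 0 - \<rho>2 (tmp d))"
  have p3: "preserves_vars d \<rho> \<rho>3" unfolding \<rho>3_def by (rule preserves_vars_tmp[OF p2]) simp
  have b: "\<rho>2 0 = b"
    using represents_preserves_vars[OF Put.prems(1) p2] by (simp add: represents_def)
  have v: "\<rho>2 (tmp d) = aval e s" using 2(2) 1(3) by (auto simp: preserves_vars_def)
  let ?c = "IfNZ (tmp (d + 2)) (Store (tmp d) (tmp (d + 1))) (Const (tmp d) 0)"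
  have *: "ram_within (compile (Put e e') d) (\<rho>, m) (com_time (Put e e') M) z"
    if "ram_within ?c (\<rho>3, m) (Suc 1) z" for z
    unfolding compile.simps
    by (rule ram_within_Seq[OF 1(1) ram_within_Seq[OF 2(1)
          ram_within_Seq[OF ram_within_simple(3) that[unfolded \<rho>3_def]]]])
      (rule order_refl | simp)+
  show ?case
  proof (cases "aval e s < b")
    case True
    have "ram_within ?c (\<rho>3, m) (Suc 1) (\<rho>3, m(aval e s := aval e' s))"
    proof (rule ram_within_If)
      show "ram_within (Store (tmp d) (tmp (d + 1))) (\<rho>3, m) 1 (\<rho>3, m(aval e s := aval e' s))"
        using ram_within_simple(5)[of "tmp d" "tmp (d + 1)" \<rho>3 m] v 2(3) by (simp add: \<rho>3_def)
    qed (use True b v in \<open>simp add: \<rho>3_def\<close>)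
    then show ?thesis
      using * represents_put[OF Put.prems(1) p3 True] preserves_vars_preserves[OF p3] True
      by (metis sem.simps(4))
  next
    case False
    have "ram_within ?c (\<rho>3, m) (Suc 1) (\<rho>3(tmp d := 0), m)"
      by (rule ram_within_If[OF _ ram_within_simple(1)]) (use False b v in \<open>simp add: \<rho>3_def\<close>)
    moreover have p: "preserves_vars d \<rho> (\<rho>3(tmp d := 0))" by (rule preserves_vars_tmp[OF p3]) simp
    ultimately show ?thesis
      using * represents_preserves_vars[OF Put.prems(1) p] preserves_vars_preserves[OF p] False
      by (metis sem.simps(4))
  qed
next
  case (Comp c1 c2)
  obtain \<rho>1 m1 where 1: "ram_within (compile c1 d) (\<rho>, m) (com_time c1 M) (\<rho>1, m1)"
    "represents b (sem b c1 s) (\<rho>1, m1)" "preserves d \<rho> \<rho>1"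
    using Comp.IH(1)[of s \<rho> m d] Comp.prems by auto
  have "\<forall>x\<in>sizes c2. var (sem b c1 s) x \<le> M"
  proof
    fix x assume x: "x \<in> sizes c2"
    then have "x \<notin> assigned c1" using Comp.prems(4) by auto
    then show "var (sem b c1 s) x \<le> M" using x Comp.prems(3) sem_frame(1)[of x c1 b s] by auto
  qed
  moreover have "sizes c2 \<inter> assigned c2 = {}" using Comp.prems(4) by auto
  ultimately obtain \<rho>2 m2 where 2: "ram_within (compile c2 d) (\<rho>1, m1) (com_time c2 M) (\<rho>2, m2)"
    "represents b (sem b c2 (sem b c1 s)) (\<rho>2, m2)" "preserves d \<rho>1 \<rho>2"
    using Comp.IH(2)[OF 1(2), of d] Comp.prems by auto
  have "ram_within (compile (Comp c1 c2) d) (\<rho>, m) (com_time (Comp c1 c2) M) (\<rho>2, m2)"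
    unfolding compile.simps by (rule ram_within_Seq[OF 1(1) 2(1)]) simp
  then show ?case using 2(2) preserves_trans[OF 1(3) 2(3)] by auto
next
  case (Cond e c1 c2)
  obtain \<rho>1 where 1: "ram_within (compile_exp e d) (\<rho>, m) (exp_time e M) (\<rho>1, m)"
    "preserves_vars d \<rho> \<rho>1" "\<rho>1 (tmp d) = aval e s"
    using compile_exp_correct[OF Cond.prems(1), of e M d] Cond.prems by auto
  note r = represents_preserves_vars[OF Cond.prems(1) 1(2)]
  define c where "c = (if aval e s \<noteq> 0 then c1 else c2)"
  have "\<exists>\<rho>' m'. ram_within (compile c d) (\<rho>1, m) (com_time c M) (\<rho>', m') \<and>
    represents b (sem b c s) (\<rho>', m') \<and> preserves d \<rho>1 \<rho>'"
    using Cond.IH(1)[OF r, of d] Cond.IH(2)[OF r, of d] Cond.prems unfolding c_def by auto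
  then obtain \<rho>2 m2 where 2: "ram_within (compile c d) (\<rho>1, m) (com_time c M) (\<rho>2, m2)"
    "represents b (sem b c s) (\<rho>2, m2)" "preserves d \<rho>1 \<rho>2" by blast
  have "ram_within (IfNZ (tmp d) (compile c1 d) (compile c2 d)) (\<rho>1, m) (Suc (com_time c M)) (\<rho>2, m2)"
    by (rule ram_within_If) (use 2(1) 1(3) in \<open>auto simp: c_def\<close>)
  then have "ram_within (compile (Cond e c1 c2) d) (\<rho>, m) (com_time (Cond e c1 c2) M) (\<rho>2, m2)"
    unfolding compile.simps by (rule ram_within_Seq[OF 1(1)]) (simp add: c_def)
  moreover have "sem b (Cond e c1 c2) s = sem b c s" unfolding c_def by simp
  ultimately show ?case
    using 2(2) preserves_trans[OF preserves_vars_preserves[OF 1(2)] 2(3)] by auto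
next
  case (For i x c)
  define n where "n = var s x"
  define f where "f = (\<lambda>k s. sem b c (set_var i k s))"
  define t where "t = (\<lambda>q. fold f [0..<q] s)"
  have t: "t 0 = s" "\<And>q. t (Suc q) = sem b c (set_var i q (t q))" "t n = sem b (For i x c) s"
    unfolding t_def f_def n_def by auto
  have sizes: "var (set_var i k (t q)) y = var s y" if "y \<in> sizes c" for q y k
  proof -
    have "y \<notin> assigned c" "y \<noteq> i" using For.prems(4) that by auto
    then have "var (t q) y = var s y" by (induction q) (auto simp: t sem_frame)
    then show ?thesis using \<open>y \<noteq> i\<close> by simp
  qed
  \<comment> \<open>Here \<open>k\<close> is the number of remaining rounds, so that
    \<open>n - k\<close> is the loop index.\<close>
  define I where "I = (\<lambda>k z. k \<le> n \<and> represents b (t (n - k)) z \<and> preserves d \<rho> (fst z) \<and>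
    fst z (tmp d) = k \<and> fst z (tmp (d + 1)) = n - k \<and> fst z (tmp (d + 2)) = 1)"
  let ?body = "Seq (copy (var_reg i) (tmp (d + 1)) (d + 3)) (Seq (compile c (d + 3))
        (Seq (Add (tmp (d + 1)) (tmp (d + 1)) (tmp (d + 2)))
          (Sub (tmp d) (tmp d) (tmp (d + 2)))))"
  have nx: "\<rho> (var_reg x) = n" using For.prems(1) unfolding represents_def n_def by simp
  define \<rho>0 where "\<rho>0 = \<rho>(tmp d := n, tmp (d + 1) := 0, tmp (d + 2) := 1)"
  have pv: "preserves_vars d \<rho> \<rho>0"
    unfolding \<rho>0_def by (intro preserves_vars_tmp preserves_vars_refl) auto
  have cnt: "fst z (tmp d) = k" if "I k z" for k z using that unfolding I_def by blast
  have init: "I n (\<rho>0, m)"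
    unfolding I_def using represents_preserves_vars[OF For.prems(1) pv] preserves_vars_preserves[OF pv]
    by (auto simp: t \<rho>0_def)
  have step: "\<exists>s'. ram_within ?body z (com_time c M + 4) s' \<and> I k s'" if I: "I (Suc k) z" for k z
  proof -
    obtain \<rho>z mz where z: "z = (\<rho>z, mz)" by (cases z)
    define q where "q = n - Suc k"
    have q: "Suc q = n - k" "Suc k \<le> n" using I unfolding I_def q_def by auto
    define \<rho>1 where "\<rho>1 = \<rho>z(tmp (d + 3) := 0, var_reg i := q)"
    have z1: "\<rho>z (tmp (d + 1)) = q" "\<rho>z (tmp d) = Suc k" "\<rho>z (tmp (d + 2)) = 1"
      "represents b (t q) (\<rho>z, mz)" "preserves d \<rho> \<rho>z"
      using I unfolding I_def z q_def by auto
    have 1: "ram_within (copy (var_reg i) (tmp (d + 1)) (d + 3)) z 2 (\<rho>1, mz)"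
      using ram_within_copy[of "tmp (d + 1)" "d + 3" \<rho>z "var_reg i" mz] z1 unfolding z \<rho>1_def by simp
    have r1: "represents b (set_var i q (t q)) (\<rho>1, mz)"
      unfolding \<rho>1_def
      by (rule represents_set_var[OF z1(4) preserves_vars_tmp[OF preserves_vars_refl[of d]]]) simp
    have "\<forall>y\<in>sizes c. var (set_var i q (t q)) y \<le> M" using sizes For.prems(3) by auto
    then obtain \<rho>2 m2 where 2: "ram_within (compile c (d + 3)) (\<rho>1, mz) (com_time c M) (\<rho>2, m2)"
      "represents b (t (Suc q)) (\<rho>2, m2)" "preserves (d + 3) \<rho>1 \<rho>2"
      using For.IH[OF r1, of "d + 3"] For.prems(2,4) unfolding t by auto
    have z2: "\<rho>2 (tmp d) = Suc k" "\<rho>2 (tmp (d + 1)) = q" "\<rho>2 (tmp (d + 2)) = 1"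
    proof -
      have "tmp d' \<noteq> var_reg i" for d' by presburger
      then have "\<rho>1 (tmp d') = \<rho>z (tmp d')" if "d' < d + 3" for d' using that unfolding \<rho>1_def by simp
      then have "\<rho>2 (tmp d') = \<rho>z (tmp d')" if "d' < d + 3" for d'
        using 2(3) that unfolding preserves_def by simp
      from this[of d] this[of "d + 1"] this[of "d + 2"]
      show "\<rho>2 (tmp d) = Suc k" "\<rho>2 (tmp (d + 1)) = q" "\<rho>2 (tmp (d + 2)) = 1"
        unfolding z1 by auto
    qed
    define \<rho>3 where "\<rho>3 = \<rho>2(tmp (d + 1) := \<rho>2 (tmp (d + 1)) + \<rho>2 (tmp (d + 2)))"
    define \<rho>4 where "\<rho>4 = \<rho>3(tmp d := \<rho>3 (tmp d) - \<rho>3 (tmp (d + 2)))"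
    have w: "ram_within ?body z (com_time c M + 4) (\<rho>4, m2)"
      unfolding \<rho>4_def \<rho>3_def
      by (rule ram_within_Seq[OF 1 ram_within_Seq[OF 2(1) ram_within_Seq[OF ram_within_simple(2,3)]]])
        (rule order_refl | simp)+
    have pv4: "preserves_vars d \<rho>2 \<rho>4"
      unfolding \<rho>4_def \<rho>3_def by (intro preserves_vars_tmp preserves_vars_refl) auto
    have "preserves d \<rho>z \<rho>2" using 2(3) unfolding \<rho>1_def preserves_def by auto
    then have "preserves d \<rho> \<rho>4"
      using z1(5) preserves_vars_preserves[OF pv4] unfolding preserves_def by simp
    then have "I k (\<rho>4, m2)"
      unfolding I_def using represents_preserves_vars[OF 2(2) pv4] q z2
      by (auto simp: \<rho>4_def \<rho>3_def)
    then show ?thesis using w by blast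
  qed
  obtain z where z: "ram_within (WhileNZ (tmp d) ?body) (\<rho>0, m) (n * (com_time c M + 4 + 1) + 1) z"
      "I 0 z"
    using ram_within_count_down[of I, OF init cnt step] by blast
  have "var_reg x \<noteq> tmp d" by presburger
  then have c: "ram_within (copy (tmp d) (var_reg x) d) (\<rho>, m) 2 (\<rho>(tmp d := n), m)"
    using ram_within_copy[of "var_reg x" d \<rho> "tmp d" m] nx by simp
  have "ram_within (compile (For i x c) d) (\<rho>, m) (2 + (1 + (1 + (n * (com_time c M + 4 + 1) + 1)))) z"
    unfolding compile.simps
    by (rule ram_within_Seq[OF c ram_within_Seq[OF ram_within_simple(1)
          ram_within_Seq[OF ram_within_simple(1) z(1)[unfolded \<rho>0_def]]]]) (rule order_refl)+
  moreover have "n \<le> M" using For.prems(3) unfolding n_def by simp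
  then have "n * (com_time c M + 5) \<le> M * (com_time c M + 5)" by (rule mult_le_mono1)
  then have "2 + (1 + (1 + (n * (com_time c M + 4 + 1) + 1))) \<le> com_time (For i x c) M"
    by (simp add: algebra_simps)
  ultimately have "ram_within (compile (For i x c) d) (\<rho>, m) (com_time (For i x c) M) z"
    unfolding ram_within_def by (meson order_trans)
  then show ?case using z(2) unfolding I_def t(3)[symmetric] by (cases z) auto
qed

section \<open>Polynomial bounds and the passage to \<open>poly_time_solvable\<close>\<close>

lemma exp_time_poly: "\<exists>p :: nat poly. \<forall>M. exp_time e M = poly p M"
proof (induction e)
  case (Num k) show ?case by (intro exI[of _ "[:1:]"]) simp
next
  case (Var x) show ?case by (intro exI[of _ "[:2:]"]) simp
next
  case (Plus e e')
  then obtain p q where "\<forall>M. exp_time e M = poly p M" "\<forall>M. exp_time e' M = poly q M" by blast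
  then show ?case by (intro exI[of _ "p + q + [:1:]"]) simp
next
  case (Minus e e')
  then obtain p q where "\<forall>M. exp_time e M = poly p M" "\<forall>M. exp_time e' M = poly q M" by blast
  then show ?case by (intro exI[of _ "p + q + [:1:]"]) simp
next
  case (Times e x)
  then obtain p where "\<forall>M. exp_time e M = poly p M" by blast
  then show ?case by (intro exI[of _ "p + [:5, 3:]"]) simp
next
  case (Arr j e)
  then obtain p where "\<forall>M. exp_time e M = poly p M" by blast
  then show ?case by (intro exI[of _ "p + [:7:]"]) simp
qed

lemma com_time_poly: "\<exists>p :: nat poly. \<forall>M. com_time c M = poly p M"
proof (induction c)
  case (Assign x e)
  obtain p where "\<forall>M. exp_time e M = poly p M" using exp_time_poly by blast
  then show ?case by (intro exI[of _ "p + [:2:]"]) simp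
next
  case (Update j e e')
  obtain p q where "\<forall>M. exp_time e M = poly p M" "\<forall>M. exp_time e' M = poly q M"
    using exp_time_poly by meson
  then show ?case by (intro exI[of _ "p + q + [:7:]"]) simp
next
  case (Get x e)
  obtain p where "\<forall>M. exp_time e M = poly p M" using exp_time_poly by blast
  then show ?case by (intro exI[of _ "p + [:3:]"]) simp
next
  case (Put e e')
  obtain p q where "\<forall>M. exp_time e M = poly p M" "\<forall>M. exp_time e' M = poly q M"
    using exp_time_poly by meson
  then show ?case by (intro exI[of _ "p + q + [:3:]"]) simp
next
  case (Comp c c')
  then obtain p q where "\<forall>M. com_time c M = poly p M" "\<forall>M. com_time c' M = poly q M" by blast
  then show ?case by (intro exI[of _ "p + q"]) simp
next
  case (Cond e c c')
  obtain r where "\<forall>M. exp_time e M = poly r M" using exp_time_poly by blast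
  moreover obtain p q where "\<forall>M. com_time c M = poly p M" "\<forall>M. com_time c' M = poly q M"
    using Cond by blast
  ultimately show ?case by (intro exI[of _ "r + p + q + [:1:]"]) simp
next
  case (For i x c)
  then obtain p where "\<forall>M. com_time c M = poly p M" by blast
  then show ?case by (intro exI[of _ "[:0, 1:] * (p + [:5:]) + [:5:]"]) simp
qed

text \<open>A program is a list of commands because sizes have to be computed from the input: a size
  variable of one command may be assigned by an earlier one. So the bound is required in the state
  in which each command starts.\<close>

fun sizes_bounded :: "nat \<Rightarrow> nat \<Rightarrow> com list \<Rightarrow> state \<Rightarrow> bool" where
  "sizes_bounded b M [] s = True"
| "sizes_bounded b M (c # cs) s =
     ((\<forall>x\<in>sizes c. var s x \<le> M) \<and> sizes_bounded b M cs (sem b c s))"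

fun compile_list :: "com list \<Rightarrow> ram_prog" where
  "compile_list [] = Const 1 0"
| "compile_list (c # cs) = Seq (compile c 0) (compile_list cs)"

lemma compile_list_correct:
  assumes "represents b s (\<rho>, m)" "\<forall>c\<in>set cs. arrays c \<and> sizes c \<inter> assigned c = {}"
    "sizes_bounded b M cs s"
  shows "\<exists>\<rho>' m'. ram_within (compile_list cs) (\<rho>, m) ((\<Sum>c\<leftarrow>cs. com_time c M) + 1) (\<rho>', m') \<and>
    represents b (fold (sem b) cs s) (\<rho>', m')"
  using assms
proof (induction cs arbitrary: s \<rho> m)
  case Nil
  have "represents b s (\<rho>(1 := 0), m)" using Nil(1) by (auto simp: represents_def)
  moreover have "ram_within (compile_list []) (\<rho>, m) ((\<Sum>c\<leftarrow>[]. com_time c M) + 1) (\<rho>(1 := 0), m)"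
    using ram_within_simple(1)[of 1 0 \<rho> m] by simp
  ultimately show ?case by (metis fold_simps(1))
next
  case (Cons c cs)
  obtain \<rho>1 m1 where 1: "ram_within (compile c 0) (\<rho>, m) (com_time c M) (\<rho>1, m1)"
    "represents b (sem b c s) (\<rho>1, m1)"
    using compile_correct[OF Cons.prems(1), of c M 0] Cons.prems by auto
  obtain \<rho>2 m2 where 2:
    "ram_within (compile_list cs) (\<rho>1, m1) ((\<Sum>c\<leftarrow>cs. com_time c M) + 1) (\<rho>2, m2)"
    "represents b (fold (sem b) cs (sem b c s)) (\<rho>2, m2)"
    using Cons.IH[OF 1(2)] Cons.prems by auto
  have "ram_within (compile_list (c # cs)) (\<rho>, m) ((\<Sum>c\<leftarrow>c # cs. com_time c M) + 1) (\<rho>2, m2)"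
    unfolding compile_list.simps by (rule ram_within_Seq[OF 1(1) 2(1)]) simp
  then show ?case using 2(2) by auto
qed

definition initial_state :: "bool list \<Rightarrow> state" where
  "initial_state x = \<lparr>var = \<lambda>_. 0, raw = input_memory x, arr = \<lambda>_ _. 0\<rparr>"

text \<open>The prologue sets register 0 to the input length plus one, the number of cells that the
  input occupies. The cells behind them are 0 and hold the arrays.\<close>

definition program :: "com list \<Rightarrow> ram_prog" where
  "program cs = Seq (Load 0 0) (Seq (Const 1 1) (Seq (Add 0 0 1) (compile_list cs)))"

lemma program_correct:
  assumes cs: "\<forall>c\<in>set cs. arrays c \<and> sizes c \<inter> assigned c = {}"
    and M: "sizes_bounded (Suc (length x)) M cs (initial_state x)"
  shows "\<exists>t \<rho> m. ram_exec (program cs) (\<lambda>_. 0, input_memory x) t (\<rho>, m) \<and>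
    t \<le> (\<Sum>c\<leftarrow>cs. com_time c M) + 4 \<and>
    represents (Suc (length x)) (fold (sem (Suc (length x))) cs (initial_state x)) (\<rho>, m)"
proof -
  let ?b = "Suc (length x)"
  define \<rho>1 where "\<rho>1 = (\<lambda>_::nat. 0::nat)(0 := length x, 1 := 1)"
  define \<rho>2 where "\<rho>2 = \<rho>1(0 := ?b)"
  have "input_memory x (?b + 8 * i + j) = 0" for i j by (simp add: input_memory_def)
  then have "represents ?b (initial_state x) (\<rho>2, input_memory x)"
    unfolding represents_def initial_state_def \<rho>2_def \<rho>1_def by simp
  then obtain \<rho> m where
    w: "ram_within (compile_list cs) (\<rho>2, input_memory x) ((\<Sum>c\<leftarrow>cs. com_time c M) + 1) (\<rho>, m)"
    and r: "represents ?b (fold (sem ?b) cs (initial_state x)) (\<rho>, m)"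
    using compile_list_correct[OF _ cs M] by blast
  define \<rho>0 where "\<rho>0 = (\<lambda>_::nat. 0::nat)(0 := length x)"
  have "ram_within (Load 0 0) (\<lambda>_. 0, input_memory x) 1 (\<rho>0, input_memory x)"
    using ram_within_simple(4)[of 0 0 "\<lambda>_. 0" "input_memory x"]
    unfolding \<rho>0_def by (simp add: input_memory_def)
  moreover have "ram_within (Const 1 1) (\<rho>0, input_memory x) 1 (\<rho>1, input_memory x)"
    using ram_within_simple(1)[of 1 1 \<rho>0] unfolding \<rho>0_def \<rho>1_def .
  moreover have "ram_within (Add 0 0 1) (\<rho>1, input_memory x) 1 (\<rho>2, input_memory x)"
    using ram_within_simple(2)[of 0 0 1 \<rho>1] unfolding \<rho>2_def by (simp add: \<rho>1_def)
  ultimately have "ram_within (program cs) (\<lambda>_. 0, input_memory x) ((\<Sum>c\<leftarrow>cs. com_time c M) + 4) (\<rho>, m)"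
    unfolding program_def using w
    by - (rule ram_within_Seq, assumption, rule ram_within_Seq, assumption, rule ram_within_Seq,
        assumption, assumption, (rule order_refl | simp)+)
  then show ?thesis using r unfolding ram_within_def by blast
qed

text \<open>An answer no longer than the input fits, together with its length cell, into the raw
  cells, where \<open>represents\<close> fixes the contents of the memory.\<close>

theorem poly_time_solvableI:
  fixes q :: "nat poly"
  assumes cs: "\<forall>c\<in>set cs. arrays c \<and> sizes c \<inter> assigned c = {}"
    and M: "\<And>i. i \<in> I \<Longrightarrow> sizes_bounded (Suc (length (enc i))) (poly q (length (enc i))) cs
      (initial_state (enc i))"
    and out: "\<And>i. i \<in> I \<Longrightarrow> \<exists>y. sol i y \<and> length y \<le> length (enc i) \<and>
      output_in_memory (raw (fold (sem (Suc (length (enc i)))) cs (initial_state (enc i)))) y"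
  shows "poly_time_solvable I enc sol"
proof -
  have "\<exists>p :: nat poly. \<forall>M. (\<Sum>c\<leftarrow>cs. com_time c M) = poly p M" for cs
  proof (induction cs)
    case Nil show ?case by (intro exI[of _ 0]) simp
  next
    case (Cons c cs)
    moreover obtain p where "\<forall>M. com_time c M = poly p M" using com_time_poly by blast
    moreover obtain p' where "\<forall>M. (\<Sum>c\<leftarrow>cs. com_time c M) = poly p' M" using Cons by blast
    ultimately show ?case by (intro exI[of _ "p + p'"]) simp
  qed
  then obtain p where p: "\<And>M. (\<Sum>c\<leftarrow>cs. com_time c M) = poly p M" by meson
  have "\<exists>t y. ram_computes (program cs) (enc i) t y \<and> t \<le> poly (p \<circ>\<^sub>p q + [:4:]) (length (enc i)) \<and> sol i y"
    if i: "i \<in> I" for i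
  proof -
    let ?x = "enc i"
    obtain t \<rho> m where t: "ram_exec (program cs) (\<lambda>_. 0, input_memory ?x) t (\<rho>, m)"
      "t \<le> poly (p \<circ>\<^sub>p q + [:4:]) (length ?x)"
      and r: "represents (Suc (length ?x)) (fold (sem (Suc (length ?x))) cs (initial_state ?x)) (\<rho>, m)"
      using program_correct[OF cs M[OF i]] unfolding p poly_add poly_pcompose by auto
    obtain y where y: "sol i y" "length y \<le> length ?x"
      "output_in_memory (raw (fold (sem (Suc (length ?x))) cs (initial_state ?x))) y"
      using out[OF i] by blast
    have "output_in_memory m y"
      using y(2,3) r unfolding output_in_memory_def represents_def by simp
    then show ?thesis using t y(1) unfolding ram_computes_def by blast
  qed
  then show ?thesis unfolding poly_time_solvable_def by blast
qed

section \<open>Minimum cuts by augmenting paths\<close>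

declare sem.simps(7) [simp del]

lemma sem_For_frame_invariant:
  assumes "I 0 s"
    and "\<And>k t. k < var s x \<Longrightarrow> I k t \<Longrightarrow> \<forall>y. y \<notin> assigned (For i x c) \<longrightarrow> var t y = var s y \<Longrightarrow>
      \<forall>j. j \<notin> updated c \<longrightarrow> arr t j = arr s j \<Longrightarrow> (\<not> puts c \<longrightarrow> raw t = raw s) \<Longrightarrow>
      I (Suc k) (sem b c (set_var i k t))"
  shows "I (var s x) (sem b (For i x c) s)"
proof -
  let ?J = "\<lambda>k t. I k t \<and> (\<forall>y. y \<notin> assigned (For i x c) \<longrightarrow> var t y = var s y) \<and>
      (\<forall>j. j \<notin> updated c \<longrightarrow> arr t j = arr s j) \<and> (\<not> puts c \<longrightarrow> raw t = raw s)"
  have "?J (var s x) (sem b (For i x c) s)"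
    by (rule sem_For_invariant) (use assms sem_frame in auto)
  then show ?thesis by blast
qed

text \<open>Indexing the invariant by the set of pairs already treated lets two nested loops be
  handled as one.\<close>

lemma sem_For_For_invariant:
  assumes ij: "i \<noteq> j" "x \<noteq> i" "y \<noteq> i" "x \<notin> assigned c" "y \<notin> assigned c" "i \<notin> assigned c" "x \<noteq> j" "y \<noteq> j"
    and init: "I {} s"
    and step: "\<And>a b W t. a < var s x \<Longrightarrow> b < var s y \<Longrightarrow> I W t \<Longrightarrow>
      \<forall>z. z \<notin> {i, j} \<union> assigned c \<longrightarrow> var t z = var s z \<Longrightarrow> var t i = a \<Longrightarrow> var t j = b \<Longrightarrow>
      \<forall>k. k \<notin> updated c \<longrightarrow> arr t k = arr s k \<Longrightarrow> (\<not> puts c \<longrightarrow> raw t = raw s) \<Longrightarrow>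
      I (insert (a, b) W) (sem bd c t)"
    and vars: "\<And>W t k a. I W t \<Longrightarrow> k = i \<or> k = j \<Longrightarrow> I W (set_var k a t)"
  shows "I ({..<var s x} \<times> {..<var s y}) (sem bd (For i x (For j y c)) s)"
proof (rule sem_For_frame_invariant[where I = "\<lambda>k. I ({..<k} \<times> {..<var s y})"])
  show "I ({..<0} \<times> {..<var s y}) s" using init by simp
next
  fix a t assume a: "a < var s x" and I: "I ({..<a} \<times> {..<var s y}) t"
    and fr: "\<forall>z. z \<notin> assigned (For i x (For j y c)) \<longrightarrow> var t z = var s z"
      "\<forall>k. k \<notin> updated (For j y c) \<longrightarrow> arr t k = arr s k" "\<not> puts (For j y c) \<longrightarrow> raw t = raw s"
  let ?t = "set_var i a t"
  have y: "var ?t y = var s y" using fr ij by auto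
  have "I ({..<a} \<times> {..<var s y} \<union> {a} \<times> {..<var ?t y}) (sem bd (For j y c) ?t)"
  proof (rule sem_For_frame_invariant[where I = "\<lambda>k. I ({..<a} \<times> {..<var s y} \<union> {a} \<times> {..<k})"])
    show "I ({..<a} \<times> {..<var s y} \<union> {a} \<times> {..<0}) ?t" using I vars by simp
  next
    fix b u assume b: "b < var ?t y" and I: "I ({..<a} \<times> {..<var s y} \<union> {a} \<times> {..<b}) u"
      and fr': "\<forall>z. z \<notin> assigned (For j y c) \<longrightarrow> var u z = var ?t z"
        "\<forall>k. k \<notin> updated c \<longrightarrow> arr u k = arr ?t k" "\<not> puts c \<longrightarrow> raw u = raw ?t"
    have "I (insert (a, b) ({..<a} \<times> {..<var s y} \<union> {a} \<times> {..<b})) (sem bd c (set_var j b u))"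
    proof (rule step[OF a])
      show "b < var s y" using b y by simp
      show "I ({..<a} \<times> {..<var s y} \<union> {a} \<times> {..<b}) (set_var j b u)" using I vars by simp
      show "\<forall>z. z \<notin> {i, j} \<union> assigned c \<longrightarrow> var (set_var j b u) z = var s z" using fr fr' by auto
      show "var (set_var j b u) i = a" using fr' ij by auto
    qed (use fr fr' in auto)
    moreover have "insert (a, b) ({..<a} \<times> {..<var s y} \<union> {a} \<times> {..<b}) = {..<a} \<times> {..<var s y} \<union> {a} \<times> {..<Suc b}"
      by auto
    ultimately show "I ({..<a} \<times> {..<var s y} \<union> {a} \<times> {..<Suc b}) (sem bd c (set_var j b u))" by simp
  qed
  moreover have "{..<a} \<times> {..<var s y} \<union> {a} \<times> {..<var ?t y} = {..<Suc a} \<times> {..<var s y}"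
    using y by auto
  ultimately show "I ({..<Suc a} \<times> {..<var s y}) (sem bd (For j y c) ?t)" by simp
qed

section \<open>Tests as arithmetic expressions, by truncated subtraction\<close>

definition NOT :: "exp \<Rightarrow> exp" where "NOT e = Minus (Num 1) e"
definition AND :: "exp \<Rightarrow> exp \<Rightarrow> exp" where "AND e e' = NOT (Plus (NOT e) (NOT e'))"
definition LE :: "exp \<Rightarrow> exp \<Rightarrow> exp" where "LE e e' = NOT (Minus e e')"
definition EQ :: "exp \<Rightarrow> exp \<Rightarrow> exp" where "EQ e e' = AND (LE e e') (LE e' e)"

lemma aval_tests [simp]:
  "aval (NOT e) s = of_bool (aval e s = 0)"
  "aval (AND e e') s = of_bool (aval e s \<noteq> 0 \<and> aval e' s \<noteq> 0)"
  "aval (LE e e') s = of_bool (aval e s \<le> aval e' s)"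
  "aval (EQ e e') s = of_bool (aval e s = aval e' s)"
  by (auto simp: NOT_def AND_def LE_def EQ_def)

lemma exp_sizes_tests [simp]:
  "exp_sizes (NOT e) = exp_sizes e"
  "exp_sizes (AND e e') = exp_sizes e \<union> exp_sizes e'"
  "exp_sizes (LE e e') = exp_sizes e \<union> exp_sizes e'"
  "exp_sizes (EQ e e') = exp_sizes e \<union> exp_sizes e'"
  by (auto simp: NOT_def AND_def LE_def EQ_def)

lemma exp_arrays_tests [simp]:
  "exp_arrays (NOT e) = exp_arrays e"
  "exp_arrays (AND e e') \<longleftrightarrow> exp_arrays e \<and> exp_arrays e'"
  "exp_arrays (LE e e') \<longleftrightarrow> exp_arrays e \<and> exp_arrays e'"
  "exp_arrays (EQ e e') \<longleftrightarrow> exp_arrays e \<and> exp_arrays e'"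
  by (auto simp: NOT_def AND_def LE_def EQ_def)

text \<open>Variable 9 is a dummy that no command of the program reads.\<close>

abbreviation (input) skip :: com where "skip \<equiv> Assign 9 (Num 0)"

section \<open>Search and augmentation in the residual network\<close>

abbreviation (input) cap_arr :: nat where "cap_arr \<equiv> 0"
abbreviation (input) src_arr :: nat where "src_arr \<equiv> 1"
abbreviation (input) snk_arr :: nat where "snk_arr \<equiv> 2"
abbreviation (input) dist_arr :: nat where "dist_arr \<equiv> 3"
abbreviation (input) par_arr :: nat where "par_arr \<equiv> 4"

abbreviation (input) nodes_var :: nat where "nodes_var \<equiv> 3"
abbreviation (input) iter_var :: nat where "iter_var \<equiv> 4"
abbreviation (input) r_var :: nat where "r_var \<equiv> 10"
abbreviation (input) a_var :: nat where "a_var \<equiv> 11"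
abbreviation (input) b_var :: nat where "b_var \<equiv> 12"
abbreviation (input) it_var :: nat where "it_var \<equiv> 13"
abbreviation (input) found_var :: nat where "found_var \<equiv> 14"
abbreviation (input) cur_var :: nat where "cur_var \<equiv> 15"
abbreviation (input) par_var :: nat where "par_var \<equiv> 16"

text \<open>Breadth-first search: \<open>dist_arr\<close> is \<open>0\<close> at nodes that have not been reached, \<open>1\<close> at sources, and
  \<open>r + 2\<close> at nodes reached in round \<open>r\<close>.\<close>
definition scan_arc :: com where
  "scan_arc = Cond (AND (AND (Arr dist_arr (Var a_var)) (LE (Arr dist_arr (Var a_var)) (Plus (Var r_var) (Num 1))))
        (AND (NOT (Arr dist_arr (Var b_var))) (Arr cap_arr (Plus (Times (Var a_var) nodes_var) (Var b_var)))))
      (Comp (Update dist_arr (Var b_var) (Plus (Var r_var) (Num 2))) (Update par_arr (Var b_var) (Var a_var)))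
      skip"

definition search_round :: com where
  "search_round = For a_var nodes_var (For b_var nodes_var scan_arc)"

definition search :: com where
  "search = Comp
     (For a_var nodes_var (Update dist_arr (Var a_var) (NOT (NOT (Arr src_arr (Var a_var))))))
     (For r_var nodes_var search_round)"

definition find_sink :: com where
  "find_sink = Comp (Assign found_var (Num 0)) (For a_var nodes_var
     (Cond (AND (Arr snk_arr (Var a_var)) (Arr dist_arr (Var a_var)))
        (Comp (Assign found_var (Num 1)) (Assign cur_var (Var a_var))) skip))"

text \<open>One step back from the sink along the tree of parents, moving one unit of capacity to
  the reverse arc. It idles at a source, where the distance is 1, or if no sink was found, and can
  therefore be repeated a fixed number of times.\<close>

definition push_arc :: com where
  "push_arc = Cond (AND (Var found_var) (NOT (LE (Arr dist_arr (Var cur_var)) (Num 1))))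
     (Comp (Assign par_var (Arr par_arr (Var cur_var)))
     (Comp (Update cap_arr (Plus (Times (Var par_var) nodes_var) (Var cur_var))
        (Minus (Arr cap_arr (Plus (Times (Var par_var) nodes_var) (Var cur_var))) (Num 1)))
     (Comp (Update cap_arr (Plus (Times (Var cur_var) nodes_var) (Var par_var))
        (Plus (Arr cap_arr (Plus (Times (Var cur_var) nodes_var) (Var par_var))) (Num 1)))
     (Assign cur_var (Var par_var)))))
     skip"

definition max_flow :: com where
  "max_flow = For it_var iter_var (Comp search (Comp find_sink (For r_var nodes_var push_arc)))"

text \<open>A node entered in this round gets \<open>r + 2\<close> and fails the test against
  \<open>r + 1\<close>. So the order of scanning is immaterial, and \<open>hit\<close> can refer to
  the state before the round.\<close>

lemma search_round_spec:
  fixes s :: state and bd :: nat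
  defines "N \<equiv> var s nodes_var"
  assumes le: "\<forall>a<N. arr s dist_arr a \<le> var s r_var + 1"
  defines "hit \<equiv> (\<lambda>a b. arr s dist_arr a \<noteq> 0 \<and> arr s dist_arr b = 0 \<and> arr s cap_arr (a * N + b) \<noteq> 0)"
  defines "t \<equiv> sem bd search_round s"
  shows "\<forall>b<N. arr t dist_arr b = arr s dist_arr b \<and> arr t par_arr b = arr s par_arr b \<or>
      arr t dist_arr b = var s r_var + 2 \<and> arr t par_arr b < N \<and> hit (arr t par_arr b) b"
    and "\<forall>a<N. \<forall>b<N. hit a b \<longrightarrow> arr t dist_arr b \<noteq> 0"
proof -
  define I where "I = (\<lambda>W (t :: state).
    (\<forall>b<N. arr t dist_arr b = arr s dist_arr b \<and> arr t par_arr b = arr s par_arr b \<or>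
      arr t dist_arr b = var s r_var + 2 \<and> arr t par_arr b < N \<and> hit (arr t par_arr b) b) \<and>
    (\<forall>a b. (a, b) \<in> W \<longrightarrow> b < N \<longrightarrow> hit a b \<longrightarrow> arr t dist_arr b \<noteq> 0))"
  have "I ({..<var s nodes_var} \<times> {..<var s nodes_var}) t"
    unfolding t_def search_round_def
  proof (rule sem_For_For_invariant)
    fix a b W u
    assume ab: "a < var s nodes_var" "b < var s nodes_var" and I: "I W u"
      and v: "\<forall>z. z \<notin> {a_var, b_var} \<union> assigned scan_arc \<longrightarrow> var u z = var s z" "var u a_var = a" "var u b_var = b"
      and ar: "\<forall>k. k \<notin> updated scan_arc \<longrightarrow> arr u k = arr s k"
    have ab: "a < N" "b < N" using ab unfolding N_def by auto
    have vars: "var u r_var = var s r_var" "var u nodes_var = N"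
      using v unfolding scan_arc_def N_def by simp_all
    have cap: "arr u cap_arr = arr s cap_arr" using ar unfolding scan_arc_def by simp
    have Da: "(arr u dist_arr a \<noteq> 0 \<and> arr u dist_arr a \<le> var s r_var + 1) \<longleftrightarrow> arr s dist_arr a \<noteq> 0"
      using I ab le unfolding I_def hit_def by force
    have Db: "arr u dist_arr b = 0 \<longrightarrow> arr s dist_arr b = 0" using I ab unfolding I_def by auto
    define test where "test = (arr u dist_arr b = 0 \<and> hit a b)"
    have sem: "sem bd scan_arc u = (if test
        then u\<lparr>arr := (arr u)(dist_arr := (arr u dist_arr)(b := var s r_var + 2),
          par_arr := (arr u par_arr)(b := a))\<rparr> else set_var 9 0 u)"
    proof -
      have "(arr u dist_arr a \<noteq> 0 \<and> arr u dist_arr a \<le> var s r_var + 1) \<and>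
          arr u dist_arr b = 0 \<and> arr u cap_arr (a * N + b) \<noteq> 0 \<longleftrightarrow> test"
        unfolding Da cap test_def hit_def using Db by blast
      then show ?thesis unfolding scan_arc_def using v vars by simp
    qed
    show "I (insert (a, b) W) (sem bd scan_arc u)"
    proof (cases test)
      case True
      then show ?thesis using I ab unfolding sem I_def test_def by auto
    next
      case False
      then show ?thesis using I ab unfolding sem I_def test_def by auto
    qed
  qed (auto simp: I_def scan_arc_def)
  then show "\<forall>b<N. arr t dist_arr b = arr s dist_arr b \<and> arr t par_arr b = arr s par_arr b \<or>
      arr t dist_arr b = var s r_var + 2 \<and> arr t par_arr b < N \<and> hit (arr t par_arr b) b"
    and "\<forall>a<N. \<forall>b<N. hit a b \<longrightarrow> arr t dist_arr b \<noteq> 0"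
    unfolding I_def N_def by auto
qed

text \<open>As \<open>D\<close> decreases along parents, following them ends at a source after at
  most \<open>r\<close> steps.\<close>

definition reach_tree :: "nat \<Rightarrow> (nat \<Rightarrow> nat) \<Rightarrow> (nat \<Rightarrow> nat) \<Rightarrow> (nat \<Rightarrow> nat) \<Rightarrow> (nat \<Rightarrow> nat) \<Rightarrow> nat \<Rightarrow> bool" where
  "reach_tree N src c D P r \<longleftrightarrow> (\<forall>b<N. (D b = 1 \<longleftrightarrow> src b \<noteq> 0) \<and> D b \<le> r + 1 \<and>
     (1 < D b \<longrightarrow> P b < N \<and> D (P b) \<noteq> 0 \<and> D (P b) < D b \<and> c (P b * N + b) \<noteq> 0))"

definition reach_closed :: "nat \<Rightarrow> (nat \<Rightarrow> nat) \<Rightarrow> (nat \<Rightarrow> nat) \<Rightarrow> bool" where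
  "reach_closed N c D \<longleftrightarrow> (\<forall>a<N. \<forall>b<N. D a \<noteq> 0 \<and> c (a * N + b) \<noteq> 0 \<longrightarrow> D b \<noteq> 0)"

text \<open>As long as the reached set is not closed, every round adds a node. After
  \<open>N\<close> rounds it is closed or contains all nodes, and then it is closed as well.\<close>

lemma search_spec:
  fixes s :: state and bd :: nat
  defines "N \<equiv> var s nodes_var"
  defines "t \<equiv> sem bd search s"
  shows "reach_tree N (arr s src_arr) (arr s cap_arr) (arr t dist_arr) (arr t par_arr) N"
    and "reach_closed N (arr s cap_arr) (arr t dist_arr)"
proof -
  define s0 where "s0 = sem bd (For a_var nodes_var
    (Update dist_arr (Var a_var) (NOT (NOT (Arr src_arr (Var a_var)))))) s"
  let ?src = "arr s src_arr" and ?c = "arr s cap_arr"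
  have fr0: "var s0 nodes_var = N" "arr s0 src_arr = ?src" "arr s0 cap_arr = ?c"
    unfolding s0_def N_def by (simp_all add: sem_frame)
  have "\<forall>a<N. arr s0 dist_arr a = of_bool (?src a \<noteq> 0)"
    unfolding s0_def N_def
    by (rule sem_For_frame_invariant[where I = "\<lambda>k t. \<forall>a<k. arr t dist_arr a = of_bool (?src a \<noteq> 0)"])
      (auto simp: less_Suc_eq)
  then have init: "reach_tree N ?src ?c (arr s0 dist_arr) (arr s0 par_arr) 0"
    unfolding reach_tree_def by auto
  define K where "K = (\<lambda>r (t :: state). reach_tree N ?src ?c (arr t dist_arr) (arr t par_arr) r \<and>
    (reach_closed N ?c (arr t dist_arr) \<or> r \<le> card {b. b < N \<and> arr t dist_arr b \<noteq> 0}))"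
  have "K (var s0 nodes_var) (sem bd (For r_var nodes_var search_round) s0)"
  proof (rule sem_For_frame_invariant)
    show "K 0 s0" unfolding K_def using init by simp
  next
    fix r u assume r: "r < var s0 nodes_var" and Ku: "K r u"
      and v: "\<forall>y. y \<notin> assigned (For r_var nodes_var search_round) \<longrightarrow> var u y = var s0 y"
      and a: "\<forall>j. j \<notin> updated search_round \<longrightarrow> arr u j = arr s0 j"
    let ?u = "set_var r_var r u"
    define w where "w = sem bd search_round ?u"
    define D where "D = arr u dist_arr"
    define D' where "D' = arr w dist_arr"
    define P where "P = arr u par_arr"
    define P' where "P' = arr w par_arr"
    define hit where "hit = (\<lambda>a b. D a \<noteq> 0 \<and> D b = 0 \<and> ?c (a * N + b) \<noteq> 0)"
    have vars: "var ?u nodes_var = N" "var ?u r_var = r"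
      using v fr0 unfolding search_round_def scan_arc_def by simp_all
    have arrs: "arr ?u cap_arr = ?c" "arr ?u dist_arr = D" "arr ?u par_arr = P"
      using a fr0 unfolding search_round_def scan_arc_def D_def P_def by simp_all
    have T: "reach_tree N ?src ?c D P r" using Ku unfolding K_def D_def P_def by blast
    then have le: "\<forall>a<N. D a \<le> r + 1" unfolding reach_tree_def by blast
    have "\<forall>a<var ?u nodes_var. arr ?u dist_arr a \<le> var ?u r_var + 1"
      unfolding vars arrs by (fact le)
    note spec = search_round_spec[OF this, of bd]
    have R: "\<forall>b<N. D' b = D b \<and> P' b = P b \<or> D' b = r + 2 \<and> P' b < N \<and> hit (P' b) b"
      using spec(1) unfolding vars arrs w_def[symmetric] D'_def[symmetric] P'_def[symmetric] hit_def .
    have H: "\<forall>a<N. \<forall>b<N. hit a b \<longrightarrow> D' b \<noteq> 0"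
      using spec(2) unfolding vars arrs w_def[symmetric] D'_def[symmetric] hit_def .
    have pos: "D b \<noteq> 0 \<Longrightarrow> D' b = D b \<and> P' b = P b" if "b < N" for b
      using R[rule_format, OF that] unfolding hit_def by auto
    have "reach_tree N ?src ?c D' P' (Suc r)"
      unfolding reach_tree_def
    proof (intro allI impI)
      fix b assume b: "b < N"
      consider "D' b = D b" "P' b = P b" | "D' b = r + 2" "P' b < N" "hit (P' b) b" using R b by blast
      then show "(D' b = 1 \<longleftrightarrow> ?src b \<noteq> 0) \<and> D' b \<le> Suc r + 1 \<and>
        (1 < D' b \<longrightarrow> P' b < N \<and> D' (P' b) \<noteq> 0 \<and> D' (P' b) < D' b \<and> ?c (P' b * N + b) \<noteq> 0)"
      proof cases
        case 1
        then show ?thesis using T b pos[of "P b"] unfolding reach_tree_def by auto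
      next
        case 2
        then have "D' (P' b) = D (P' b)" "D (P' b) \<le> r + 1" "D b = 0"
          using pos[of "P' b"] T unfolding hit_def reach_tree_def by auto
        then show ?thesis using 2 T b unfolding hit_def reach_tree_def by auto
      qed
    qed
    moreover have "reach_closed N ?c D' \<or> Suc r \<le> card {b. b < N \<and> D' b \<noteq> 0}"
    proof (cases "reach_closed N ?c D")
      case True
      then have "\<not> hit a b" if "a < N" "b < N" for a b
        using that unfolding reach_closed_def hit_def by blast
      then have eq: "\<forall>b<N. D' b = D b" using R by blast
      have "reach_closed N ?c D'"
        unfolding reach_closed_def
      proof (intro allI impI)
        fix a b assume ab: "a < N" "b < N" "D' a \<noteq> 0 \<and> ?c (a * N + b) \<noteq> 0"
        then have "D b \<noteq> 0" using True eq[rule_format, OF ab(1)] unfolding reach_closed_def by metis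
        then show "D' b \<noteq> 0" using eq[rule_format, OF ab(2)] by simp
      qed
      then show ?thesis ..
    next
      case False
      then obtain a b where ab: "a < N" "b < N" and h: "D a \<noteq> 0" "?c (a * N + b) \<noteq> 0" "D b = 0"
        unfolding reach_closed_def by (metis (no_types))
      have ab: "a < N" "b < N" "hit a b" using ab h unfolding hit_def by simp_all
      have "{b. b < N \<and> D b \<noteq> 0} \<subset> {b. b < N \<and> D' b \<noteq> 0}"
      proof
        show "{b. b < N \<and> D b \<noteq> 0} \<subseteq> {b. b < N \<and> D' b \<noteq> 0}"
        proof safe
          fix b assume "b < N" "0 < D b"
          then show "0 < D' b" using pos[of b] by simp
        qed
        have "D' b \<noteq> 0" "D b = 0" using H[rule_format, OF ab] ab(3) unfolding hit_def by simp_all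
        then show "{b. b < N \<and> D b \<noteq> 0} \<noteq> {b. b < N \<and> D' b \<noteq> 0}" using ab(2) by blast
      qed
      then have "card {b. b < N \<and> D b \<noteq> 0} < card {b. b < N \<and> D' b \<noteq> 0}"
        by (intro psubset_card_mono) auto
      then show ?thesis using Ku False unfolding K_def D_def by auto
    qed
    ultimately show "K (Suc r) (sem bd search_round ?u)"
      unfolding K_def w_def[symmetric] D'_def P'_def by blast
  qed
  moreover have "t = sem bd (For r_var nodes_var search_round) s0"
    unfolding t_def search_def s0_def by simp
  ultimately have "K N t" unfolding fr0 by simp
  then show "reach_tree N (arr s src_arr) (arr s cap_arr) (arr t dist_arr) (arr t par_arr) N"
    unfolding K_def by blast
  have "reach_closed N ?c (arr t dist_arr)" if "N \<le> card {b. b < N \<and> arr t dist_arr b \<noteq> 0}"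
  proof -
    have "{b. b < N \<and> arr t dist_arr b \<noteq> 0} = {..<N}"
      using that by (intro card_seteq) auto
    then show ?thesis unfolding reach_closed_def by auto
  qed
  then show "reach_closed N (arr s cap_arr) (arr t dist_arr)" using \<open>K N t\<close> unfolding K_def by blast
qed

lemma find_sink_spec:
  fixes s :: state and bd :: nat
  defines "N \<equiv> var s nodes_var"
  defines "t \<equiv> sem bd find_sink s"
  shows "if var t found_var = 0 then \<forall>a<N. arr s snk_arr a \<noteq> 0 \<longrightarrow> arr s dist_arr a = 0
    else var t cur_var < N \<and> arr s snk_arr (var t cur_var) \<noteq> 0 \<and> arr s dist_arr (var t cur_var) \<noteq> 0"
proof -
  define I where "I = (\<lambda>k (t :: state). if var t found_var = 0 then \<forall>a<k. arr s snk_arr a \<noteq> 0 \<longrightarrow> arr s dist_arr a = 0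
    else var t cur_var < N \<and> arr s snk_arr (var t cur_var) \<noteq> 0 \<and> arr s dist_arr (var t cur_var) \<noteq> 0)"
  let ?c = "Cond (AND (Arr snk_arr (Var a_var)) (Arr dist_arr (Var a_var)))
        (Comp (Assign found_var (Num 1)) (Assign cur_var (Var a_var))) skip"
  let ?s = "set_var found_var 0 s"
  have "I (var ?s nodes_var) (sem bd (For a_var nodes_var ?c) ?s)"
    by (rule sem_For_frame_invariant) (auto simp: I_def N_def less_Suc_eq)
  moreover have "t = sem bd (For a_var nodes_var ?c) ?s" unfolding t_def find_sink_def by simp
  ultimately have "I N t" unfolding N_def by simp
  then show ?thesis unfolding I_def .
qed

section \<open>Residual capacities of cuts\<close>

definition cut :: "nat \<Rightarrow> (nat \<Rightarrow> nat) \<Rightarrow> nat set \<Rightarrow> int" where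
  "cut N c S = (\<Sum>x<N. \<Sum>y<N. of_bool (x \<in> S \<and> y \<notin> S) * int (c (x * N + y)))"

lemma row_major_inject:
  fixes y y' N :: nat
  assumes "y < N" "y' < N"
  shows "x * N + y = x' * N + y' \<longleftrightarrow> x = x' \<and> y = y'"
proof
  assume eq: "x * N + y = x' * N + y'"
  have "(x * N + y) div N = x" "(x' * N + y') div N = x'" using assms by auto
  then show "x = x' \<and> y = y'" using eq by simp
qed simp

text \<open>Because the reverse arc gains what the arc loses, the change is additive in the two
  memberships, and it telescopes along a path.\<close>

lemma cut_push:
  assumes "p < N" "q < N" "p \<noteq> q" "c (p * N + q) \<noteq> 0"
  shows "cut N (c(p * N + q := c (p * N + q) - 1, q * N + p := c (q * N + p) + 1)) S =
    cut N c S - of_bool (p \<in> S) + of_bool (q \<in> S)"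
proof -
  define c' where "c' = c(p * N + q := c (p * N + q) - 1, q * N + p := c (q * N + p) + 1)"
  have c': "int (c' (x * N + y)) = int (c (x * N + y)) - of_bool (x = p \<and> y = q) + of_bool (x = q \<and> y = p)"
    if "x < N" "y < N" for x y
    using assms that row_major_inject unfolding c'_def by (auto simp: of_nat_diff)
  let ?b = "\<lambda>x y. of_bool (x \<in> S \<and> y \<notin> S) :: int"
  have delta: "(\<Sum>x<N. \<Sum>y<N. if x = u \<and> y = v then k else 0) = k" if "u < N" "v < N" for u v and k :: int
  proof -
    have "(\<Sum>x<N. \<Sum>y<N. if x = u \<and> y = v then k else 0) = (\<Sum>x<N. if x = u then (\<Sum>y<N. if y = v then k else 0) else 0)"
      by (intro sum.cong refl) auto
    then show ?thesis using that by simp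
  qed
  have "cut N c' S = (\<Sum>x<N. \<Sum>y<N. ?b x y * int (c (x * N + y))
      - (if x = p \<and> y = q then ?b p q else 0) + (if x = q \<and> y = p then ?b q p else 0))"
    unfolding cut_def
  proof (intro sum.cong refl)
    fix x y assume "x \<in> {..<N}" "y \<in> {..<N}"
    then have "int (c' (x * N + y)) = int (c (x * N + y)) - of_bool (x = p \<and> y = q) + of_bool (x = q \<and> y = p)"
      using c' by simp
    moreover have "(if x = p \<and> y = q then ?b p q else 0) = ?b x y * of_bool (x = p \<and> y = q)"
      "(if x = q \<and> y = p then ?b q p else 0) = ?b x y * of_bool (x = q \<and> y = p)" by auto
    ultimately show "?b x y * int (c' (x * N + y)) = ?b x y * int (c (x * N + y))
      - (if x = p \<and> y = q then ?b p q else 0) + (if x = q \<and> y = p then ?b q p else 0)"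
      by (simp only: distrib_left right_diff_distrib)
  qed
  also have "\<dots> = cut N c S - ?b p q + ?b q p"
    unfolding cut_def sum.distrib sum_subtractf delta[OF assms(1,2)] delta[OF assms(2,1)] ..
  also have "\<dots> = cut N c S - of_bool (p \<in> S) + of_bool (q \<in> S)" by auto
  finally show ?thesis unfolding c'_def .
qed

text \<open>After telescoping only the two ends of the path remain. \<open>N\<close> repetitions
  suffice since each one lowers \<open>D\<close>, which is at most \<open>N + 1\<close>, until it is
  1.\<close>

lemma push_path_spec:
  fixes s :: state and bd :: nat
  defines "N \<equiv> var s nodes_var"
  defines "t \<equiv> sem bd (For r_var nodes_var push_arc) s"
  assumes tree: "reach_tree N src (arr s cap_arr) (arr s dist_arr) (arr s par_arr) N"
    and found: "var s found_var \<noteq> 0"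
    and cur: "var s cur_var < N" "arr s dist_arr (var s cur_var) \<noteq> 0"
  shows "\<exists>p<N. src p \<noteq> 0 \<and> (\<forall>S. cut N (arr t cap_arr) S =
    cut N (arr s cap_arr) S - of_bool (p \<in> S) + of_bool (var s cur_var \<in> S))"
proof -
  let ?c = "arr s cap_arr"
  define D where "D = arr s dist_arr"
  define P where "P = arr s par_arr"
  have tree: "\<And>b. b < N \<Longrightarrow> D b = 1 \<longleftrightarrow> src b \<noteq> 0" "\<And>b. b < N \<Longrightarrow> D b \<le> N + 1"
    "\<And>b. b < N \<Longrightarrow> 1 < D b \<Longrightarrow> P b < N \<and> D (P b) \<noteq> 0 \<and> D (P b) < D b \<and> ?c (P b * N + b) \<noteq> 0"
    using tree unfolding reach_tree_def D_def P_def by blast+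
  define I where "I = (\<lambda>r (t :: state). var t cur_var < N \<and> D (var t cur_var) \<noteq> 0 \<and>
    D (var t cur_var) \<le> max 1 (N + 1 - r) \<and>
    (\<forall>b<N. 1 < D b \<longrightarrow> D b \<le> D (var t cur_var) \<longrightarrow> arr t cap_arr (P b * N + b) \<noteq> 0) \<and>
    (\<forall>S. cut N (arr t cap_arr) S =
      cut N ?c S - of_bool (var t cur_var \<in> S) + of_bool (var s cur_var \<in> S)))"
  have "I (var s nodes_var) t"
    unfolding t_def
  proof (rule sem_For_frame_invariant)
    show "I 0 s" using cur tree unfolding I_def D_def[symmetric] by fastforce
  next
    fix r u assume r: "r < var s nodes_var" and I: "I r u"
      and v: "\<forall>y. y \<notin> assigned (For r_var nodes_var push_arc) \<longrightarrow> var u y = var s y"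
      and a: "\<forall>j. j \<notin> updated push_arc \<longrightarrow> arr u j = arr s j"
    have vars: "var u found_var = var s found_var" "var u nodes_var = N"
      using v unfolding push_arc_def N_def by simp_all
    have arrs: "arr u dist_arr = D" "arr u par_arr = P"
      using a unfolding push_arc_def D_def P_def by simp_all
    define q where "q = var u cur_var"
    define c where "c = arr u cap_arr"
    have Iq: "q < N" "D q \<noteq> 0" "D q \<le> max 1 (N + 1 - r)"
      "\<And>b. b < N \<Longrightarrow> 1 < D b \<Longrightarrow> D b \<le> D q \<Longrightarrow> c (P b * N + b) \<noteq> 0"
      "\<And>S. cut N c S = cut N ?c S - of_bool (q \<in> S) + of_bool (var s cur_var \<in> S)"
      using I unfolding I_def q_def[symmetric] c_def[symmetric] by blast+
    show "I (Suc r) (sem bd push_arc (set_var r_var r u))"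
    proof (cases "1 < D q")
      case False
      have "sem bd push_arc (set_var r_var r u) = set_var 9 0 (set_var r_var r u)"
        using False vars arrs unfolding push_arc_def q_def by simp
      then show ?thesis
        using Iq False unfolding I_def q_def c_def by simp
    next
      case True
      define p where "p = P q"
      have p: "p < N" "D p \<noteq> 0" "D p < D q" using tree(3)[OF Iq(1) True] unfolding p_def by auto
      then have "p \<noteq> q" by auto
      define c' where "c' = c(p * N + q := c (p * N + q) - 1, q * N + p := c (q * N + p) + 1)"
      have "q * N + p \<noteq> p * N + q" using row_major_inject[of p N q q p] p Iq \<open>p \<noteq> q\<close> by auto
      then have sem: "var (sem bd push_arc (set_var r_var r u)) cur_var = p"
        "arr (sem bd push_arc (set_var r_var r u)) cap_arr = c'"
        using True vars arrs found unfolding push_arc_def q_def p_def c'_def c_def by simp_all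
      have cq: "c (p * N + q) \<noteq> 0" using Iq(4)[OF Iq(1) True] unfolding p_def by simp
      \<comment> \<open>The lowered arc enters \<open>q\<close>, which is farther from the sources
        than every such \<open>b\<close>; the other changed arc has gained capacity.\<close>
      have "c' (P b * N + b) \<noteq> 0" if b: "b < N" "1 < D b" "D b \<le> D p" for b
      proof -
        have "b \<noteq> q" using b p by auto
        then have "P b * N + b \<noteq> p * N + q"
          using row_major_inject[of b N q "P b" p] b Iq(1) by auto
        moreover have "c (P b * N + b) \<noteq> 0" using Iq(4) b p by simp
        ultimately show ?thesis unfolding c'_def by simp
      qed
      moreover have "cut N c' S = cut N ?c S - of_bool (p \<in> S) + of_bool (var s cur_var \<in> S)" for S
        unfolding c'_def using cut_push[of p N q c S, OF p(1) Iq(1) \<open>p \<noteq> q\<close> cq] Iq(5)[of S] by simp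
      moreover have "D p \<le> max 1 (N + 1 - Suc r)" using p Iq(3) True by auto
      ultimately show ?thesis unfolding I_def sem using p by blast
    qed
  qed
  then have "var t cur_var < N" "D (var t cur_var) = 1" 
    "\<And>S. cut N (arr t cap_arr) S =
      cut N ?c S - of_bool (var t cur_var \<in> S) + of_bool (var s cur_var \<in> S)"
    unfolding I_def N_def by auto
  then show ?thesis using tree(1) by blast
qed

lemma push_path_not_found:
  assumes "var s found_var = 0"
  shows "arr (sem bd (For r_var nodes_var push_arc) s) cap_arr = arr s cap_arr"
proof (rule sem_For_frame_invariant[where I = "\<lambda>_ t. arr t cap_arr = arr s cap_arr"])
  fix r and u :: state assume "arr u cap_arr = arr s cap_arr"
    and "\<forall>y. y \<notin> assigned (For r_var nodes_var push_arc) \<longrightarrow> var u y = var s y"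
  then show "arr (sem bd push_arc (set_var r_var r u)) cap_arr = arr s cap_arr"
    using assms by (simp add: push_arc_def)
qed simp

definition valid_cut :: "nat \<Rightarrow> (nat \<Rightarrow> nat) \<Rightarrow> (nat \<Rightarrow> nat) \<Rightarrow> nat set \<Rightarrow> bool" where
  "valid_cut N src snk S \<longleftrightarrow> (\<forall>a<N. (src a \<noteq> 0 \<longrightarrow> a \<in> S) \<and> (snk a \<noteq> 0 \<longrightarrow> a \<notin> S))"

lemma cut_nonneg: "0 \<le> cut N c S"
  unfolding cut_def by (intro sum_nonneg) simp

text \<open>Every augmentation lowers the residual capacity of every cut between sources and sinks by
  one. Hence the set reached when no augmentation is possible any more, whose residual capacity is
  \<open>0\<close>, was minimal from the beginning.\<close>
lemma max_flow_spec:
  fixes s :: state and bd :: nat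
  defines "N \<equiv> var s nodes_var"
  defines "t \<equiv> sem bd max_flow s"
  assumes S0: "valid_cut N (arr s src_arr) (arr s snk_arr) S0" "cut N (arr s cap_arr) S0 < var s iter_var"
  shows "valid_cut N (arr s src_arr) (arr s snk_arr) {a. arr t dist_arr a \<noteq> 0}"
    and "valid_cut N (arr s src_arr) (arr s snk_arr) S \<Longrightarrow>
      cut N (arr s cap_arr) {a. arr t dist_arr a \<noteq> 0} \<le> cut N (arr s cap_arr) S"
proof -
  let ?c = "arr s cap_arr"
  let ?valid = "valid_cut N (arr s src_arr) (arr s snk_arr)"
  let ?body = "Comp search (Comp find_sink (For r_var nodes_var push_arc))"
  define I where "I = (\<lambda>it (t :: state). \<exists>k :: nat.
    (\<forall>S. ?valid S \<longrightarrow> cut N ?c S = cut N (arr t cap_arr) S + int k) \<and>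
    (k = it \<or> ?valid {a. arr t dist_arr a \<noteq> 0} \<and> cut N (arr t cap_arr) {a. arr t dist_arr a \<noteq> 0} = 0))"
  have "I (var s iter_var) t"
    unfolding t_def max_flow_def
  proof (rule sem_For_frame_invariant)
    show "I 0 s" unfolding I_def by (intro exI[of _ 0]) simp
  next
    fix it u assume it: "it < var s iter_var" and Iu: "I it u"
      and v: "\<forall>y. y \<notin> assigned (For it_var iter_var ?body) \<longrightarrow> var u y = var s y"
      and a: "\<forall>j. j \<notin> updated ?body \<longrightarrow> arr u j = arr s j"
    note defs = search_def search_round_def scan_arc_def find_sink_def push_arc_def
    let ?u = "set_var it_var it u"
    define c where "c = arr u cap_arr"
    have u: "var ?u nodes_var = N" "arr ?u src_arr = arr s src_arr" "arr ?u snk_arr = arr s snk_arr"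
      "arr ?u cap_arr = c"
      using v a unfolding N_def defs c_def by simp_all
    define u1 where "u1 = sem bd search ?u"
    define D where "D = arr u1 dist_arr"
    have tree: "reach_tree N (arr s src_arr) c D (arr u1 par_arr) N"
      using search_spec(1)[of ?u bd] unfolding u u1_def[symmetric] D_def[symmetric] .
    have closed: "reach_closed N c D"
      using search_spec(2)[of ?u bd] unfolding u u1_def[symmetric] D_def[symmetric] .
    have u1: "var u1 nodes_var = N" "arr u1 src_arr = arr s src_arr" "arr u1 snk_arr = arr s snk_arr"
      "arr u1 cap_arr = c"
      using u unfolding u1_def by (simp_all add: sem_frame defs)
    define u2 where "u2 = sem bd find_sink u1"
    have u2: "var u2 nodes_var = N" "arr u2 src_arr = arr s src_arr" "arr u2 snk_arr = arr s snk_arr"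
      "arr u2 cap_arr = c" "arr u2 dist_arr = D" "arr u2 par_arr = arr u1 par_arr"
      using u1 unfolding u2_def D_def by (simp_all add: sem_frame defs)
    have sink: "if var u2 found_var = 0 then \<forall>a<N. arr s snk_arr a \<noteq> 0 \<longrightarrow> D a = 0
      else var u2 cur_var < N \<and> arr s snk_arr (var u2 cur_var) \<noteq> 0 \<and> D (var u2 cur_var) \<noteq> 0"
      using find_sink_spec[of bd u1] unfolding u1 u2_def[symmetric] D_def[symmetric] .
    define u3 where "u3 = sem bd (For r_var nodes_var push_arc) u2"
    have "arr u3 dist_arr = D" using u2 unfolding u3_def by (simp add: sem_frame defs)
    obtain k where k: "\<And>S. ?valid S \<Longrightarrow> cut N ?c S = cut N c S + int k"
      "k = it \<or> ?valid {a. arr u dist_arr a \<noteq> 0} \<and> cut N c {a. arr u dist_arr a \<noteq> 0} = 0"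
      using Iu unfolding I_def c_def[symmetric] by blast
    have "I (Suc it) u3"
    proof (cases "var u2 found_var = 0")
      case True
      then have "arr u3 cap_arr = c" using push_path_not_found u2 unfolding u3_def by blast
      have "?valid {a. D a \<noteq> 0}"
        using tree sink True unfolding valid_cut_def reach_tree_def by auto
      moreover have "cut N c {a. D a \<noteq> 0} = 0"
        unfolding cut_def
      proof (intro sum.neutral ballI)
        fix x y assume "x \<in> {..<N}" "y \<in> {..<N}"
        then have "D x \<noteq> 0 \<and> c (x * N + y) \<noteq> 0 \<longrightarrow> D y \<noteq> 0"
          using closed unfolding reach_closed_def by blast
        then show "of_bool (x \<in> {a. D a \<noteq> 0} \<and> y \<notin> {a. D a \<noteq> 0}) * int (c (x * N + y)) = 0"
          by auto
      qed
      ultimately show ?thesis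
        unfolding I_def \<open>arr u3 cap_arr = c\<close> \<open>arr u3 dist_arr = D\<close> using k(1) by blast
    next
      case False
      then obtain p where p: "p < N" "arr s src_arr p \<noteq> 0" "\<And>S. cut N (arr u3 cap_arr) S =
          cut N c S - of_bool (p \<in> S) + of_bool (var u2 cur_var \<in> S)"
        using push_path_spec[of u2 "arr s src_arr" bd] tree sink unfolding u2 u3_def[symmetric] by auto
      have dec: "cut N (arr u3 cap_arr) S = cut N c S - 1" if "?valid S" for S
        using that p sink False unfolding valid_cut_def by auto
      \<comment> \<open>A valid cut of capacity 0 would become negative, so every earlier round has
        augmented as well.\<close>
      have "\<not> (?valid {a. arr u dist_arr a \<noteq> 0} \<and> cut N c {a. arr u dist_arr a \<noteq> 0} = 0)"
        using dec cut_nonneg[of N "arr u3 cap_arr"] by (metis diff_0 neg_0_le_iff_le not_one_le_zero)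
      then show ?thesis
        unfolding I_def using k dec by (intro exI[of _ "Suc it"]) auto
    qed
    then show "I (Suc it) (sem bd ?body ?u)" unfolding u3_def u2_def u1_def by simp
  qed
  then obtain k where k: "\<And>S. ?valid S \<Longrightarrow> cut N ?c S = cut N (arr t cap_arr) S + int k"
    "k = var s iter_var \<or>
      ?valid {a. arr t dist_arr a \<noteq> 0} \<and> cut N (arr t cap_arr) {a. arr t dist_arr a \<noteq> 0} = 0"
    unfolding I_def by blast
  \<comment> \<open>Each augmentation costs \<open>S0\<close> one unit, and it has fewer units than
    there are rounds. So some round did not augment.\<close>
  have "k \<noteq> var s iter_var" using k(1)[OF S0(1)] S0(2) cut_nonneg[of N "arr t cap_arr" S0] by auto
  then have *: "?valid {a. arr t dist_arr a \<noteq> 0}" "cut N (arr t cap_arr) {a. arr t dist_arr a \<noteq> 0} = 0"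
    using k(2) by blast+
  then show "?valid {a. arr t dist_arr a \<noteq> 0}" by blast
  show "cut N ?c {a. arr t dist_arr a \<noteq> 0} \<le> cut N ?c S" if "?valid S"
    using k(1)[OF that] k(1)[OF *(1)] *(2) cut_nonneg[of N "arr t cap_arr" S] by simp
qed

section \<open>Edge deletion as a minimum cut\<close>

lemma cut_eq_card:
  assumes c: "\<And>x y. x < N \<Longrightarrow> y < N \<Longrightarrow> c (x * N + y) = (if (x, y) \<in> R then B else of_bool ((x, y) \<in> U))"
    and U: "U \<subseteq> {..<N} \<times> {..<N}"
    and R: "\<And>x y. (x, y) \<in> R \<Longrightarrow> x \<in> S \<Longrightarrow> y \<in> S"
  shows "cut N c S = int (card {(x, y) \<in> U. x \<in> S \<and> y \<notin> S})"
proof -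
  let ?W = "{(x, y) \<in> U. x \<in> S \<and> y \<notin> S}"
  have "cut N c S = (\<Sum>x<N. \<Sum>y<N. of_bool ((x, y) \<in> ?W))"
    unfolding cut_def
  proof (intro sum.cong refl)
    fix x y assume "x \<in> {..<N}" "y \<in> {..<N}"
    then have "c (x * N + y) = (if (x, y) \<in> R then B else of_bool ((x, y) \<in> U))" using c by simp
    then show "of_bool (x \<in> S \<and> y \<notin> S) * int (c (x * N + y)) = of_bool ((x, y) \<in> ?W)"
      using R[of x y] by auto
  qed
  also have "\<dots> = (\<Sum>z\<in>{..<N} \<times> {..<N}. of_bool (z \<in> ?W))"
    unfolding sum.cartesian_product by (intro sum.cong) auto
  also have "\<dots> = int (card (({..<N} \<times> {..<N}) \<inter> ?W))"
    by (simp add: of_bool_def sum.If_cases Int_def)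
  also have "({..<N} \<times> {..<N}) \<inter> ?W = ?W" using U by auto
  finally show ?thesis .
qed

lemma cut_less_imp_no_crossing:
  assumes "x < N" "y < N" "cut N c S < int (c (x * N + y))" "x \<in> S"
  shows "y \<in> S"
proof (rule ccontr)
  assume "y \<notin> S"
  have "int (c (x * N + y)) = of_bool (x \<in> S \<and> y \<notin> S) * int (c (x * N + y))"
    using assms(4) \<open>y \<notin> S\<close> by simp
  also have "\<dots> \<le> (\<Sum>y<N. of_bool (x \<in> S \<and> y \<notin> S) * int (c (x * N + y)))"
    by (rule member_le_sum) (use assms in auto)
  also have "\<dots> \<le> cut N c S"
    unfolding cut_def
    by (rule member_le_sum[of x _ "\<lambda>x. \<Sum>y<N. of_bool (x \<in> S \<and> y \<notin> S) * int (c (x * N + y))"])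
      (use assms in \<open>auto intro!: sum_nonneg\<close>)
  finally show False using assms(3) by simp
qed

locale lhomed_instance =
  fixes H :: "'a ugraph" and ch :: "'a set \<Rightarrow> 'a list" and pa pb qa qb :: "'a set \<Rightarrow> 'a set \<Rightarrow> nat"
    and G :: "nat ugraph" and L :: "nat \<Rightarrow> 'a set" and n :: nat
  assumes graph_H: "is_graph H" and chains: "two_monotone_chains H ch pa pb qa qb"
    and graph_G: "is_graph G" and verts_G: "verts G = {..<n}"
    and lists: "\<And>v. v < n \<Longrightarrow> L v \<subseteq> verts H"
begin

definition m :: nat where "m = card (verts H)"

abbreviation len :: "nat \<Rightarrow> nat" where "len v \<equiv> length (ch (L v))"

text \<open>Every pair has a block of \<open>m + 3\<close> numbers. Numbers up to \<open>m\<close>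
  are the positions in the chain of \<open>v\<close>, used for \<open>u = v\<close>. The last two
  are the ends of the unit arc of an edge, also of a loop at \<open>v\<close>, which therefore does
  not collide with the chain.\<close>

definition node :: "nat \<Rightarrow> nat \<Rightarrow> nat \<Rightarrow> nat" where
  "node u v i = (u * n + v) * (m + 3) + i"

definition N :: nat where "N = n * n * (m + 3)"

definition F :: "(nat \<times> nat) set" where
  "F = {(u, v). u < n \<and> v < n \<and> u \<le> v \<and> {u, v} \<in> edges G}"

text \<open>For \<open>i \<le> m\<close>, the node \<open>(v, v, i)\<close> is on the source side if the label of \<open>v\<close> has position at
  least \<open>i\<close> in its chain. The unit arc from \<open>(u, v, m + 1)\<close> to \<open>(u, v, m + 2)\<close> of the edge \<open>uv\<close> need
  not be cut if the positions of the labels of \<open>u\<close> and \<open>v\<close> are in one of the two rectangles of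
  \<open>two_monotone_chains\<close>.\<close>
definition unit_arcs :: "nat \<Rightarrow> nat \<Rightarrow> (nat \<times> nat) set" where
  "unit_arcs u v = (if (u, v) \<in> F then {(node u v (m + 1), node u v (m + 2))} else {})"

definition chain_arcs :: "nat \<Rightarrow> nat \<Rightarrow> (nat \<times> nat) set" where
  "chain_arcs v i = {(node v v (i + 1), node v v i)}"

definition edge_arcs :: "nat \<Rightarrow> nat \<Rightarrow> (nat \<times> nat) set" where
  "edge_arcs u v = (if (u, v) \<in> F then
     {(node u u (pa (L u) (L v)), node u v (m + 1)), (node v v (pb (L u) (L v)), node u v (m + 1)),
      (node u v (m + 2), node u u (qa (L u) (L v))), (node u v (m + 2), node v v (qb (L u) (L v)))}
   else {})"

definition units :: "(nat \<times> nat) set" where "units = (\<Union>u<n. \<Union>v<n. unit_arcs u v)"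

text \<open>These arcs are implications: if the tail is on the source side, so is the head.\<close>

definition rigid :: "(nat \<times> nat) set" where
  "rigid = (\<Union>v<n. \<Union>i<m. chain_arcs v i) \<union> (\<Union>u<n. \<Union>v<n. edge_arcs u v)"

text \<open>As there are at most \<open>n * n\<close> unit arcs, \<open>n * n + 1\<close> acts as an
  infinite capacity. Chains shorter than \<open>m\<close> are closed off by several sinks. An empty
  list would make \<open>node v v 0\<close> both a source and a sink, and no valid cut would
  exist.\<close>

definition network :: "(nat \<Rightarrow> nat) \<Rightarrow> (nat \<Rightarrow> nat) \<Rightarrow> (nat \<Rightarrow> nat) \<Rightarrow> bool" where
  "network c src snk \<longleftrightarrow>
     (\<forall>x<N. \<forall>y<N. c (x * N + y) = (if (x, y) \<in> rigid then n * n + 1 else of_bool ((x, y) \<in> units))) \<and>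
     (\<forall>x<N. src x \<noteq> 0 \<longleftrightarrow> (\<exists>v<n. x = node v v 0)) \<and>
     (\<forall>x<N. snk x \<noteq> 0 \<longleftrightarrow> (\<exists>v<n. \<exists>i\<le>m. len v \<le> i \<and> x = node v v i))"

section \<open>Numbering of the nodes and bounds on the thresholds\<close>

lemma node_less: "u < n \<Longrightarrow> v < n \<Longrightarrow> i < m + 3 \<Longrightarrow> node u v i < N"
proof -
  assume a: "u < n" "v < n" "i < m + 3"
  have "u * n + v < n * n"
    using a mult_le_mono1[of "Suc u" n n] by simp
  then have "Suc (u * n + v) * (m + 3) \<le> n * n * (m + 3)" by (intro mult_le_mono1) simp
  then show ?thesis using a unfolding node_def N_def by simp
qed

lemma node_decode:
  assumes "v < n" "i < m + 3"
  shows "node u v i mod (m + 3) = i" "node u v i div (m + 3) div n = u" "node u v i div (m + 3) mod n = v"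
proof -
  have "node u v i div (m + 3) = u * n + v" using assms unfolding node_def by simp
  then show "node u v i div (m + 3) div n = u" "node u v i div (m + 3) mod n = v" using assms by auto
  show "node u v i mod (m + 3) = i" using assms unfolding node_def by simp
qed

lemma node_inject:
  assumes "v < n" "v' < n" "i < m + 3" "i' < m + 3"
  shows "node u v i = node u' v' i' \<longleftrightarrow> u = u' \<and> v = v' \<and> i = i'"
  using node_decode[OF assms(1,3), of u] node_decode[OF assms(2,4), of u'] by metis

lemma F_less: "(u, v) \<in> F \<Longrightarrow> u < n \<and> v < n"
  unfolding F_def by auto

lemma finite_F: "finite F"
  by (rule finite_subset[of _ "{..<n} \<times> {..<n}"]) (auto simp: F_def)

lemma card_F: "card F \<le> n * n"
  using card_mono[of "{..<n} \<times> {..<n}" F] by (auto simp: F_def)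

lemma chain_bounds:
  assumes "v < n"
  shows "len v \<le> m" "set (ch (L v)) \<subseteq> L v"
    "\<And>x. x \<in> L v \<Longrightarrow> \<exists>y\<in>set (ch (L v)). \<forall>z\<in>verts H. adj H x z \<longrightarrow> adj H y z"
  using chains lists[OF assms] unfolding two_monotone_chains_def m_def by blast+

lemma threshold_bounds:
  assumes "u < n" "v < n"
  shows "pa (L u) (L v) \<le> len u" "pb (L u) (L v) \<le> len v" "qa (L u) (L v) \<le> len u" "qb (L u) (L v) \<le> len v"
  using chains lists[OF assms(1)] lists[OF assms(2)] unfolding two_monotone_chains_def by blast+

lemma threshold_less:
  assumes "u < n" "v < n"
  shows "pa (L u) (L v) < m + 3" "pb (L u) (L v) < m + 3" "qa (L u) (L v) < m + 3" "qb (L u) (L v) < m + 3"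
  using threshold_bounds[OF assms] chain_bounds(1)[OF assms(1)] chain_bounds(1)[OF assms(2)] by linarith+

lemma adj_iff_thresholds:
  assumes "u < n" "v < n" "i < len u" "j < len v"
  shows "adj H (ch (L u) ! i) (ch (L v) ! j) \<longleftrightarrow>
    i < pa (L u) (L v) \<and> j < pb (L u) (L v) \<or> qa (L u) (L v) \<le> i \<and> qb (L u) (L v) \<le> j"
proof -
  note two = chains[unfolded two_monotone_chains_def, THEN conjunct2, THEN spec, THEN mp,
      OF lists[OF assms(1)], THEN spec, THEN mp, OF lists[OF assms(2)]]
  show ?thesis
    by (rule two[THEN conjunct2, THEN conjunct2, THEN conjunct2, THEN conjunct2, THEN spec, THEN mp,
          OF assms(3), THEN spec, THEN mp, OF assms(4)])
qed

lemma units_eq: "units = (\<lambda>(u, v). (node u v (m + 1), node u v (m + 2))) ` F"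
proof
  show "units \<subseteq> (\<lambda>(u, v). (node u v (m + 1), node u v (m + 2))) ` F"
  proof
    fix z assume "z \<in> units"
    then obtain u v where "z \<in> unit_arcs u v" unfolding units_def by blast
    then show "z \<in> (\<lambda>(u, v). (node u v (m + 1), node u v (m + 2))) ` F"
      unfolding unit_arcs_def by (cases "(u, v) \<in> F") auto
  qed
  show "(\<lambda>(u, v). (node u v (m + 1), node u v (m + 2))) ` F \<subseteq> units"
  proof
    fix z assume "z \<in> (\<lambda>(u, v). (node u v (m + 1), node u v (m + 2))) ` F"
    then obtain u v where "(u, v) \<in> F" "z = (node u v (m + 1), node u v (m + 2))" by auto
    then show "z \<in> units"
      unfolding units_def using F_less[of u v]
      by (intro UN_I[of u] UN_I[of v]) (auto simp: unit_arcs_def)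
  qed
qed

lemma units_bounded: "units \<subseteq> {..<N} \<times> {..<N}"
  unfolding units_eq using node_less F_less by auto

lemma rigid_bounded: "rigid \<subseteq> {..<N} \<times> {..<N}"
  unfolding rigid_def chain_arcs_def edge_arcs_def
  using node_less threshold_less by (auto split: if_splits)

lemma cut_units:
  assumes "network c src snk" "\<And>x y. (x, y) \<in> rigid \<Longrightarrow> x \<in> S \<Longrightarrow> y \<in> S"
  shows "cut N c S = int (card {(u, v) \<in> F. node u v (m + 1) \<in> S \<and> node u v (m + 2) \<notin> S})"
proof -
  let ?W = "{(u, v) \<in> F. node u v (m + 1) \<in> S \<and> node u v (m + 2) \<notin> S}"
  let ?f = "\<lambda>(u, v). (node u v (m + 1), node u v (m + 2))"
  have "cut N c S = int (card {(x, y) \<in> units. x \<in> S \<and> y \<notin> S})"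
    by (rule cut_eq_card[OF _ units_bounded assms(2)]) (use assms(1) in \<open>simp_all add: network_def\<close>)
  also have "{(x, y) \<in> units. x \<in> S \<and> y \<notin> S} = ?f ` ?W"
    unfolding units_eq by auto
  also have "card (?f ` ?W) = card ?W"
    by (rule card_image) (auto simp: inj_on_def node_inject dest!: F_less)
  finally show ?thesis .
qed

lemma cut_of_labels:
  assumes net: "network c src snk" and x: "\<And>v. v < n \<Longrightarrow> x v < len v"
  shows "\<exists>S. valid_cut N src snk S \<and>
    cut N c S = int (card {(u, v) \<in> F. \<not> adj H (ch (L u) ! x u) (ch (L v) ! x v)})"
proof -
  \<comment> \<open>The tail of a unit arc is put on the source side only if a rigid arc forces it,
    the head whenever the rigid arcs allow it. So the unit arc is cut only if both rectangles are
    missed.\<close>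
  define Q where "Q = (\<lambda>u v i. if i \<le> m then i \<le> x u
    else if i = m + 1 then pa (L u) (L v) \<le> x u \<or> pb (L u) (L v) \<le> x v
    else qa (L u) (L v) \<le> x u \<and> qb (L u) (L v) \<le> x v)"
  define S where "S = {a. Q (a div (m + 3) div n) (a div (m + 3) mod n) (a mod (m + 3))}"
  have S: "node u v i \<in> S \<longleftrightarrow> Q u v i" if "v < n" "i < m + 3" for u v i
    using node_decode[OF that] unfolding S_def by simp
  have t: "pa (L u) (L v) \<le> m" "pb (L u) (L v) \<le> m" "qa (L u) (L v) \<le> m" "qb (L u) (L v) \<le> m"
    if "u < n" "v < n" for u v
    using threshold_bounds[OF that] chain_bounds(1)[OF that(1)] chain_bounds(1)[OF that(2)] by linarith+
  have "valid_cut N src snk S"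
    unfolding valid_cut_def
  proof (intro allI impI conjI)
    fix a assume "a < N" "src a \<noteq> 0"
    then obtain v where "v < n" "a = node v v 0" using net unfolding network_def by blast
    then show "a \<in> S" using S by (simp add: Q_def)
  next
    fix a assume "a < N" "snk a \<noteq> 0"
    then obtain v i where "v < n" "i \<le> m" "len v \<le> i" "a = node v v i" using net unfolding network_def by blast
    then show "a \<notin> S" using S x[of v] by (simp add: Q_def)
  qed
  moreover have "b \<in> S" if ab: "(a, b) \<in> rigid" "a \<in> S" for a b
  proof -
    consider (chain) v i where "v < n" "i < m" "a = node v v (i + 1)" "b = node v v i"
      | (edge) u v where "u < n" "v < n" "(a, b) \<in> edge_arcs u v"
      using ab(1) unfolding rigid_def chain_arcs_def by blast
    then show ?thesis
    proof cases
      case chain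
      then show ?thesis using ab(2) S by (simp add: Q_def)
    next
      case edge
      then show ?thesis
        using ab(2) t[OF edge(1,2)] unfolding edge_arcs_def by (auto simp: S Q_def split: if_splits)
    qed
  qed
  then have "cut N c S = int (card {(u, v) \<in> F. node u v (m + 1) \<in> S \<and> node u v (m + 2) \<notin> S})"
    by (rule cut_units[OF net])
  moreover have "{(u, v) \<in> F. node u v (m + 1) \<in> S \<and> node u v (m + 2) \<notin> S} =
      {(u, v) \<in> F. \<not> adj H (ch (L u) ! x u) (ch (L v) ! x v)}"
  proof -
    have "node u v (m + 1) \<in> S \<and> node u v (m + 2) \<notin> S \<longleftrightarrow> \<not> adj H (ch (L u) ! x u) (ch (L v) ! x v)"
      if "(u, v) \<in> F" for u v
      using F_less[OF that] S adj_iff_thresholds[of u v "x u" "x v"] x by (auto simp: Q_def)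
    then show ?thesis by blast
  qed
  ultimately show ?thesis by auto
qed

section \<open>From cuts to deleted edges and back\<close>

lemma adj_sym: "adj H x y \<longleftrightarrow> adj H y x"
  unfolding adj_def by (simp add: insert_commute)

definition deleted :: "nat set \<Rightarrow> nat set set" where
  "deleted S = (\<lambda>(u, v). {u, v}) ` {(u, v) \<in> F. node u v (m + 1) \<in> S \<and> node u v (m + 2) \<notin> S}"

text \<open>A cut this small crosses no rigid arc. So for each \<open>v\<close> the chain nodes in
  \<open>S\<close> form an initial segment, nonempty because of the source and within the chain
  because of the sinks; its top is the position of the label.\<close>

lemma labels_of_cut:
  assumes net: "network c src snk" and valid: "valid_cut N src snk S" and cut: "cut N c S \<le> int (n * n)"
  shows "list_hom_del H G L (deleted S)" "int (card (deleted S)) \<le> cut N c S"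
proof -
  have rigid: "y \<in> S" if "(x, y) \<in> rigid" "x \<in> S" for x y
  proof (rule cut_less_imp_no_crossing[where N = N and c = c])
    show "x < N" "y < N" using that rigid_bounded by auto
    then have "c (x * N + y) = n * n + 1" using net that unfolding network_def by simp
    then show "cut N c S < int (c (x * N + y))" using cut by simp
  qed fact
  have "cut N c S = int (card {(u, v) \<in> F. node u v (m + 1) \<in> S \<and> node u v (m + 2) \<notin> S})"
    by (rule cut_units[OF net rigid])
  moreover have "finite {(u, v) \<in> F. node u v (m + 1) \<in> S \<and> node u v (m + 2) \<notin> S}"
    using finite_F by (rule finite_subset[rotated]) auto
  ultimately show "int (card (deleted S)) \<le> cut N c S"
    unfolding deleted_def using card_image_le by force
  have "\<exists>x<len v. \<forall>i\<le>m. node v v i \<in> S \<longleftrightarrow> i \<le> x" if v: "v < n" for v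
  proof -
    define D where "D = (\<lambda>i. i \<le> m \<and> node v v i \<in> S)"
    have step: "D i" if "D (Suc i)" for i
    proof -
      have "(node v v (Suc i), node v v i) \<in> rigid"
        unfolding rigid_def chain_arcs_def
        by (intro UnI1 UN_I[of v] UN_I[of i]) (use that v in \<open>auto simp: D_def\<close>)
      then show ?thesis using rigid that unfolding D_def by auto
    qed
    have down: "D i \<Longrightarrow> j \<le> i \<Longrightarrow> D j" for i j
      by (induction i) (auto simp: le_Suc_eq dest: step)
    have bound: "i < len v" if "D i" for i
    proof (rule ccontr)
      assume "\<not> i < len v"
      then have "\<exists>w<n. \<exists>j\<le>m. len w \<le> j \<and> node v v i = node w w j"
        using v that unfolding D_def by (intro exI[of _ v] exI[of _ i]) auto
      moreover have "node v v i < N" using node_less[OF v v, of i] that unfolding D_def by simp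
      ultimately have "snk (node v v i) \<noteq> 0" using net unfolding network_def by blast
      then show False using valid that v node_less[OF v v, of i] unfolding valid_cut_def D_def by auto
    qed
    obtain a where a: "\<And>i. D i \<longleftrightarrow> i < a"
      using downset_is_initial_segment[of D "len v"] down bound by blast
    have "src (node v v 0) \<noteq> 0" using net v node_less[OF v v, of 0] unfolding network_def by auto
    then have "D 0" using valid node_less[OF v v, of 0] unfolding valid_cut_def D_def by auto
    then have "0 < a" using a by blast
    then have "D (a - 1)" using a by simp
    then have "a - 1 < len v" by (rule bound)
    moreover have "\<forall>i\<le>m. node v v i \<in> S \<longleftrightarrow> i \<le> a - 1" using a \<open>0 < a\<close> unfolding D_def by (metis Suc_diff_1 less_Suc_eq_le)
    ultimately show ?thesis by blast
  qed
  then obtain x where x: "\<And>v. v < n \<Longrightarrow> x v < len v"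
    "\<And>v i. v < n \<Longrightarrow> i \<le> m \<Longrightarrow> node v v i \<in> S \<longleftrightarrow> i \<le> x v"
    by metis
  have ok: "adj H (ch (L u) ! x u) (ch (L v) ! x v)" if uv: "(u, v) \<in> F" "{u, v} \<notin> deleted S" for u v
  proof -
    have l: "u < n" "v < n" using F_less[OF uv(1)] by auto
    note t = threshold_bounds[OF l] chain_bounds(1)[OF l(1)] chain_bounds(1)[OF l(2)]
    have arcs: "edge_arcs u v \<subseteq> rigid" using l unfolding rigid_def by blast
    have "node u v (m + 1) \<notin> S \<or> node u v (m + 2) \<in> S" using uv unfolding deleted_def by auto
    then have "x u < pa (L u) (L v) \<and> x v < pb (L u) (L v) \<or> qa (L u) (L v) \<le> x u \<and> qb (L u) (L v) \<le> x v"
    proof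
      assume "node u v (m + 1) \<notin> S"
      then have "node u u (pa (L u) (L v)) \<notin> S" "node v v (pb (L u) (L v)) \<notin> S"
        using arcs rigid uv(1) unfolding edge_arcs_def by auto
      then show ?thesis using x(2) l t by (metis le_trans not_le)
    next
      assume "node u v (m + 2) \<in> S"
      then have "node u u (qa (L u) (L v)) \<in> S" "node v v (qb (L u) (L v)) \<in> S"
        using arcs rigid uv(1) unfolding edge_arcs_def by auto
      then show ?thesis using x(2) l t by (metis le_trans)
    qed
    then show ?thesis using adj_iff_thresholds[OF l x(1) x(1)] l by simp
  qed
  show "list_hom_del H G L (deleted S)"
    unfolding list_hom_del_def
  proof (intro conjI exI[of _ "\<lambda>v. ch (L v) ! x v"] ballI allI impI)
    show "deleted S \<subseteq> edges G" unfolding deleted_def F_def by auto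
    show "ch (L v) ! x v \<in> L v" if "v \<in> verts G" for v
      using that x(1) chain_bounds(2) nth_mem unfolding verts_G by blast
    show "adj H (ch (L u) ! x u) (ch (L v) ! x v)" if "{u, v} \<in> edges G - deleted S" for u v
    proof -
      have e: "{u, v} \<in> edges G" using that by blast
      obtain u' v' where "u' \<in> verts G" "v' \<in> verts G" "{u, v} = {u', v'}"
        using bspec[OF conjunct2[OF graph_G[unfolded is_graph_def]] e] by (elim bexE)
      then have "u < n" "v < n" unfolding verts_G by (auto simp: doubleton_eq_iff)
      then have "(u, v) \<in> F \<or> (v, u) \<in> F" using that unfolding F_def by (auto simp: insert_commute)
      then show ?thesis using ok[of u v] ok[of v u] that adj_sym by (auto simp: insert_commute)
    qed
  qed
qed

text \<open>Each label is replaced by one in the chain that dominates it. By symmetry of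
  \<open>adj\<close> this may be done at one end of an edge after the other, and no edge that was
  kept gets lost.\<close>

lemma labels_of_deletion:
  assumes "list_hom_del H G L Y"
  shows "\<exists>x. (\<forall>v<n. x v < len v) \<and>
    card {(u, v) \<in> F. \<not> adj H (ch (L u) ! x u) (ch (L v) ! x v)} \<le> card Y"
proof -
  obtain f where Y: "Y \<subseteq> edges G" and f: "\<And>v. v < n \<Longrightarrow> f v \<in> L v"
    "\<And>u v. {u, v} \<in> edges G - Y \<Longrightarrow> adj H (f u) (f v)"
    using assms unfolding list_hom_del_def verts_G by auto
  have "\<exists>i<len v. \<forall>z\<in>verts H. adj H (f v) z \<longrightarrow> adj H (ch (L v) ! i) z" if "v < n" for v
    using chain_bounds(3)[OF that f(1)[OF that]] by (metis in_set_conv_nth)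
  then obtain x where x: "\<And>v. v < n \<Longrightarrow> x v < len v"
    "\<And>v z. v < n \<Longrightarrow> z \<in> verts H \<Longrightarrow> adj H (f v) z \<Longrightarrow> adj H (ch (L v) ! x v) z"
    by metis
  let ?W = "{(u, v) \<in> F. \<not> adj H (ch (L u) ! x u) (ch (L v) ! x v)}"
  have "{u, v} \<in> Y" if "(u, v) \<in> ?W" for u v
  proof (rule ccontr)
    assume "{u, v} \<notin> Y"
    moreover have l: "u < n" "v < n" and "{u, v} \<in> edges G" using that unfolding F_def by auto
    ultimately have "adj H (f u) (f v)" using f(2) by blast
    moreover have "f v \<in> verts H" "ch (L u) ! x u \<in> verts H"
      using f(1)[OF l(2)] lists[OF l(2)] lists[OF l(1)] chain_bounds(2)[OF l(1)] nth_mem[OF x(1)[OF l(1)]] by blast+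
    ultimately have "adj H (ch (L u) ! x u) (ch (L v) ! x v)"
      using x(2) l adj_sym by blast
    then show False using that by simp
  qed
  then have "(\<lambda>(u, v). {u, v}) ` ?W \<subseteq> Y" by auto
  moreover have "finite (edges G)"
  proof (rule finite_subset)
    show "edges G \<subseteq> (\<lambda>(u, v). {u, v}) ` ({..<n} \<times> {..<n})"
      using graph_G unfolding is_graph_def verts_G by fastforce
  qed simp
  then have "finite Y" using Y finite_subset by blast
  \<comment> \<open>\<open>F\<close> contains only one orientation of each edge.\<close>
  moreover have "inj_on (\<lambda>(u, v). {u, v}) ?W"
    unfolding inj_on_def F_def by (auto simp: doubleton_eq_iff)
  ultimately have "card ?W \<le> card Y" using card_inj_on_le by blast
  then show ?thesis using x(1) by blast
qed

lemma deletion_exists_iff: "(\<exists>X. list_hom_del H G L X) \<longleftrightarrow> (\<forall>v<n. L v \<noteq> {})"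
proof
  assume "\<exists>X. list_hom_del H G L X"
  then show "\<forall>v<n. L v \<noteq> {}" unfolding list_hom_del_def verts_G by blast
next
  assume "\<forall>v<n. L v \<noteq> {}"
  then have "\<exists>f. \<forall>v<n. f v \<in> L v" by (meson ex_in_conv)
  then have "list_hom_del H G L (edges G)" unfolding list_hom_del_def verts_G by auto
  then show "\<exists>X. list_hom_del H G L X" ..
qed

lemma finite_cut_exists:
  assumes "network c src snk" "\<forall>v<n. L v \<noteq> {}"
  shows "\<exists>S. valid_cut N src snk S \<and> cut N c S \<le> int (n * n)"
proof -
  obtain Y where "list_hom_del H G L Y" using deletion_exists_iff assms(2) by blast
  then obtain x where x: "\<And>v. v < n \<Longrightarrow> x v < len v" using labels_of_deletion by blast
  obtain S where "valid_cut N src snk S"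
    and S: "cut N c S = int (card {(u, v) \<in> F. \<not> adj H (ch (L u) ! x u) (ch (L v) ! x v)})"
    using cut_of_labels[OF assms(1) x] by blast
  moreover have "card {(u, v) \<in> F. \<not> adj H (ch (L u) ! x u) (ch (L v) ! x v)} \<le> card F"
    by (rule card_mono[OF finite_F]) auto
  then have "cut N c S \<le> int (n * n)" unfolding S using card_F by (simp only: of_nat_le_iff)
  ultimately show ?thesis by blast
qed

text \<open>Every deletion \<open>Y\<close> yields a valid cut of capacity at most
  \<open>card Y\<close>, and \<open>S\<close> yields a deletion no larger than its own
  capacity.\<close>

lemma min_cut_min_deletion:
  assumes net: "network c src snk" and S: "valid_cut N src snk S" and cut: "cut N c S \<le> int (n * n)"
    and min: "\<And>T. valid_cut N src snk T \<Longrightarrow> cut N c S \<le> cut N c T"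
  shows "min_list_hom_del H G L (deleted S)"
  unfolding min_list_hom_del_def
proof (intro conjI allI impI)
  show "list_hom_del H G L (deleted S)" by (rule labels_of_cut(1)[OF net S cut])
  fix Y assume "list_hom_del H G L Y"
  then obtain x where x: "\<And>v. v < n \<Longrightarrow> x v < len v"
    "card {(u, v) \<in> F. \<not> adj H (ch (L u) ! x u) (ch (L v) ! x v)} \<le> card Y"
    using labels_of_deletion by blast
  obtain T where "valid_cut N src snk T"
    and T: "cut N c T = int (card {(u, v) \<in> F. \<not> adj H (ch (L u) ! x u) (ch (L v) ! x v)})"
    using cut_of_labels[OF net x(1)] by blast
  then have "int (card (deleted S)) \<le> cut N c T"
    using min labels_of_cut(2)[OF net S cut] by force
  then show "card (deleted S) \<le> card Y" using T x(2) by simp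
qed

end

section \<open>The program\<close>

text \<open>The binary number with these digits, most significant first; doubling by addition is how
  \<open>read_list\<close> computes it.\<close>

definition bits_code :: "bool list \<Rightarrow> nat" where
  "bits_code bs = foldl (\<lambda>c b. c + c + of_bool b) 0 bs"

lemma bits_code_snoc: "bits_code (bs @ [b]) = bits_code bs + bits_code bs + of_bool b"
  by (simp add: bits_code_def)

lemma bits_code_inject: "length bs = length bs' \<Longrightarrow> bits_code bs = bits_code bs' \<Longrightarrow> bs = bs'"
proof (induction bs arbitrary: bs' rule: rev_induct)
  case (snoc b bs)
  then obtain c cs where bs': "bs' = cs @ [c]" by (cases bs' rule: rev_cases) auto
  have eq: "bits_code bs + bits_code bs + of_bool b = bits_code cs + bits_code cs + of_bool c"
    using snoc.prems unfolding bs' bits_code_snoc by simp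
  have "b = c" using arg_cong[OF eq, of odd] by simp
  moreover have "bits_code bs = bits_code cs" using eq \<open>b = c\<close> by simp
  ultimately show ?case using snoc.IH[of cs] snoc.prems unfolding bs' by simp
qed simp

lemma bits_code_eq_0_iff: "bits_code bs = 0 \<longleftrightarrow> True \<notin> set bs"
  by (induction bs rule: rev_induct) (auto simp: bits_code_snoc, simp add: bits_code_def)

definition list_code :: "'a list \<Rightarrow> 'a set \<Rightarrow> nat" where
  "list_code hs A = bits_code (map (\<lambda>a. a \<in> A) hs)"

lemma list_code_inject:
  assumes "A \<subseteq> set hs" "B \<subseteq> set hs"
  shows "list_code hs A = list_code hs B \<longleftrightarrow> A = B"
proof
  assume "list_code hs A = list_code hs B"
  then have "map (\<lambda>a. a \<in> A) hs = map (\<lambda>a. a \<in> B) hs"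
    unfolding list_code_def by (intro bits_code_inject) simp
  then show "A = B" using assms by auto
qed simp

lemma list_code_eq_0_iff: "A \<subseteq> set hs \<Longrightarrow> list_code hs A = 0 \<longleftrightarrow> A = {}"
  unfolding list_code_def bits_code_eq_0_iff by auto

text \<open>A product with a constant, written out as a sum so that it involves no size
  variable.\<close>

fun repeat_exp :: "nat \<Rightarrow> exp \<Rightarrow> exp" where
  "repeat_exp 0 e = Num 0"
| "repeat_exp (Suc k) e = Plus e (repeat_exp k e)"

fun sum_exp :: "exp list \<Rightarrow> exp" where
  "sum_exp [] = Num 0"
| "sum_exp (e # es) = Plus e (sum_exp es)"

lemma repeat_exp_simps [simp]:
  "aval (repeat_exp k e) s = k * aval e s"
  "exp_sizes e = {} \<Longrightarrow> exp_sizes (repeat_exp k e) = {}"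
  "exp_arrays e \<Longrightarrow> exp_arrays (repeat_exp k e)"
  by (induction k) auto

lemma sum_exp_simps:
  "aval (sum_exp es) s = (\<Sum>e\<leftarrow>es. aval e s)"
  "(\<forall>e\<in>set es. exp_sizes e = {}) \<Longrightarrow> exp_sizes (sum_exp es) = {}"
  "(\<forall>e\<in>set es. exp_arrays e) \<Longrightarrow> exp_arrays (sum_exp es)"
  by (induction es) auto

text \<open>Any function on subsets of \<open>verts H\<close>, however obtained, becomes a fixed
  expression: a sum over all subsets in which only the one with the given code contributes. This is
  how chain lengths and thresholds enter the program.\<close>

definition table :: "'a list \<Rightarrow> ('a set \<Rightarrow> nat) \<Rightarrow> exp \<Rightarrow> exp" where
  "table hs f e = sum_exp (map (\<lambda>xs. repeat_exp (f (set xs)) (EQ e (Num (list_code hs (set xs))))) (subseqs hs))"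

definition table2 :: "'a list \<Rightarrow> ('a set \<Rightarrow> 'a set \<Rightarrow> nat) \<Rightarrow> exp \<Rightarrow> exp \<Rightarrow> exp" where
  "table2 hs f e e' = sum_exp (map (\<lambda>xs. sum_exp (map (\<lambda>ys. repeat_exp (f (set xs) (set ys))
     (AND (EQ e (Num (list_code hs (set xs)))) (EQ e' (Num (list_code hs (set ys)))))) (subseqs hs))) (subseqs hs))"

lemma table_simps [simp]:
  "exp_sizes e = {} \<Longrightarrow> exp_sizes (table hs f e) = {}"
  "exp_arrays e \<Longrightarrow> exp_arrays (table hs f e)"
  "exp_sizes e = {} \<Longrightarrow> exp_sizes e' = {} \<Longrightarrow> exp_sizes (table2 hs g e e') = {}"
  "exp_arrays e \<Longrightarrow> exp_arrays e' \<Longrightarrow> exp_arrays (table2 hs g e e')"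
  unfolding table_def table2_def by (simp_all add: sum_exp_simps)

lemma sum_list_subseqs:
  fixes f :: "'a set \<Rightarrow> nat"
  assumes "distinct hs" "A \<subseteq> set hs"
  shows "(\<Sum>xs\<leftarrow>subseqs hs. f (set xs) * of_bool (A = set xs)) = f A"
proof -
  have "(\<Sum>xs\<leftarrow>subseqs hs. f (set xs) * of_bool (A = set xs)) =
      (\<Sum>B\<leftarrow>map set (subseqs hs). f B * of_bool (A = B))" by (simp add: o_def)
  also have "\<dots> = (\<Sum>B\<in>set (map set (subseqs hs)). f B * of_bool (A = B))"
    using distinct_set_subseqs[OF assms(1)] by (rule sum_list_distinct_conv_sum_set)
  also have "set (map set (subseqs hs)) = Pow (set hs)" by (simp add: subseqs_powset)
  also have "(\<Sum>B\<in>Pow (set hs). f B * of_bool (A = B)) = (\<Sum>B\<in>Pow (set hs). if A = B then f B else 0)"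
    by (intro sum.cong) auto
  also have "\<dots> = f A" using assms(2) by (subst sum.delta') auto
  finally show ?thesis .
qed

lemma aval_table:
  assumes "distinct hs" "A \<subseteq> set hs" "aval e s = list_code hs A"
  shows "aval (table hs f e) s = f A"
proof -
  have "aval (table hs f e) s = (\<Sum>xs\<leftarrow>subseqs hs. f (set xs) * of_bool (list_code hs A = list_code hs (set xs)))"
    unfolding table_def sum_exp_simps(1) by (simp add: o_def assms(3))
  also have "\<dots> = (\<Sum>xs\<leftarrow>subseqs hs. f (set xs) * of_bool (A = set xs))"
  proof (intro arg_cong[where f = sum_list] map_cong refl)
    fix xs assume "xs \<in> set (subseqs hs)"
    then have "set xs \<subseteq> set hs" using subseqs_powset[of hs] by blast
    then show "f (set xs) * of_bool (list_code hs A = list_code hs (set xs)) = f (set xs) * of_bool (A = set xs)"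
      using list_code_inject[OF assms(2)] by simp
  qed
  finally show ?thesis using sum_list_subseqs[OF assms(1,2)] by simp
qed

lemma aval_table2:
  assumes "distinct hs" "A \<subseteq> set hs" "B \<subseteq> set hs" "aval e s = list_code hs A" "aval e' s = list_code hs B"
  shows "aval (table2 hs f e e') s = f A B"
proof -
  define T where "T = (\<lambda>C. table hs (f C) e')"
  have T: "aval (T C) s = f C B" for C
    unfolding T_def by (rule aval_table[OF assms(1,3,5)])
  have *: "(\<Sum>ys\<leftarrow>subseqs hs. f (set xs) (set ys) *
      of_bool (list_code hs A = list_code hs (set xs) \<and> list_code hs B = list_code hs (set ys))) =
      f (set xs) B * of_bool (list_code hs A = list_code hs (set xs))" for xs
  proof (cases "list_code hs A = list_code hs (set xs)")
    case True
    then show ?thesis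
      using T[of "set xs"] unfolding T_def table_def sum_exp_simps(1) by (simp add: o_def assms(5))
  qed simp
  have "aval (table2 hs f e e') s = (\<Sum>xs\<leftarrow>subseqs hs. f (set xs) B * of_bool (list_code hs A = list_code hs (set xs)))"
    unfolding table2_def sum_exp_simps(1) by (simp add: o_def sum_exp_simps(1) assms(4,5) *)
  also have "\<dots> = aval (table hs (\<lambda>C. f C B) e) s"
    unfolding table_def sum_exp_simps(1) by (simp add: o_def assms(4))
  also have "\<dots> = f A B" by (rule aval_table[OF assms(1,2,4)])
  finally show ?thesis .
qed

text \<open>The cells written in different rounds may overlap, since all of them receive the same
  value \<open>w\<close>.\<close>

lemma For_For_fill:
  assumes ij: "i \<noteq> j" "x \<noteq> i" "y \<noteq> i" "x \<notin> assigned c" "y \<notin> assigned c" "i \<notin> assigned c" "x \<noteq> j" "y \<noteq> j"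
    and XY: "var s x = X" "var s y = Y"
    and step: "\<And>u v t. u < X \<Longrightarrow> v < Y \<Longrightarrow>
      \<forall>z. z \<notin> {i, j} \<union> assigned c \<longrightarrow> var t z = var s z \<Longrightarrow> var t i = u \<Longrightarrow> var t j = v \<Longrightarrow>
      \<forall>k. k \<notin> updated c \<longrightarrow> arr t k = arr s k \<Longrightarrow>
      arr (sem bd c t) a = (\<lambda>k. if k \<in> A u v then w else arr t a k)"
  shows "arr (sem bd (For i x (For j y c)) s) a =
    (\<lambda>k. if k \<in> (\<Union>u<X. \<Union>v<Y. A u v) then w else arr s a k)"
proof -
  define I where "I = (\<lambda>W (t :: state). arr t a = (\<lambda>k. if \<exists>(u, v)\<in>W. k \<in> A u v then w else arr s a k))"
  have "I ({..<var s x} \<times> {..<var s y}) (sem bd (For i x (For j y c)) s)"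
  proof (rule sem_For_For_invariant[OF ij])
    show "I {} s" unfolding I_def by simp
  next
    fix u v W and t :: state
    assume a: "u < var s x" "v < var s y" "I W t" "\<forall>z. z \<notin> {i, j} \<union> assigned c \<longrightarrow> var t z = var s z"
      "var t i = u" "var t j = v" "\<forall>k. k \<notin> updated c \<longrightarrow> arr t k = arr s k"
    have "arr (sem bd c t) a = (\<lambda>k. if k \<in> A u v then w else arr t a k)"
      by (rule step[OF a(1,2)[unfolded XY] a(4-7)])
    then show "I (insert (u, v) W) (sem bd c t)" using a(3) unfolding I_def by auto
  qed (simp add: I_def)
  moreover have "(\<exists>(u, v)\<in>{..<var s x} \<times> {..<var s y}. k \<in> A u v) \<longleftrightarrow>
      k \<in> (\<Union>u<X. \<Union>v<Y. A u v)" for k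
    using XY by auto
  ultimately show ?thesis unfolding I_def by simp
qed

section \<open>Commands for reading the instance, filling the network and writing the answer\<close>

abbreviation (input) edge_arr :: nat where "edge_arr \<equiv> 5"
abbreviation (input) code_arr :: nat where "code_arr \<equiv> 6"

abbreviation (input) len_var :: nat where "len_var \<equiv> 0"
abbreviation (input) n_var :: nat where "n_var \<equiv> 1"
abbreviation (input) nn_var :: nat where "nn_var \<equiv> 2"
abbreviation (input) m_var :: nat where "m_var \<equiv> 5"
abbreviation (input) k_var :: nat where "k_var \<equiv> 6"
abbreviation (input) go_var :: nat where "go_var \<equiv> 8"
abbreviation (input) u_var :: nat where "u_var \<equiv> 20"
abbreviation (input) v_var :: nat where "v_var \<equiv> 21"
abbreviation (input) i_var :: nat where "i_var \<equiv> 22"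
abbreviation (input) code_var :: nat where "code_var \<equiv> 23"
abbreviation (input) bit_var :: nat where "bit_var \<equiv> 24"
abbreviation (input) bad_var :: nat where "bad_var \<equiv> 25"

text \<open>The flag \<open>go_var\<close> is cleared by the \<open>False\<close> that ends the
  unary number and stays cleared.\<close>

definition read_n :: com where
  "read_n = Comp (Assign go_var (Num 1)) (For i_var len_var (Comp (Get bit_var (Plus (Var i_var) (Num 1)))
     (Cond (AND (Var go_var) (Var bit_var)) (Assign n_var (Plus (Var n_var) (Num 1))) (Assign go_var (Num 0)))))"

text \<open>\<open>iter_var\<close> is both the number of rounds of \<open>max_flow\<close> and the
  capacity of the rigid arcs. It exceeds the possible number of augmentations by one, which leaves a
  round for the search that fails.\<close>

definition set_sizes :: "nat \<Rightarrow> com" where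
  "set_sizes m = Comp (Assign nodes_var (Times (Num (m + 3)) nn_var))
     (Comp (Assign iter_var (Plus (Var nn_var) (Num 1)))
     (Comp (Assign m_var (Num m)) (Assign k_var (Num (m + 3)))))"

text \<open>Bit \<open>i\<close> of the input is in cell \<open>i + 1\<close>; the adjacency matrix starts at bit \<open>n + 1\<close>, the lists at
  bit \<open>n\<^sup>2 + n + 1\<close>.\<close>
definition read_edges :: com where
  "read_edges = For u_var n_var (For v_var n_var
     (Comp (Get bit_var (Plus (Plus (Times (Var u_var) n_var) (Var v_var)) (Plus (Var n_var) (Num 2))))
       (Update edge_arr (Plus (Times (Var u_var) n_var) (Var v_var)) (Var bit_var))))"

definition read_list :: com where
  "read_list = Comp (Assign code_var (Num 0)) (For i_var m_var
     (Comp (Get bit_var (Plus (Plus (Times (Var v_var) m_var) (Var i_var)) (Plus (Var nn_var) (Plus (Var n_var) (Num 2)))))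
       (Assign code_var (Plus (Plus (Var code_var) (Var code_var)) (Var bit_var)))))"

definition read_lists :: com where
  "read_lists = For v_var n_var (Comp read_list (Comp (Update code_arr (Var v_var) (Var code_var))
     (Cond (Var code_var) skip (Assign bad_var (Num 1)))))"

definition node_exp :: "exp \<Rightarrow> exp \<Rightarrow> exp \<Rightarrow> exp" where
  "node_exp u v i = Plus (Times (Plus (Times u n_var) v) k_var) i"

definition arc_exp :: "exp \<Rightarrow> exp \<Rightarrow> exp" where
  "arc_exp x y = Plus (Times x nodes_var) y"

definition edge_exp :: "exp \<Rightarrow> exp \<Rightarrow> exp" where
  "edge_exp u v = AND (LE u v) (Arr edge_arr (Plus (Times u n_var) v))"

definition fill_units :: "nat \<Rightarrow> com" where
  "fill_units m = For u_var n_var (For v_var n_var (Cond (edge_exp (Var u_var) (Var v_var))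
     (Update cap_arr (arc_exp (node_exp (Var u_var) (Var v_var) (Num (m + 1)))
       (node_exp (Var u_var) (Var v_var) (Num (m + 2)))) (Num 1)) skip))"

definition fill_chains :: com where
  "fill_chains = For v_var n_var (For i_var m_var
     (Update cap_arr (arc_exp (node_exp (Var v_var) (Var v_var) (Plus (Var i_var) (Num 1)))
       (node_exp (Var v_var) (Var v_var) (Var i_var))) (Var iter_var)))"

definition fill_edges ::
  "'a list \<Rightarrow> ('a set \<Rightarrow> 'a set \<Rightarrow> nat) \<Rightarrow> ('a set \<Rightarrow> 'a set \<Rightarrow> nat) \<Rightarrow> ('a set \<Rightarrow> 'a set \<Rightarrow> nat) \<Rightarrow>
    ('a set \<Rightarrow> 'a set \<Rightarrow> nat) \<Rightarrow> nat \<Rightarrow> com" where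
  "fill_edges hs pa pb qa qb m = For u_var n_var (For v_var n_var (Cond (edge_exp (Var u_var) (Var v_var))
     (let u = Var u_var; v = Var v_var;
       tab = (\<lambda>f. table2 hs f (Arr code_arr u) (Arr code_arr v));
       set_cap = (\<lambda>x y. Update cap_arr (arc_exp x y) (Var iter_var))
      in Comp (Comp (set_cap (node_exp u u (tab pa)) (node_exp u v (Num (m + 1))))
           (set_cap (node_exp v v (tab pb)) (node_exp u v (Num (m + 1)))))
         (Comp (set_cap (node_exp u v (Num (m + 2))) (node_exp u u (tab qa)))
           (set_cap (node_exp u v (Num (m + 2))) (node_exp v v (tab qb)))))
     skip))"

definition fill_src :: com where
  "fill_src = For v_var n_var (For i_var k_var (Cond (Var i_var) skip
     (Update src_arr (node_exp (Var v_var) (Var v_var) (Var i_var)) (Num 1))))"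

definition fill_snk :: "'a list \<Rightarrow> ('a set \<Rightarrow> nat) \<Rightarrow> nat \<Rightarrow> com" where
  "fill_snk hs l m = For v_var n_var (For i_var k_var
     (Cond (AND (LE (Var i_var) (Num m)) (LE (table hs l (Arr code_arr (Var v_var))) (Var i_var)))
       (Update snk_arr (node_exp (Var v_var) (Var v_var) (Var i_var)) (Num 1)) skip))"

definition cut_exp :: "nat \<Rightarrow> exp \<Rightarrow> exp \<Rightarrow> exp" where
  "cut_exp m u v = AND (edge_exp u v) (AND (Arr dist_arr (node_exp u v (Num (m + 1))))
     (NOT (Arr dist_arr (node_exp u v (Num (m + 2))))))"

text \<open>The matrix is symmetric while \<open>edge_exp\<close> accepts only
  \<open>u \<le> v\<close>, so both orientations are tested.\<close>

definition write_output :: "nat \<Rightarrow> com" where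
  "write_output m = Cond (Var bad_var) (Comp (Put (Num 0) (Num 1)) (Put (Num 1) (Num 0)))
     (Comp (Comp (Put (Num 0) (Plus (Var nn_var) (Num 1))) (Put (Num 1) (Num 1)))
       (For u_var n_var (For v_var n_var (Put (Plus (Plus (Times (Var u_var) n_var) (Var v_var)) (Num 2))
         (NOT (NOT (Plus (cut_exp m (Var u_var) (Var v_var)) (cut_exp m (Var v_var) (Var u_var)))))))))"

text \<open>The first four commands are separate because each of them assigns size variables of
  later commands, which a command may not do with its own.\<close>

definition lhomed_coms :: "'a list \<Rightarrow> ('a set \<Rightarrow> nat) \<Rightarrow> ('a set \<Rightarrow> 'a set \<Rightarrow> nat) \<Rightarrow> ('a set \<Rightarrow> 'a set \<Rightarrow> nat) \<Rightarrow>
    ('a set \<Rightarrow> 'a set \<Rightarrow> nat) \<Rightarrow> ('a set \<Rightarrow> 'a set \<Rightarrow> nat) \<Rightarrow> com list" where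
  "lhomed_coms hs l pa pb qa qb = (let m = length hs in
     [Get len_var (Num 0), read_n, Assign nn_var (Times (Var n_var) n_var), set_sizes m,
      read_edges, read_lists, fill_units m, fill_chains, fill_edges hs pa pb qa qb m,
      fill_src, fill_snk hs l m, max_flow, write_output m])"

lemmas com_defs = read_n_def set_sizes_def read_edges_def read_list_def read_lists_def fill_units_def
  fill_chains_def fill_edges_def fill_src_def fill_snk_def write_output_def max_flow_def search_def
  search_round_def scan_arc_def find_sink_def push_arc_def
  node_exp_def arc_exp_def edge_exp_def cut_exp_def

lemma lhomed_coms_admissible:
  "\<forall>c\<in>set (lhomed_coms hs l pa pb qa qb). arrays c \<and> sizes c \<inter> assigned c = {}"
  unfolding lhomed_coms_def Let_def by (simp add: com_defs Let_def)

lemma node_exp_simps [simp]: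
  "aval (node_exp u v i) s = (aval u s * var s n_var + aval v s) * var s k_var + aval i s"
  "aval (arc_exp x y) s = aval x s * var s nodes_var + aval y s"
  "aval (edge_exp u v) s =
     of_bool (aval u s \<le> aval v s \<and> arr s edge_arr (aval u s * var s n_var + aval v s) \<noteq> 0)"
  by (auto simp: node_exp_def arc_exp_def edge_exp_def)

section \<open>Positions in the encoding and correctness of reading\<close>

lemma length_concat_map: "length (concat (map (\<lambda>u. map (f u) ys) [0..<k])) = k * length ys"
  by (induction k) auto

lemma nth_concat_map:
  assumes "u < k" "j < length ys"
  shows "concat (map (\<lambda>u. map (f u) ys) [0..<k]) ! (u * length ys + j) = f u (ys ! j)"
  using assms
proof (induction k)
  case (Suc k)
  show ?case
  proof (cases "u < k")
    case True
    then have "Suc u * length ys \<le> k * length ys" by (intro mult_le_mono1) simp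
    then have "u * length ys + j < k * length ys" using Suc.prems by simp
    then show ?thesis using Suc True by (simp add: nth_append length_concat_map)
  next
    case False
    then have "u = k" using Suc.prems by simp
    then show ?thesis using Suc.prems by (simp add: nth_append length_concat_map)
  qed
qed simp

lemma length_edge_matrix: "length (edge_matrix n E) = n * n"
  unfolding edge_matrix_def by (simp add: length_concat_map)

lemma nth_edge_matrix: "u < n \<Longrightarrow> v < n \<Longrightarrow> edge_matrix n E ! (u * n + v) \<longleftrightarrow> {u, v} \<in> E"
  unfolding edge_matrix_def
  using nth_concat_map[of u n v "[0..<n]" "\<lambda>u v. {u, v} \<in> E"] by simp

lemma less_square: "u < n \<Longrightarrow> v < n \<Longrightarrow> u * n + v < n * (n :: nat)"
  using mult_le_mono1[of "Suc u" n n] by simp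

lemma read_n_spec:
  assumes "var s len_var = length x" "var s n_var = 0"
    and raw: "\<forall>i<length x. raw s (Suc i) = of_bool (x ! i)" and x: "x = replicate n True @ False # ys"
  shows "var (sem (Suc (length x)) read_n s) n_var = n"
proof -
  let ?b = "Suc (length x)"
  let ?c = "Comp (Get bit_var (Plus (Var i_var) (Num 1)))
     (Cond (AND (Var go_var) (Var bit_var)) (Assign n_var (Plus (Var n_var) (Num 1))) (Assign go_var (Num 0)))"
  let ?s = "set_var go_var 1 s"
  define I where "I = (\<lambda>k (t :: state). (var t go_var \<noteq> 0 \<longleftrightarrow> k \<le> n) \<and> var t n_var = min k n)"
  have "I (var ?s len_var) (sem ?b (For i_var len_var ?c) ?s)"
  proof (rule sem_For_frame_invariant)
    show "I 0 ?s" using assms(2) unfolding I_def by simp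
  next
    fix k t assume k: "k < var ?s len_var" and I: "I k t" and r: "\<not> puts ?c \<longrightarrow> raw t = raw ?s"
    have k: "k < length x" using k assms(1) by simp
    have "raw t (Suc k) = of_bool (x ! k)" using r raw k by simp
    moreover have "k \<le> n \<Longrightarrow> x ! k \<longleftrightarrow> k < n" unfolding x by (auto simp: nth_append)
    ultimately show "I (Suc k) (sem ?b ?c (set_var i_var k t))"
      using I k unfolding I_def by (cases "k \<le> n"; cases "k < n") auto
  qed
  moreover have "n \<le> length x" unfolding x by simp
  ultimately show ?thesis using assms(1) unfolding I_def read_n_def by simp
qed

lemma read_edges_spec:
  fixes s :: state
  defines "n \<equiv> var s n_var"
  assumes raw: "\<And>u v. u < n \<Longrightarrow> v < n \<Longrightarrow> u * n + v + n + 2 < bd \<and> raw s (u * n + v + n + 2) = of_bool (e u v)"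
  shows "\<forall>u<n. \<forall>v<n. arr (sem bd read_edges s) edge_arr (u * n + v) = of_bool (e u v)"
proof -
  define I where "I = (\<lambda>W (t :: state). \<forall>u v. (u, v) \<in> W \<longrightarrow> v < n \<longrightarrow> arr t edge_arr (u * n + v) = of_bool (e u v))"
  have "I ({..<var s n_var} \<times> {..<var s n_var}) (sem bd read_edges s)"
    unfolding read_edges_def
  proof (rule sem_For_For_invariant)
    fix u v W and t :: state
    let ?c = "Comp (Get bit_var (Plus (Plus (Times (Var u_var) n_var) (Var v_var)) (Plus (Var n_var) (Num 2))))
       (Update edge_arr (Plus (Times (Var u_var) n_var) (Var v_var)) (Var bit_var))"
    assume uv: "u < var s n_var" "v < var s n_var" and I: "I W t"
      and v: "\<forall>z. z \<notin> {u_var, v_var} \<union> assigned ?c \<longrightarrow> var t z = var s z" "var t u_var = u" "var t v_var = v"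
      and r: "\<not> puts ?c \<longrightarrow> raw t = raw s"
    have n: "var t n_var = n" using v unfolding n_def by simp
    have uv: "u < n" "v < n" using uv unfolding n_def by auto
    have "arr (sem bd ?c t) edge_arr = (arr t edge_arr)(u * n + v := of_bool (e u v))"
      using raw[OF uv] v r n by (simp add: add.assoc)
    then show "I (insert (u, v) W) (sem bd ?c t)"
      using I uv row_major_inject unfolding I_def by auto
  qed (simp_all add: I_def)
  then show ?thesis unfolding I_def n_def by blast
qed

lemma read_list_spec:
  fixes s :: state
  defines "n \<equiv> var s n_var" and "nn \<equiv> var s nn_var" and "v \<equiv> var s v_var"
  assumes m: "var s m_var = length hs"
    and raw: "\<And>i. i < length hs \<Longrightarrow> v * length hs + i + nn + n + 2 < bd \<and>
      raw s (v * length hs + i + nn + n + 2) = of_bool (hs ! i \<in> A)"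
  shows "var (sem bd read_list s) code_var = list_code hs A"
proof -
  let ?c = "Comp (Get bit_var (Plus (Plus (Times (Var v_var) m_var) (Var i_var)) (Plus (Var nn_var) (Plus (Var n_var) (Num 2)))))
       (Assign code_var (Plus (Plus (Var code_var) (Var code_var)) (Var bit_var)))"
  let ?s = "set_var code_var 0 s"
  define I where "I = (\<lambda>k (t :: state). var t code_var = bits_code (map (\<lambda>a. a \<in> A) (take k hs)))"
  have "I (var ?s m_var) (sem bd (For i_var m_var ?c) ?s)"
  proof (rule sem_For_frame_invariant)
    show "I 0 ?s" unfolding I_def bits_code_def by simp
  next
    fix k t assume k: "k < var ?s m_var" and I: "I k t"
      and v: "\<forall>y. y \<notin> assigned (For i_var m_var ?c) \<longrightarrow> var t y = var ?s y"
      and r: "\<not> puts ?c \<longrightarrow> raw t = raw ?s"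
    have k: "k < length hs" using k m by simp
    have "var t v_var = v" "var t m_var = length hs" "var t nn_var = nn" "var t n_var = n"
      using v m unfolding n_def nn_def v_def by simp_all
    then have "var (sem bd ?c (set_var i_var k t)) code_var = var t code_var + var t code_var + of_bool (hs ! k \<in> A)"
      using raw[OF k] r by (simp add: add.assoc)
    then show "I (Suc k) (sem bd ?c (set_var i_var k t))"
      using I k unfolding I_def by (simp add: take_Suc_conv_app_nth bits_code_snoc)
  qed
  then show ?thesis using m unfolding I_def read_list_def list_code_def by simp
qed

lemma read_lists_spec:
  fixes s :: state
  defines "n \<equiv> var s n_var" and "nn \<equiv> var s nn_var"
  assumes m: "var s m_var = length hs" and bad: "var s bad_var = 0"
    and raw: "\<And>v i. v < n \<Longrightarrow> i < length hs \<Longrightarrow> v * length hs + i + nn + n + 2 < bd \<and>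
      raw s (v * length hs + i + nn + n + 2) = of_bool (hs ! i \<in> L v)"
  shows "\<forall>v<n. arr (sem bd read_lists s) code_arr v = list_code hs (L v)"
    and "var (sem bd read_lists s) bad_var \<noteq> 0 \<longleftrightarrow> (\<exists>v<n. list_code hs (L v) = 0)"
proof -
  let ?c = "Comp read_list (Comp (Update code_arr (Var v_var) (Var code_var))
     (Cond (Var code_var) skip (Assign bad_var (Num 1))))"
  define I where "I = (\<lambda>k (t :: state). (\<forall>v<k. arr t code_arr v = list_code hs (L v)) \<and>
    (var t bad_var \<noteq> 0 \<longleftrightarrow> (\<exists>v<k. list_code hs (L v) = 0)))"
  have "I (var s n_var) (sem bd (For v_var n_var ?c) s)"
  proof (rule sem_For_frame_invariant)
    show "I 0 s" unfolding I_def using bad by simp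
  next
    fix k t assume k: "k < var s n_var" and I: "I k t"
      and v: "\<forall>y. y \<notin> assigned (For v_var n_var ?c) \<longrightarrow> var t y = var s y"
      and r: "\<not> puts ?c \<longrightarrow> raw t = raw s"
    let ?t = "set_var v_var k t"
    define t1 where "t1 = sem bd read_list ?t"
    have k: "k < n" using k unfolding n_def .
    have "var ?t n_var = n" "var ?t nn_var = nn" "var ?t v_var = k" "var ?t m_var = length hs"
      using v m unfolding n_def nn_def read_list_def by simp_all
    moreover have "raw ?t = raw s" using r unfolding read_list_def by simp
    ultimately have 1: "var t1 code_var = list_code hs (L k)"
      unfolding t1_def using raw[OF k] by (intro read_list_spec) simp_all
    have 2: "var t1 bad_var = var t bad_var" "arr t1 code_arr = arr t code_arr" "var t1 v_var = k"
      unfolding t1_def by (simp_all add: sem_frame read_list_def)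
    have "sem bd ?c ?t = sem bd (Comp (Update code_arr (Var v_var) (Var code_var))
     (Cond (Var code_var) skip (Assign bad_var (Num 1)))) t1" unfolding t1_def by simp
    moreover have "I (Suc k) \<dots>"
      using I 1 2 unfolding I_def by (auto simp: less_Suc_eq)
    ultimately show "I (Suc k) (sem bd ?c ?t)" by simp
  qed
  then show "\<forall>v<n. arr (sem bd read_lists s) code_arr v = list_code hs (L v)"
    and "var (sem bd read_lists s) bad_var \<noteq> 0 \<longleftrightarrow> (\<exists>v<n. list_code hs (L v) = 0)"
    unfolding I_def read_lists_def n_def by blast+
qed

lemma sizes_boundedI:
  assumes "\<forall>c\<in>set cs. sizes c \<subseteq> Z \<and> assigned c \<inter> Z = {}" "\<forall>z\<in>Z. var s z \<le> M"
  shows "sizes_bounded b M cs s"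
  using assms
proof (induction cs arbitrary: s)
  case (Cons c cs)
  have "var (sem b c s) z = var s z" if "z \<in> Z" for z
    using Cons.prems(1) that by (intro sem_frame) auto
  then show ?case using Cons by auto
qed simp

section \<open>Correctness of the network construction and of the output\<close>

locale lhomed_program = lhomed_instance H ch pa pb qa qb G L n
  for H :: "'a ugraph" and ch pa pb qa qb G L n +
  fixes hs :: "'a list"
  assumes hs: "distinct hs" "set hs = verts H"
begin

lemma m_eq: "m = length hs"
  using hs distinct_card unfolding m_def by metis

text \<open>What the commands after \<open>read_lists\<close> need to know of the instance. It
  concerns only variables 1 to 6 and two arrays, which those commands leave unchanged.\<close>

definition ready :: "state \<Rightarrow> bool" where
  "ready s \<longleftrightarrow> var s n_var = n \<and> var s nn_var = n * n \<and> var s nodes_var = N \<and> var s iter_var = n * n + 1 \<and>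
     var s m_var = m \<and> var s k_var = m + 3 \<and>
     (\<forall>u<n. \<forall>v<n. arr s edge_arr (u * n + v) \<noteq> 0 \<longleftrightarrow> {u, v} \<in> edges G) \<and>
     (\<forall>v<n. arr s code_arr v = list_code hs (L v))"

lemma ready_frame:
  assumes "ready s" "\<forall>z\<in>{1..6}. var t z = var s z" "arr t edge_arr = arr s edge_arr" "arr t code_arr = arr s code_arr"
  shows "ready t"
  using assms unfolding ready_def by simp

lemma ready_sem:
  assumes "ready s" "assigned c \<inter> {1..6} = {}" "edge_arr \<notin> updated c" "code_arr \<notin> updated c"
  shows "ready (sem bd c s)"
proof (rule ready_frame[OF assms(1)])
  show "\<forall>z\<in>{1..6}. var (sem bd c s) z = var s z" using assms(2) by (auto intro!: sem_frame)
qed (use assms sem_frame in auto)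

lemma ready_exps:
  assumes "ready s"
  shows "aval (node_exp u v i) s = node (aval u s) (aval v s) (aval i s)"
    and "aval (arc_exp e e') s = aval e s * N + aval e' s"
    and "aval u s < n \<Longrightarrow> aval v s < n \<Longrightarrow> aval (edge_exp u v) s = of_bool ((aval u s, aval v s) \<in> F)"
  using assms unfolding ready_def node_def F_def by auto

lemma ready_tables:
  assumes "ready s"
  shows "aval u s < n \<Longrightarrow> aval (table hs f (Arr code_arr u)) s = f (L (aval u s))"
    and "aval u s < n \<Longrightarrow> aval v s < n \<Longrightarrow>
      aval (table2 hs g (Arr code_arr u) (Arr code_arr v)) s = g (L (aval u s)) (L (aval v s))"
  using assms lists hs unfolding ready_def by (auto intro!: aval_table aval_table2)

abbreviation arc_address :: "nat \<times> nat \<Rightarrow> nat" where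
  "arc_address z \<equiv> fst z * N + snd z"

lemma fill_units_spec:
  assumes "ready s"
  shows "arr (sem bd (fill_units m) s) cap_arr =
    (\<lambda>k. if k \<in> (\<Union>u<n. \<Union>v<n. arc_address ` unit_arcs u v) then 1 else arr s cap_arr k)"
proof -
  have n: "var s n_var = n" using assms unfolding ready_def by simp
  show ?thesis
    unfolding fill_units_def
  proof (rule For_For_fill, goal_cases)
    case (11 u v t)
    have "ready t" by (rule ready_frame[OF assms]) (use 11 in auto)
    note [simp] = ready_exps[OF this]
    have [simp]: "u < n" "v < n" "var t u_var = u" "var t v_var = v" using 11 n by simp_all
    show ?case by (auto simp: unit_arcs_def simp del: node_exp_simps)
  qed (auto simp: n[simplified])
qed

lemma fill_chains_spec:
  assumes "ready s"
  shows "arr (sem bd fill_chains s) cap_arr =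
    (\<lambda>k. if k \<in> (\<Union>v<n. \<Union>i<m. arc_address ` chain_arcs v i) then n * n + 1 else arr s cap_arr k)"
proof -
  have n: "var s n_var = n" "var s m_var = m" using assms unfolding ready_def by simp_all
  show ?thesis
    unfolding fill_chains_def
  proof (rule For_For_fill, goal_cases)
    case (11 v i t)
    have r: "ready t" by (rule ready_frame[OF assms]) (use 11 in auto)
    note [simp] = ready_exps[OF r]
    have [simp]: "var t v_var = v" "var t i_var = i" "var t iter_var = n * n + 1"
      using 11 r unfolding ready_def by simp_all
    show ?case by (auto simp: chain_arcs_def n simp del: node_exp_simps)
  qed (auto simp: n[simplified])
qed

lemma fill_edges_spec:
  assumes "ready s"
  shows "arr (sem bd (fill_edges hs pa pb qa qb m) s) cap_arr =
    (\<lambda>k. if k \<in> (\<Union>u<n. \<Union>v<n. arc_address ` edge_arcs u v) then n * n + 1 else arr s cap_arr k)"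
proof -
  have n: "var s n_var = n" using assms unfolding ready_def by simp
  show ?thesis
    unfolding fill_edges_def Let_def
  proof (rule For_For_fill, goal_cases)
    case (11 u v t)
    have r: "ready t" by (rule ready_frame[OF assms]) (use 11 in auto)
    have uv: "u < n" "v < n" "var t u_var = u" "var t v_var = v" "var t iter_var = n * n + 1"
      using 11 n r unfolding ready_def by simp_all
    have up: "sem bd (Update cap_arr (arc_exp e e') (Var iter_var)) w =
        w\<lparr>arr := (arr w)(cap_arr := (arr w cap_arr)(aval e w * N + aval e' w := n * n + 1))\<rparr>"
      if "ready w" for e e' w
      using ready_exps(2)[OF that, of e e'] that unfolding ready_def by simp
    have nodes: "aval (node_exp (Var a) (Var b) i) w = node (var w a) (var w b) (aval i w)" if "ready w" for a b i w
      using ready_exps(1)[OF that, of "Var a" "Var b" i] by (simp del: node_exp_simps)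
    have tabs: "aval (table2 hs g (Arr code_arr (Var u_var)) (Arr code_arr (Var v_var))) w = g (L u) (L v)"
      if "ready w" "var w u_var = u" "var w v_var = v" for g w
      using ready_tables(2)[OF that(1), of "Var u_var" "Var v_var" g] that uv by simp
    have rw: "ready (w\<lparr>arr := (arr w)(cap_arr := h)\<rparr>)" if "ready w" for w h
      using that unfolding ready_def by simp
    show ?case
      using ready_exps(3)[OF r, of "Var u_var" "Var v_var"] r uv
      by (simp add: up nodes tabs rw edge_arcs_def n del: sem.simps(2) node_exp_simps) auto
  qed (auto simp: n[simplified])
qed

lemma fill_src_spec:
  assumes "ready s"
  shows "arr (sem bd fill_src s) src_arr =
    (\<lambda>k. if k \<in> (\<Union>v<n. \<Union>i<m + 3. if i = 0 then {node v v i} else {}) then 1 else arr s src_arr k)"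
proof -
  have n: "var s n_var = n" "var s k_var = m + 3" using assms unfolding ready_def by simp_all
  show ?thesis
    unfolding fill_src_def
  proof (rule For_For_fill, goal_cases)
    case (11 v i t)
    have r: "ready t" by (rule ready_frame[OF assms]) (use 11 in auto)
    note [simp] = ready_exps[OF r]
    have [simp]: "var t v_var = v" "var t i_var = i" using 11 by simp_all
    show ?case by (auto simp del: node_exp_simps)
  qed (auto simp: n[simplified])
qed

lemma fill_snk_spec:
  assumes "ready s"
  shows "arr (sem bd (fill_snk hs (\<lambda>A. length (ch A)) m) s) snk_arr =
    (\<lambda>k. if k \<in> (\<Union>v<n. \<Union>i<m + 3. if i \<le> m \<and> len v \<le> i then {node v v i} else {}) then 1 else arr s snk_arr k)"
proof -
  have n: "var s n_var = n" "var s k_var = m + 3" using assms unfolding ready_def by simp_all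
  show ?thesis
    unfolding fill_snk_def
  proof (rule For_For_fill, goal_cases)
    case (11 v i t)
    have r: "ready t" by (rule ready_frame[OF assms]) (use 11 in auto)
    note [simp] = ready_exps[OF r] ready_tables[OF r]
    have [simp]: "var t v_var = v" "var t i_var = i" "v < n" using 11 n by simp_all
    show ?case by (auto simp del: node_exp_simps)
  qed (auto simp: n[simplified])
qed

lemma write_output_spec:
  fixes s :: state
  defines "S \<equiv> {a. arr s dist_arr a \<noteq> 0}"
  assumes r: "ready s" and ok: "var s bad_var = 0" and bd: "n * n + 1 < bd"
  shows "output_in_memory (raw (sem bd (write_output m) s)) (True # edge_matrix n (deleted S))"
proof -
  let ?e = "NOT (NOT (Plus (cut_exp m (Var u_var) (Var v_var)) (cut_exp m (Var v_var) (Var u_var))))"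
  let ?c = "Put (Plus (Plus (Times (Var u_var) n_var) (Var v_var)) (Num 2)) ?e"
  have n: "var s n_var = n" "var s nn_var = n * n" using r unfolding ready_def by simp_all
  define s1 where "s1 = s\<lparr>raw := (raw s)(0 := n * n + 1, 1 := 1)\<rparr>"
  define I where "I = (\<lambda>W (t :: state). raw t 0 = n * n + 1 \<and> raw t 1 = 1 \<and>
    (\<forall>u v. (u, v) \<in> W \<longrightarrow> u < n \<longrightarrow> v < n \<longrightarrow> raw t (u * n + v + 2) = of_bool ({u, v} \<in> deleted S)))"
  have s1: "var s1 n_var = n" using n unfolding s1_def by simp
  have "I ({..<var s1 n_var} \<times> {..<var s1 n_var}) (sem bd (For u_var n_var (For v_var n_var ?c)) s1)"
  proof (rule sem_For_For_invariant)
    fix u v W and t :: state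
    assume uv: "u < var s1 n_var" "v < var s1 n_var" and I: "I W t"
      and v: "\<forall>z. z \<notin> {u_var, v_var} \<union> assigned ?c \<longrightarrow> var t z = var s1 z" "var t u_var = u" "var t v_var = v"
      and a: "\<forall>k. k \<notin> updated ?c \<longrightarrow> arr t k = arr s1 k"
    have uv: "u < n" "v < n" using uv s1 by auto
    have rt: "ready t" by (rule ready_frame[OF r]) (use v a in \<open>auto simp: s1_def\<close>)
    have dist: "arr t dist_arr = arr s dist_arr" using a unfolding s1_def by simp
    have cut: "aval (cut_exp m (Var a) (Var b)) t =
        of_bool ((x, y) \<in> F \<and> node x y (m + 1) \<in> S \<and> node x y (m + 2) \<notin> S)"
      if "var t a = x" "var t b = y" "x < n" "y < n" for a b x y
      using ready_exps[OF rt] that dist unfolding cut_exp_def S_def by (simp del: node_exp_simps)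
    have "{u, v} \<in> deleted S \<longleftrightarrow> ((u, v) \<in> F \<and> node u v (m + 1) \<in> S \<and> node u v (m + 2) \<notin> S) \<or>
        ((v, u) \<in> F \<and> node v u (m + 1) \<in> S \<and> node v u (m + 2) \<notin> S)"
      unfolding deleted_def by (auto simp: doubleton_eq_iff)
    then have e: "aval ?e t = of_bool ({u, v} \<in> deleted S)"
      using cut[OF v(2,3) uv] cut[OF v(3,2) uv(2,1)] by auto
    have "u * n + v + 2 < bd" using less_square[OF uv] bd by simp
    then have "raw (sem bd ?c t) = (raw t)(u * n + v + 2 := of_bool ({u, v} \<in> deleted S))"
      using e v rt unfolding ready_def by (simp del: aval_tests)
    then show "I (insert (u, v) W) (sem bd ?c t)"
      using I uv row_major_inject[of _ n v _ u] unfolding I_def by auto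
  qed (auto simp: I_def s1_def)
  moreover have "sem bd (write_output m) s = sem bd (For u_var n_var (For v_var n_var ?c)) s1"
    using ok n bd unfolding write_output_def s1_def by simp
  ultimately have J: "I ({..<n} \<times> {..<n}) (sem bd (write_output m) s)" unfolding s1 by simp
  show ?thesis
    unfolding output_in_memory_def
  proof (intro conjI allI impI)
    show "raw (sem bd (write_output m) s) 0 = length (True # edge_matrix n (deleted S))"
      using J unfolding I_def by (simp add: length_edge_matrix)
    fix i assume i: "i < length (True # edge_matrix n (deleted S))"
    show "raw (sem bd (write_output m) s) (Suc i) = of_bool ((True # edge_matrix n (deleted S)) ! i)"
    proof (cases i)
      case 0
      then show ?thesis using J unfolding I_def by simp
    next
      case (Suc j)
      then have j: "j < n * n" using i by (simp add: length_edge_matrix)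
      define u v where "u = j div n" and "v = j mod n"
      have "0 < n" using j by (cases n) auto
      then have uv: "u < n" "v < n" "j = u * n + v"
        using j unfolding u_def v_def by (auto simp: less_mult_imp_div_less)
      then have "raw (sem bd (write_output m) s) (u * n + v + 2) = of_bool ({u, v} \<in> deleted S)"
        using J unfolding I_def by blast
      then show ?thesis using nth_edge_matrix[OF uv(1,2)] Suc uv(3) by simp
    qed
  qed
qed

end

context lhomed_program
begin

lemma arc_address_image:
  assumes "R \<subseteq> {..<N} \<times> {..<N}" "y < N"
  shows "x * N + y \<in> arc_address ` R \<longleftrightarrow> (x, y) \<in> R"
proof
  assume "x * N + y \<in> arc_address ` R"
  then obtain p q where pq: "(p, q) \<in> R" "x * N + y = p * N + q" by auto
  then have "q < N" using assms(1) by auto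
  then show "(x, y) \<in> R" using pq row_major_inject[OF assms(2)] by auto
qed force

lemma network_filled:
  fixes s :: state and bd :: nat
  defines "t \<equiv> fold (sem bd) [fill_units m, fill_chains, fill_edges hs pa pb qa qb m, fill_src,
      fill_snk hs (\<lambda>A. length (ch A)) m] s"
  assumes r: "ready s" and z: "arr s cap_arr = (\<lambda>_. 0)" "arr s src_arr = (\<lambda>_. 0)" "arr s snk_arr = (\<lambda>_. 0)"
  shows "network (arr t cap_arr) (arr t src_arr) (arr t snk_arr)" "ready t"
proof -
  define s1 where "s1 = sem bd (fill_units m) s"
  define s2 where "s2 = sem bd fill_chains s1"
  define s3 where "s3 = sem bd (fill_edges hs pa pb qa qb m) s2"
  define s4 where "s4 = sem bd fill_src s3"
  have t: "t = sem bd (fill_snk hs (\<lambda>A. length (ch A)) m) s4"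
    unfolding t_def s1_def s2_def s3_def s4_def by simp
  have r1: "ready s1" unfolding s1_def by (rule ready_sem[OF r]) (auto simp: fill_units_def)
  have r2: "ready s2" unfolding s2_def by (rule ready_sem[OF r1]) (auto simp: fill_chains_def)
  have r3: "ready s3" unfolding s3_def by (rule ready_sem[OF r2]) (auto simp: fill_edges_def Let_def)
  have r4: "ready s4" unfolding s4_def by (rule ready_sem[OF r3]) (auto simp: fill_src_def)
  show "ready t" unfolding t by (rule ready_sem[OF r4]) (auto simp: fill_snk_def)
  note frame = sem_frame com_defs Let_def
  have cap_t: "arr t cap_arr = arr s3 cap_arr" unfolding t s4_def by (simp add: frame)
  have src_t: "arr t src_arr = arr s4 src_arr" unfolding t by (simp add: frame)
  have src_3: "arr s3 src_arr = (\<lambda>_. 0)" unfolding s3_def s2_def s1_def by (simp add: frame z[unfolded One_nat_def])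
  have snk_4: "arr s4 snk_arr = (\<lambda>_. 0)" unfolding s4_def s3_def s2_def s1_def by (simp add: frame z)
  let ?C = "\<Union>v<n. \<Union>i<m. chain_arcs v i" and ?E = "\<Union>u<n. \<Union>v<n. edge_arcs u v"
  \<comment> \<open>The last command to write a cell wins, in accordance with the precedence of
    \<open>rigid\<close> over \<open>units\<close> in \<open>network\<close>.\<close>
  have cap: "arr t cap_arr k = (if k \<in> arc_address ` ?E then n * n + 1 else
      if k \<in> arc_address ` ?C then n * n + 1 else if k \<in> arc_address ` units then 1 else 0)" for k
    unfolding cap_t s3_def fill_edges_spec[OF r2] unfolding s2_def fill_chains_spec[OF r1]
    unfolding s1_def fill_units_spec[OF r] z units_def image_UN by (rule refl)
  have E: "?E \<subseteq> {..<N} \<times> {..<N}" and C: "?C \<subseteq> {..<N} \<times> {..<N}"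
    using rigid_bounded unfolding rigid_def by blast+
  show "network (arr t cap_arr) (arr t src_arr) (arr t snk_arr)"
    unfolding network_def
  proof (intro conjI allI impI)
    fix x y assume "x < N" "y < N"
    then show "arr t cap_arr (x * N + y) = (if (x, y) \<in> rigid then n * n + 1 else of_bool ((x, y) \<in> units))"
      unfolding cap arc_address_image[OF E \<open>y < N\<close>] arc_address_image[OF C \<open>y < N\<close>]
        arc_address_image[OF units_bounded \<open>y < N\<close>] rigid_def by simp
  next
    fix x
    have "arr t src_arr x = (if x \<in> (\<Union>v<n. \<Union>i<m + 3. if i = 0 then {node v v i} else {}) then 1 else 0)"
      unfolding src_t s4_def fill_src_spec[OF r3] src_3 ..
    then show "arr t src_arr x \<noteq> 0 \<longleftrightarrow> (\<exists>v<n. x = node v v 0)" by (auto split: if_splits)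
    have "arr t snk_arr x = (if x \<in> (\<Union>v<n. \<Union>i<m + 3. if i \<le> m \<and> len v \<le> i then {node v v i} else {}) then 1 else 0)"
      unfolding t fill_snk_spec[OF r4] snk_4 ..
    moreover have "x \<in> (\<Union>v<n. \<Union>i<m + 3. if i \<le> m \<and> len v \<le> i then {node v v i} else {}) \<longleftrightarrow>
        (\<exists>v<n. \<exists>i\<le>m. len v \<le> i \<and> x = node v v i)"
    proof
      assume "\<exists>v<n. \<exists>i\<le>m. len v \<le> i \<and> x = node v v i"
      then obtain v i where "v < n" "i \<le> m" "len v \<le> i" "x = node v v i" by blast
      then show "x \<in> (\<Union>v<n. \<Union>i<m + 3. if i \<le> m \<and> len v \<le> i then {node v v i} else {})"
        by (intro UN_I[of v] UN_I[of i]) auto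
    qed (auto split: if_splits)
    ultimately show "arr t snk_arr x \<noteq> 0 \<longleftrightarrow> (\<exists>v<n. \<exists>i\<le>m. len v \<le> i \<and> x = node v v i)" by simp
  qed
qed

section \<open>The run on an encoded instance\<close>

definition instance_bits :: "bool list" where "instance_bits = LHomED_encode hs (G, L)"

lemma instance_bits_eq: "instance_bits = replicate n True @ [False] @ edge_matrix n (edges G) @
    concat (map (\<lambda>v. map (\<lambda>a. a \<in> L v) hs) [0..<n])"
  unfolding instance_bits_def LHomED_encode_def using verts_G by simp

lemma length_instance_bits: "length instance_bits = n + 1 + n * n + n * m"
  unfolding instance_bits_eq m_eq by (simp add: length_edge_matrix length_concat_map)

lemma nth_instance_bits_edge: "u < n \<Longrightarrow> v < n \<Longrightarrow> instance_bits ! (u * n + v + n + 1) \<longleftrightarrow> {u, v} \<in> edges G"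
  using less_square[of u n v] nth_edge_matrix[of u n v "edges G"]
  unfolding instance_bits_eq by (simp add: nth_append length_edge_matrix)

lemma nth_instance_bits_list:
  assumes "v < n" "i < m"
  shows "instance_bits ! (v * m + i + n * n + n + 1) \<longleftrightarrow> hs ! i \<in> L v"
proof -
  have "v * m + i + n * n + n + 1 = length (replicate n True @ [False] @ edge_matrix n (edges G)) + (v * m + i)"
    by (simp add: length_edge_matrix)
  then have "instance_bits ! (v * m + i + n * n + n + 1) = concat (map (\<lambda>v. map (\<lambda>a. a \<in> L v) hs) [0..<n]) ! (v * m + i)"
    unfolding instance_bits_eq append_assoc[symmetric] by (simp only: nth_append_length_plus)
  then show ?thesis using nth_concat_map[of v n i hs "\<lambda>v a. a \<in> L v"] assms unfolding m_eq by simp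
qed

lemma list_index_less: "v < n \<Longrightarrow> i < m \<Longrightarrow> v * m + i < n * m"
  using mult_le_mono1[of "Suc v" n m] by simp

definition bd :: nat where "bd = Suc (length instance_bits)"

abbreviation coms :: "com list" where "coms \<equiv> lhomed_coms hs (\<lambda>A. length (ch A)) pa pb qa qb"

abbreviation init_coms :: "com list" where
  "init_coms \<equiv> [Get len_var (Num 0), read_n, Assign nn_var (Times (Var n_var) n_var), set_sizes m]"

lemma prepared:
  fixes s :: state
  defines "s \<equiv> fold (sem bd) (init_coms @ [read_edges, read_lists]) (initial_state instance_bits)"
  shows "ready s" "arr s cap_arr = (\<lambda>_. 0)" "arr s src_arr = (\<lambda>_. 0)" "arr s snk_arr = (\<lambda>_. 0)"
    "var s bad_var \<noteq> 0 \<longleftrightarrow> (\<exists>v<n. L v = {})"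
    and "sizes_bounded bd (length instance_bits) init_coms (initial_state instance_bits)"
    and "\<forall>z\<in>{1..6}. var (fold (sem bd) init_coms (initial_state instance_bits)) z \<le> (m + 3) * (length instance_bits + 1)"
proof -
  define s1 where "s1 = sem bd (Get len_var (Num 0)) (initial_state instance_bits)"
  define s2 where "s2 = sem bd read_n s1"
  define s3 where "s3 = sem bd (Assign nn_var (Times (Var n_var) n_var)) s2"
  define s4 where "s4 = sem bd (set_sizes m) s3"
  define s5 where "s5 = sem bd read_edges s4"
  have s: "s = sem bd read_lists s5" unfolding s_def s5_def s4_def s3_def s2_def s1_def by simp
  have s4: "fold (sem bd) init_coms (initial_state instance_bits) = s4" unfolding s4_def s3_def s2_def s1_def by simp
  note frame = sem_frame com_defs
  have bits: "raw (initial_state instance_bits) (Suc i) = of_bool (instance_bits ! i)" if "i < length instance_bits" for i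
    using that unfolding initial_state_def by (simp add: input_memory_def)
  have len: "var s1 len_var = length instance_bits" and "var s1 n_var = 0"
    unfolding s1_def bd_def by (simp_all add: initial_state_def input_memory_def)
  moreover have raw1: "raw s1 = raw (initial_state instance_bits)" unfolding s1_def by simp
  ultimately have n2: "var s2 n_var = n"
    unfolding s2_def bd_def using bits instance_bits_eq by (intro read_n_spec[where x = instance_bits]) simp_all
  have len2: "var s2 len_var = length instance_bits" using len unfolding s2_def by (simp add: frame)
  have v4: "var s4 n_var = n" "var s4 nn_var = n * n" "var s4 nodes_var = N" "var s4 iter_var = n * n + 1"
    "var s4 m_var = m" "var s4 k_var = m + 3"
    using n2 unfolding s4_def s3_def set_sizes_def N_def by (simp_all add: algebra_simps)
  have raw4: "raw s4 = raw (initial_state instance_bits)" unfolding s4_def s3_def s2_def using raw1 by (simp add: frame)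
  have edges: "\<forall>u<n. \<forall>v<n. arr s5 edge_arr (u * n + v) = of_bool ({u, v} \<in> edges G)"
    unfolding s5_def v4(1)[symmetric]
  proof (rule read_edges_spec, unfold v4(1))
    fix u v assume uv: "u < n" "v < n"
    have l: "u * n + v + n + 1 < length instance_bits" using less_square[OF uv] unfolding length_instance_bits by simp
    then have "raw s4 (Suc (u * n + v + n + 1)) = of_bool ({u, v} \<in> edges G)"
      unfolding raw4 using bits[OF l] nth_instance_bits_edge[OF uv] by simp
    then show "u * n + v + n + 2 < bd \<and> raw s4 (u * n + v + n + 2) = of_bool ({u, v} \<in> edges G)"
      using l unfolding bd_def by simp
  qed
  have v5: "\<forall>z\<in>{1..6}. var s5 z = var s4 z" unfolding s5_def by (simp add: frame)
  have vars5: "var s5 n_var = n" "var s5 nn_var = n * n" "var s5 m_var = length hs"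
    using v4 v5 m_eq by simp_all
  have raw5: "raw s5 = raw (initial_state instance_bits)" using raw4 unfolding s5_def by (simp add: frame)
  have lists_raw: "v * length hs + i + n * n + n + 2 < bd \<and>
      raw s5 (v * length hs + i + n * n + n + 2) = of_bool (hs ! i \<in> L v)"
    if "v < n" "i < length hs" for v i
  proof -
    have i: "i < m" using that m_eq by simp
    have l: "v * m + i + n * n + n + 1 < length instance_bits"
      using list_index_less[OF that(1) i] unfolding length_instance_bits by simp
    then have "raw s5 (Suc (v * m + i + n * n + n + 1)) = of_bool (hs ! i \<in> L v)"
      unfolding raw5 using bits[OF l] nth_instance_bits_list[OF that(1) i] by simp
    then show ?thesis using l unfolding bd_def m_eq by simp
  qed
  have bad5: "var s5 bad_var = 0"
    unfolding s5_def s4_def s3_def s2_def s1_def by (simp add: frame initial_state_def)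
  have lists6: "\<forall>v<n. arr s code_arr v = list_code hs (L v)"
    and bad: "var s bad_var \<noteq> 0 \<longleftrightarrow> (\<exists>v<n. list_code hs (L v) = 0)"
    unfolding s using read_lists_spec[of s5 hs bd L] lists_raw bad5 vars5 by simp_all
  have "arr s edge_arr = arr s5 edge_arr" unfolding s by (simp add: frame)
  moreover have "\<forall>z\<in>{1..6}. var s z = var s4 z" using v5 unfolding s by (simp add: frame)
  ultimately show "ready s" using v4 edges lists6 unfolding ready_def by simp
  show "arr s cap_arr = (\<lambda>_. 0)" "arr s src_arr = (\<lambda>_. 0)" "arr s snk_arr = (\<lambda>_. 0)"
    unfolding s s5_def s4_def s3_def s2_def s1_def by (simp_all add: frame initial_state_def)
  have "list_code hs (L v) = 0 \<longleftrightarrow> L v = {}" if "v < n" for v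
    using list_code_eq_0_iff[of "L v" hs] lists[OF that] hs by simp
  then show "var s bad_var \<noteq> 0 \<longleftrightarrow> (\<exists>v<n. L v = {})" unfolding bad by auto
  have "n \<le> length instance_bits" "n * n \<le> length instance_bits" unfolding length_instance_bits by simp_all
  then show "sizes_bounded bd (length instance_bits) init_coms (initial_state instance_bits)"
    using len n2 unfolding s1_def s2_def by (simp add: read_n_def set_sizes_def)
  \<comment> \<open>The dominant size is \<open>N = n * n * (m + 3)\<close>, and
    \<open>n * n\<close> is at most the input length because the input contains the adjacency
    matrix.\<close>
  let ?M = "(m + 3) * (length instance_bits + 1)"
  have "N \<le> length instance_bits * (m + 3)"
    unfolding N_def by (intro mult_le_mono1) (simp add: length_instance_bits)
  then have "N \<le> ?M" by (simp add: algebra_simps)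
  moreover have "1 * (length instance_bits + 1) \<le> ?M" by (intro mult_le_mono1) simp
  then have "n \<le> ?M" "n * n \<le> ?M" "n * n + 1 \<le> ?M" by (simp_all add: length_instance_bits)
  moreover have "(m + 3) * 1 \<le> ?M" by (intro mult_le_mono2) simp
  then have "m \<le> ?M" "m + 3 \<le> ?M" by simp_all
  moreover have "z = 1 \<or> z = 2 \<or> z = 3 \<or> z = 4 \<or> z = 5 \<or> z = 6" if "z \<in> {1..6}" for z :: nat
    using that by auto
  ultimately show "\<forall>z\<in>{1..6}. var (fold (sem bd) init_coms (initial_state instance_bits)) z \<le> ?M"
    unfolding s4 using v4 by metis
qed

end

lemma sizes_bounded_append:
  "sizes_bounded b M (cs @ cs') s \<longleftrightarrow> sizes_bounded b M cs s \<and> sizes_bounded b M cs' (fold (sem b) cs s)"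
  by (induction cs arbitrary: s) auto

lemma sizes_bounded_mono: "sizes_bounded b M cs s \<Longrightarrow> M \<le> M' \<Longrightarrow> sizes_bounded b M' cs s"
  by (induction cs arbitrary: s) auto

context lhomed_program
begin

text \<open>After the initial commands all sizes are among variables 1 to 6, which no later command
  assigns, so one bound at that point suffices.\<close>

lemma coms_sizes_bounded: "sizes_bounded bd ((m + 3) * (length instance_bits + 1)) coms (initial_state instance_bits)"
proof -
  let ?rest = "[read_edges, read_lists, fill_units m, fill_chains, fill_edges hs pa pb qa qb m,
      fill_src, fill_snk hs (\<lambda>A. length (ch A)) m, max_flow, write_output m]"
  have eq: "coms = init_coms @ ?rest" unfolding lhomed_coms_def Let_def m_eq by simp
  have "sizes_bounded bd ((m + 3) * (length instance_bits + 1)) init_coms (initial_state instance_bits)"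
  proof (rule sizes_bounded_mono[OF prepared(6)])
    have "1 * (length instance_bits + 1) \<le> (m + 3) * (length instance_bits + 1)" by (intro mult_le_mono1) simp
    then show "length instance_bits \<le> (m + 3) * (length instance_bits + 1)" by simp
  qed
  moreover have "sizes_bounded bd ((m + 3) * (length instance_bits + 1)) ?rest (fold (sem bd) init_coms (initial_state instance_bits))"
  proof (rule sizes_boundedI[OF _ prepared(7)])
    have six: "{1..6} = {1, 2, 3, 4, 5, 6 :: nat}" by auto
    show "\<forall>c\<in>set ?rest. sizes c \<subseteq> {1..6} \<and> assigned c \<inter> {1..6} = {}"
      unfolding six by (simp add: com_defs Let_def)
  qed
  ultimately show ?thesis unfolding eq sizes_bounded_append by (rule conjI)
qed

lemma coms_output:
  "\<exists>y. LHomED_answer H (G, L) y \<and> length y \<le> length instance_bits \<and>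
    output_in_memory (raw (fold (sem bd) coms (initial_state instance_bits))) y"
proof -
  define s where "s = fold (sem bd) (init_coms @ [read_edges, read_lists]) (initial_state instance_bits)"
  define t where "t = fold (sem bd) [fill_units m, fill_chains, fill_edges hs pa pb qa qb m, fill_src,
      fill_snk hs (\<lambda>A. length (ch A)) m] s"
  define u where "u = sem bd max_flow t"
  have final: "fold (sem bd) coms (initial_state instance_bits) = sem bd (write_output m) u"
    unfolding u_def t_def s_def lhomed_coms_def Let_def m_eq by simp
  have s: "ready s" "arr s cap_arr = (\<lambda>_. 0)" "arr s src_arr = (\<lambda>_. 0)" "arr s snk_arr = (\<lambda>_. 0)"
    "var s bad_var \<noteq> 0 \<longleftrightarrow> (\<exists>v<n. L v = {})"
    unfolding s_def by (rule prepared)+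
  have net: "network (arr t cap_arr) (arr t src_arr) (arr t snk_arr)" and t: "ready t"
    unfolding t_def by (rule network_filled[OF s(1-4)])+
  have u: "ready u"
    unfolding u_def by (rule ready_sem[OF t]) (auto simp: com_defs)
  have bad: "var u bad_var = var s bad_var"
    unfolding u_def t_def by (simp add: sem_frame com_defs Let_def)
  have bd: "n * n + 1 < bd" unfolding bd_def length_instance_bits by simp
  have card: "card (verts G) = n" using verts_G by simp
  show ?thesis
  proof (cases "\<forall>v<n. L v \<noteq> {}")
    case True
    define S where "S = {a. arr u dist_arr a \<noteq> 0}"
    have vars: "var t nodes_var = N" "var t iter_var = n * n + 1" using t unfolding ready_def by simp_all
    obtain S0 where S0: "valid_cut N (arr t src_arr) (arr t snk_arr) S0" "cut N (arr t cap_arr) S0 \<le> int (n * n)"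
      using finite_cut_exists[OF net True] by blast
    have "cut N (arr t cap_arr) S0 < int (n * n + 1)" using S0(2) by simp
    note flow = max_flow_spec[where s = t and bd = bd and ?S0.0 = S0, unfolded vars, OF S0(1) this, folded u_def, folded S_def]
    have "min_list_hom_del H G L (deleted S)"
      using min_cut_min_deletion[OF net flow(1) _ flow(2)] flow(2)[OF S0(1)] S0(2) by simp
    moreover have "\<exists>X. list_hom_del H G L X" using True deletion_exists_iff by blast
    ultimately have "LHomED_answer H (G, L) (True # edge_matrix n (deleted S))"
      unfolding LHomED_answer_def by (auto simp: card)
    moreover have "output_in_memory (raw (sem bd (write_output m) u)) (True # edge_matrix n (deleted S))"
      unfolding S_def by (rule write_output_spec[OF u _ bd]) (use True s(5) bad in auto)
    moreover have "length (True # edge_matrix n (deleted S)) \<le> length instance_bits"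
      by (simp add: length_edge_matrix length_instance_bits)
    ultimately show ?thesis unfolding final by blast
  next
    case False
    then have "LHomED_answer H (G, L) [False]"
      unfolding LHomED_answer_def using deletion_exists_iff by auto
    moreover have "output_in_memory (raw (sem bd (write_output m) u)) [False]"
      using False s(5) bad bd unfolding output_in_memory_def write_output_def by simp
    moreover have "length [False] \<le> length instance_bits" by (simp add: length_instance_bits)
    ultimately show ?thesis unfolding final by blast
  qed
qed

end

theorem theorem6p14:
  fixes H :: "'a ugraph"
  assumes "is_graph H"
    and "bi_arc_graph H"
    and "\<not> (\<exists>u v. irreflexive_edge H u v)"
    and "\<not> (\<exists>U \<subseteq> verts H. card U = 3 \<and> has_private_neighbors H U)"
  shows "LHomED_poly_time H"
  unfolding LHomED_poly_time_def
proof (intro allI impI)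
  fix hs assume hs: "distinct hs \<and> set hs = verts H"
  obtain ch pa pb qa qb where ch: "two_monotone_chains H ch pa pb qa qb"
    using two_monotone_chains_exist[OF assms] by blast
  let ?cs = "lhomed_coms hs (\<lambda>A. length (ch A)) pa pb qa qb"
  \<comment> \<open>This polynomial takes the value
    \<open>(m + 3) * (length instance_bits + 1)\<close> at the input length.\<close>
  let ?q = "[:card (verts H) + 3, card (verts H) + 3:]"
  let ?e = "LHomED_encode hs"
  have *: "sizes_bounded (Suc (length (?e i))) (poly ?q (length (?e i))) ?cs (initial_state (?e i))"
    "\<exists>y. LHomED_answer H i y \<and> length y \<le> length (?e i) \<and>
      output_in_memory (raw (fold (sem (Suc (length (?e i)))) ?cs (initial_state (?e i)))) y"
    if inst: "i \<in> LHomED_instances H" for i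
  proof -
    obtain G L where i: "i = (G, L)" by (cases i)
    obtain n where n: "verts G = {..<n}" using inst unfolding i LHomED_instances_def by blast
    interpret lhomed_program H ch pa pb qa qb G L n hs
      by unfold_locales (use assms(1) ch inst i n hs in \<open>auto simp: LHomED_instances_def\<close>)
    have e: "?e i = instance_bits" unfolding i instance_bits_def ..
    have q: "poly ?q (length instance_bits) = (m + 3) * (length instance_bits + 1)" unfolding m_def by (simp add: algebra_simps)
    show "sizes_bounded (Suc (length (?e i))) (poly ?q (length (?e i))) ?cs (initial_state (?e i))"
      unfolding e q bd_def[symmetric] by (rule coms_sizes_bounded)
    show "\<exists>y. LHomED_answer H i y \<and> length y \<le> length (?e i) \<and>
      output_in_memory (raw (fold (sem (Suc (length (?e i)))) ?cs (initial_state (?e i)))) y"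
      unfolding e bd_def[symmetric] unfolding i by (rule coms_output)
  qed
  show "poly_time_solvable (LHomED_instances H) (LHomED_encode hs) (LHomED_answer H)"
    by (rule poly_time_solvableI[OF lhomed_coms_admissible]) (fact *)+
qed

end
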